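(* Let $K$ be a field of characteristic zero and $L/K$ a finite separable extension with Galois closure $E$, $G=\mathrm{Gal}(E/K)$, $G_L=\mathrm{Gal}(E/L)$, $X=G/G_L$. Let $N$ be a finite abelian group with $|N|=|X|$, and let $\alpha_1,\alpha_2:N\hookrightarrow\mathrm{Perm}(X)$ be injective homomorphisms whose images are regular and normalized by $\lambda(G)$, with corresponding embeddings $\beta_1,\beta_2:G\hookrightarrow\mathrm{Hol}(N)$ and automorphism components $\overline{\beta_1},\overline{\beta_2}$. Then $E[\alpha_1(N)]^G\cong E[\alpha_2(N)]^G$ as $K$-algebras if and only if $(\widehat N,\ast_1)\cong(\widehat N,\ast_2)$ as $\Gamma$-sets.
   Context: $X=G/G_L$ is the set of left cosets $\overline{\tau}=\tau G_L$; $\lambda:G\to\mathrm{Perm}(X)$, $\lambda(\sigma)(\overline{\tau})=\overline{\sigma\tau}$. Regular: order $|X|$ and transitive. $G$ acts on $E[\alpha_i(N)]$ by Galois action on $E$ and by $\sigma\ast\nu=\lambda(\sigma)\nu\lambda(\sigma)^{-1}$ on $\alpha_i(N)$; $E[\alpha_i(N)]^G$ is the fixed ring. $\mathrm{Hol}(N)$ is the normalizer in $\mathrm{Perm}(N)$ of the left translations; every $h\in\mathrm{Hol}(N)$ is uniquely $h=r_m\circ\mu$ with $r_m(x)=xm$, $\mu\in\mathrm{Aut}(N)$, and $\overline{h}:=\mu$. With $a_i:N\to X$, $a_i(\eta)=\alpha_i(\eta)(\overline{1})$, $\beta_i(g)=a_i^{-1}\circ\lambda(g)\circ a_i$ and $\overline{\beta_i}(g)=\overline{\beta_i(g)}$.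 Let $\zeta$ be a primitive $e$-th root of unity, $e$ the exponent of $N$, $\tilde E=E(\zeta)$, $\Gamma=\mathrm{Gal}(\tilde E/K)$. $\Gamma$ acts on $N$ by $\gamma\ast_i\eta=\overline{\beta_i}(\gamma|_E)(\eta)$ and on $\widehat N=\mathrm{Hom}(N,\tilde E^\times)$ by $(\gamma\ast_i\chi)(\eta)=\gamma(\chi(\gamma^{-1}\ast_i\eta))$. Isomorphic as $\Gamma$-sets means there is a $\Gamma$-equivariant bijection. *)

theory Defs
  imports
    "HOL-Algebra.Bij"
    "HOL-Algebra.Left_Coset"
    "HOL-Algebra.Group_Action"
    "HOL-Algebra.Module"
    "HOL-Algebra.QuotRing"
    "HOL-Algebra.Multiplicative_Group"
    "HOL-Algebra.Generated_Fields"
    "HOL-Algebra.Finite_Extensions"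
begin

section \<open>Field extensions inside an ambient field\<close>

text \<open>
  All fields are subfields of one ambient field \<open>R\<close>; \<open>R\<lparr>carrier := E\<rparr>\<close> is the subfield \<open>E\<close> as a ring.
\<close>

text \<open>Polynomials are lists with the leading coefficient first.\<close>

definition formal_deriv :: "('a, 'b) ring_scheme \<Rightarrow> 'a list \<Rightarrow> 'a list" where
  "formal_deriv R p =
     ring.normalize R (map (\<lambda>i. [i] \<cdot>\<^bsub>R\<^esub> ring.coeff R p i) (rev [1..<length p]))"

definition separable_poly :: "('a, 'b) ring_scheme \<Rightarrow> 'a set \<Rightarrow> 'a list \<Rightarrow> bool" where
  "separable_poly R K p \<longleftrightarrow>
     (\<forall>d \<in> carrier (K[X]\<^bsub>R\<^esub>).
        d divides\<^bsub>K[X]\<^bsub>R\<^esub>\<^esub> p \<and> d divides\<^bsub>K[X]\<^bsub>R\<^esub>\<^esub> formal_deriv R p \<longrightarrow> d \<in> Units (K[X]\<^bsub>R\<^esub>))"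

definition separable_extension :: "('a, 'b) ring_scheme \<Rightarrow> 'a set \<Rightarrow> 'a set \<Rightarrow> bool" where
  "separable_extension R K E \<longleftrightarrow>
     (\<forall>x \<in> E. ring.algebraic R K x \<and> separable_poly R K (ring.Irr R K x))"

definition normal_extension :: "('a, 'b) ring_scheme \<Rightarrow> 'a set \<Rightarrow> 'a set \<Rightarrow> bool" where
  "normal_extension R K E \<longleftrightarrow>
     (\<forall>x \<in> E. ring.algebraic R K x) \<and>
     (\<forall>p \<in> carrier (K[X]\<^bsub>R\<^esub>).
        pirreducible\<^bsub>R\<^esub> K p \<and> (\<exists>x \<in> E. ring.eval R p x = \<zero>\<^bsub>R\<^esub>)
          \<longrightarrow> ring.splitted (R\<lparr>carrier := E\<rparr>) p)"

definition finite_galois_extension :: "('a, 'b) ring_scheme \<Rightarrow> 'a set \<Rightarrow> 'a set \<Rightarrow> bool" where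
  "finite_galois_extension R K E \<longleftrightarrow>
     subfield E R \<and> K \<subseteq> E \<and> ring.finite_dimension R K E \<and>
     normal_extension R K E \<and> separable_extension R K E"

definition galois_closure :: "('a, 'b) ring_scheme \<Rightarrow> 'a set \<Rightarrow> 'a set \<Rightarrow> 'a set \<Rightarrow> bool" where
  "galois_closure R K L E \<longleftrightarrow>
     L \<subseteq> E \<and> finite_galois_extension R K E \<and>
     (\<forall>M. L \<subseteq> M \<and> M \<subseteq> E \<and> finite_galois_extension R K M \<longrightarrow> M = E)"

definition galois_group :: "('a, 'b) ring_scheme \<Rightarrow> 'a set \<Rightarrow> 'a set \<Rightarrow> ('a \<Rightarrow> 'a) monoid" where
  "galois_group R E K =
     (BijGroup E)\<lparr>carrier :=
        {\<sigma> \<in> Bij E. \<sigma> \<in> ring_hom (R\<lparr>carrier := E\<rparr>) (R\<lparr>carrier := E\<rparr>) \<and> (\<forall>x \<in> K. \<sigma> x = x)}\<rparr>"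

definition primitive_root_of_unity :: "('a, 'b) ring_scheme \<Rightarrow> nat \<Rightarrow> 'a \<Rightarrow> bool" where
  "primitive_root_of_unity R n z \<longleftrightarrow>
     z \<in> carrier R \<and> z [^]\<^bsub>R\<^esub> n = \<one>\<^bsub>R\<^esub> \<and> (\<forall>k. 0 < k \<and> k < n \<longrightarrow> z [^]\<^bsub>R\<^esub> k \<noteq> \<one>\<^bsub>R\<^esub>)"


section \<open>Groups, permutations and the holomorph\<close>

definition group_exponent :: "('n, 'k) monoid_scheme \<Rightarrow> nat" where
  "group_exponent N = (LEAST n. 0 < n \<and> (\<forall>x \<in> carrier N. x [^]\<^bsub>N\<^esub> n = \<one>\<^bsub>N\<^esub>))"

definition regular_subgroup :: "'x set \<Rightarrow> ('x \<Rightarrow> 'x) set \<Rightarrow> bool" where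
  "regular_subgroup S P \<longleftrightarrow>
     subgroup P (BijGroup S) \<and> card P = card S \<and> (\<forall>x \<in> S. \<forall>y \<in> S. \<exists>p \<in> P. p x = y)"

text \<open>Here \<open>\<sigma> <# (\<tau> <# H) = (\<sigma> \<otimes> \<tau>) <# H\<close>.\<close>

definition coset_translation :: "('g, 'k) monoid_scheme \<Rightarrow> 'g set \<Rightarrow> 'g \<Rightarrow> 'g set \<Rightarrow> 'g set" where
  "coset_translation G H \<sigma> = (\<lambda>C \<in> lcosets\<^bsub>G\<^esub> H. \<sigma> <#\<^bsub>G\<^esub> C)"

definition perm_conj ::
    "('g, 'k) monoid_scheme \<Rightarrow> 'g set \<Rightarrow> 'g \<Rightarrow> ('g set \<Rightarrow> 'g set) \<Rightarrow> 'g set \<Rightarrow> 'g set" where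
  "perm_conj G H \<sigma> \<nu> =
     (let S = BijGroup (lcosets\<^bsub>G\<^esub> H)
      in coset_translation G H \<sigma> \<otimes>\<^bsub>S\<^esub> \<nu> \<otimes>\<^bsub>S\<^esub> inv\<^bsub>S\<^esub> (coset_translation G H \<sigma>))"

definition left_translations :: "('n, 'k) monoid_scheme \<Rightarrow> ('n \<Rightarrow> 'n) set" where
  "left_translations N = (\<lambda>n. \<lambda>x \<in> carrier N. n \<otimes>\<^bsub>N\<^esub> x) ` carrier N"

definition holomorph :: "('n, 'k) monoid_scheme \<Rightarrow> ('n \<Rightarrow> 'n) set" where
  "holomorph N = normalizer (BijGroup (carrier N)) (left_translations N)"

definition right_translation :: "('n, 'k) monoid_scheme \<Rightarrow> 'n \<Rightarrow> 'n \<Rightarrow> 'n" where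
  "right_translation N m = (\<lambda>x \<in> carrier N. x \<otimes>\<^bsub>N\<^esub> m)"

text \<open>Meaningful for \<open>h \<in> holomorph N\<close>, where \<open>m\<close> and \<open>\<mu>\<close> exist and are unique by \<open>holomorph_decomposition\<close>.\<close>

definition aut_part :: "('n, 'k) monoid_scheme \<Rightarrow> ('n \<Rightarrow> 'n) \<Rightarrow> 'n \<Rightarrow> 'n" where
  "aut_part N h =
     (THE \<mu>. \<mu> \<in> auto N \<and> (\<exists>m \<in> carrier N. h = compose (carrier N) (right_translation N m) \<mu>))"

lemma (in group) left_translations_subset: "left_translations G \<subseteq> Bij (carrier G)"
proof
  fix t assume "t \<in> left_translations G"
  then obtain n where n: "n \<in> carrier G" and t: "t = (\<lambda>x \<in> carrier G. n \<otimes> x)"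
    by (auto simp: left_translations_def)
  have "bij_betw t (carrier G) (carrier G)"
    by (rule bij_betwI[where g = "\<lambda>x. inv n \<otimes> x"]) (use n in \<open>auto simp: t m_assoc[symmetric]\<close>)
  then show "t \<in> Bij (carrier G)" by (simp add: Bij_def t)
qed

lemma (in group) right_translation_Bij:
  assumes "m \<in> carrier G" shows "right_translation G m \<in> Bij (carrier G)"
proof -
  have "bij_betw (right_translation G m) (carrier G) (carrier G)"
    by (rule bij_betwI[where g = "\<lambda>x. x \<otimes> inv m"])
       (use assms in \<open>auto simp: right_translation_def m_assoc\<close>)
  then show ?thesis by (simp add: Bij_def right_translation_def)
qed

lemma (in group) holomorph_iff:
  "h \<in> holomorph G \<longleftrightarrow>
     h \<in> Bij (carrier G) \<and>
     (let S = BijGroup (carrier G) in h <#\<^bsub>S\<^esub> left_translations G #>\<^bsub>S\<^esub> inv\<^bsub>S\<^esub> h = left_translations G)"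
  using left_translations_subset
  by (auto simp: holomorph_def normalizer_def stabilizer_def BijGroup_def Let_def)

lemma (in group) holomorph_decomposition:
  assumes h: "h \<in> holomorph G"
  shows "\<exists>!(m, \<mu>). m \<in> carrier G \<and> \<mu> \<in> auto G \<and> h = compose (carrier G) (right_translation G m) \<mu>"
proof -
  let ?S = "BijGroup (carrier G)"
  have hB: "h \<in> Bij (carrier G)" using h by (simp add: holomorph_iff)
  have hc: "h x \<in> carrier G" if "x \<in> carrier G" for x
    using Bij_imp_funcset[OF hB] that by auto
  have hom: "h (n \<otimes> x) \<otimes> inv (h \<one>) = (h n \<otimes> inv (h \<one>)) \<otimes> (h x \<otimes> inv (h \<one>))"
    if n: "n \<in> carrier G" and x: "x \<in> carrier G" for n x
  proof -
    define t where "t = (\<lambda>x \<in> carrier G. n \<otimes> x)"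
    have t: "t \<in> left_translations G" using n by (auto simp: left_translations_def t_def)
    then have tB: "t \<in> Bij (carrier G)" using left_translations_subset by auto
    have "h \<otimes>\<^bsub>?S\<^esub> t \<otimes>\<^bsub>?S\<^esub> inv\<^bsub>?S\<^esub> h \<in> h <#\<^bsub>?S\<^esub> left_translations G #>\<^bsub>?S\<^esub> inv\<^bsub>?S\<^esub> h"
      using t by (auto simp: l_coset_def r_coset_def)
    then have "h \<otimes>\<^bsub>?S\<^esub> t \<otimes>\<^bsub>?S\<^esub> inv\<^bsub>?S\<^esub> h \<in> left_translations G"
      using h by (simp add: holomorph_iff Let_def)
    then obtain n' where n': "n' \<in> carrier G"
      and eq: "h \<otimes>\<^bsub>?S\<^esub> t \<otimes>\<^bsub>?S\<^esub> inv\<^bsub>?S\<^esub> h = (\<lambda>x \<in> carrier G. n' \<otimes> x)"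
      by (auto simp: left_translations_def)
    have *: "h (n \<otimes> y) = n' \<otimes> h y" if y: "y \<in> carrier G" for y
    proof -
      have "(h \<otimes>\<^bsub>?S\<^esub> t \<otimes>\<^bsub>?S\<^esub> inv\<^bsub>?S\<^esub> h) (h y) = h (t (inv_into (carrier G) h (h y)))"
        using hB tB hc[OF y] restrict_inv_into_Bij[OF hB]
        by (simp add: inv_BijGroup) (simp add: BijGroup_def compose_Bij compose_eq Bij_inv_into_mem)
      also have "inv_into (carrier G) h (h y) = y"
        using hB y by (auto simp: Bij_def bij_betw_def)
      finally show ?thesis using y n hc[OF y] unfolding eq by (simp add: t_def)
    qed
    have "n' = h n \<otimes> inv (h \<one>)" using *[of \<one>] n n' hc[of \<one>] by (simp add: m_assoc)
    then show ?thesis using *[OF x] n x hc by (simp add: m_assoc)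
  qed
  define \<mu> where "\<mu> = compose (carrier G) (right_translation G (inv (h \<one>))) h"
  have "\<mu> \<in> Bij (carrier G)"
    unfolding \<mu>_def using hB hc by (intro compose_Bij right_translation_Bij) auto
  moreover have "\<mu> \<in> hom G G"
    using hc hom by (auto simp: hom_def \<mu>_def compose_def right_translation_def)
  moreover have "h = compose (carrier G) (right_translation G (h \<one>)) \<mu>"
    using hc Bij_imp_extensional[OF hB]
    by (auto simp: \<mu>_def compose_def right_translation_def m_assoc extensional_def fun_eq_iff)
  ultimately have ex: "\<mu> \<in> auto G" "h = compose (carrier G) (right_translation G (h \<one>)) \<mu>"
    by (auto simp: auto_def)
  have un: "m = h \<one> \<and> \<nu> = \<mu>"
    if "m \<in> carrier G" "\<nu> \<in> auto G" and eq: "h = compose (carrier G) (right_translation G m) \<nu>" for m \<nu>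
  proof -
    have \<nu>: "\<nu> \<in> hom G G" "\<nu> \<in> extensional (carrier G)" using that by (auto simp: auto_def Bij_def)
    interpret \<nu>: group_hom G G \<nu> using \<nu> by unfold_locales
    have m: "h \<one> = m"
      unfolding eq using that(1) by (simp add: compose_def right_translation_def)
    have "h x = \<nu> x \<otimes> m" if "x \<in> carrier G" for x
      unfolding eq using that by (simp add: compose_def right_translation_def)
    then have "\<mu> x = \<nu> x" if "x \<in> carrier G" for x
      using that \<open>m \<in> carrier G\<close> hc by (simp add: \<mu>_def m compose_def right_translation_def m_assoc)
    moreover have "\<mu> \<in> extensional (carrier G)" by (simp add: \<mu>_def)
    ultimately show ?thesis using \<nu>(2) m by (auto intro: extensionalityI)
  qed
  show ?thesis
    by (rule ex1I[of _ "(h \<one>, \<mu>)"]) (use ex hc un in auto)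
qed

corollary (in group) aut_part:
  assumes "h \<in> holomorph G"
  shows "aut_part G h \<in> auto G"
    and "\<exists>m \<in> carrier G. h = compose (carrier G) (right_translation G m) (aut_part G h)"
proof -
  have "\<exists>!\<mu>. \<mu> \<in> auto G \<and> (\<exists>m \<in> carrier G. h = compose (carrier G) (right_translation G m) \<mu>)"
    using holomorph_decomposition[OF assms] by (auto simp: split_paired_Ex)
  from theI'[OF this]
  show "aut_part G h \<in> auto G"
    and "\<exists>m \<in> carrier G. h = compose (carrier G) (right_translation G m) (aut_part G h)"
    by (auto simp: aut_part_def)
qed

definition base_orbit_map ::
    "('g, 'k) monoid_scheme \<Rightarrow> 'g set \<Rightarrow> ('n \<Rightarrow> 'g set \<Rightarrow> 'g set) \<Rightarrow> 'n \<Rightarrow> 'g set" where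
  "base_orbit_map G H \<alpha> \<eta> = \<alpha> \<eta> (\<one>\<^bsub>G\<^esub> <#\<^bsub>G\<^esub> H)"

definition hol_embedding ::
    "('n, 'j) monoid_scheme \<Rightarrow> ('g, 'k) monoid_scheme \<Rightarrow> 'g set
      \<Rightarrow> ('n \<Rightarrow> 'g set \<Rightarrow> 'g set) \<Rightarrow> 'g \<Rightarrow> 'n \<Rightarrow> 'n" where
  "hol_embedding N G H \<alpha> g =
     (\<lambda>\<eta> \<in> carrier N. inv_into (carrier N) (base_orbit_map G H \<alpha>)
        (coset_translation G H g (base_orbit_map G H \<alpha> \<eta>)))"

lemma hol_embedding_in_holomorph:
  fixes N (structure)
  assumes "group N" "finite (carrier N)" "monoid G"
    and card: "order N = card (lcosets\<^bsub>G\<^esub> H)"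
    and \<alpha>: "\<alpha> \<in> hom N (BijGroup (lcosets\<^bsub>G\<^esub> H))"
    and reg: "regular_subgroup (lcosets\<^bsub>G\<^esub> H) (\<alpha> ` carrier N)"
    and nrm: "coset_translation G H ` carrier G \<subseteq> normalizer (BijGroup (lcosets\<^bsub>G\<^esub> H)) (\<alpha> ` carrier N)"
    and g: "g \<in> carrier G"
  shows "hol_embedding N G H \<alpha> g \<in> holomorph N"
proof -
  interpret group N by fact
  interpret G: monoid G by fact
  define Q where "Q = lcosets\<^bsub>G\<^esub> H"
  define l where "l = coset_translation G H g"
  define a where "a = base_orbit_map G H \<alpha>"
  define h where "h = hol_embedding N G H \<alpha> g"
  let ?S = "BijGroup Q" and ?T = "BijGroup (carrier N)"
  interpret S: group ?S by (rule group_BijGroup)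
  interpret T: group ?T by (rule group_BijGroup)
  have carS: "carrier ?S = Bij Q" and carT: "carrier ?T = Bij (carrier N)" by (simp_all add: BijGroup_def)
  have \<alpha>B: "\<alpha> n \<in> Bij Q" if "n \<in> carrier N" for n
    using \<alpha> that by (auto simp: hom_def Q_def BijGroup_def)
  have apS: "(p \<otimes>\<^bsub>?S\<^esub> q) x = p (q x)" if "p \<in> Bij Q" "q \<in> Bij Q" "x \<in> Q" for p q x
    using that by (simp add: BijGroup_def compose_def)
  have apT: "(p \<otimes>\<^bsub>?T\<^esub> q) x = p (q x)" if "p \<in> Bij (carrier N)" "q \<in> Bij (carrier N)" "x \<in> carrier N" for p q x
    using that by (simp add: BijGroup_def compose_def)
  have b: "\<one>\<^bsub>G\<^esub> <#\<^bsub>G\<^esub> H \<in> Q" by (auto simp: Q_def LCOSETS_def)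
  have aQ: "a n \<in> Q" if "n \<in> carrier N" for n
    using Bij_imp_funcset[OF \<alpha>B[OF that]] b by (auto simp: a_def base_orbit_map_def)
  have "a ` carrier N = Q"
  proof
    show "Q \<subseteq> a ` carrier N"
    proof
      fix y assume "y \<in> Q"
      then obtain n where "n \<in> carrier N" "\<alpha> n (\<one>\<^bsub>G\<^esub> <#\<^bsub>G\<^esub> H) = y"
        using reg b unfolding regular_subgroup_def Q_def by blast
      then show "y \<in> a ` carrier N" by (auto simp: a_def base_orbit_map_def)
    qed
  qed (use aQ in auto)
  moreover from this have "inj_on a (carrier N)"
    using card assms(2) by (intro eq_card_imp_inj_on) (auto simp: order_def Q_def)
  ultimately have abij: "bij_betw a (carrier N) Q" by (simp add: bij_betw_def)
  have lB: "l \<in> Bij Q"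
    and lnorm: "l <#\<^bsub>?S\<^esub> (\<alpha> ` carrier N) #>\<^bsub>?S\<^esub> inv\<^bsub>?S\<^esub> l = \<alpha> ` carrier N"
  proof -
    have "l \<in> normalizer ?S (\<alpha> ` carrier N)" using nrm g by (auto simp: l_def Q_def)
    moreover have "\<alpha> ` carrier N \<subseteq> carrier ?S" using \<alpha>B carS by auto
    ultimately show "l \<in> Bij Q" "l <#\<^bsub>?S\<^esub> (\<alpha> ` carrier N) #>\<^bsub>?S\<^esub> inv\<^bsub>?S\<^esub> l = \<alpha> ` carrier N"
      by (auto simp: normalizer_def stabilizer_def carS)
  qed
  have lbij: "bij_betw l Q Q" using lB by (simp add: Bij_def)
  have h_eq: "h = (\<lambda>\<eta> \<in> carrier N. inv_into (carrier N) a (l (a \<eta>)))"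
    by (simp add: h_def hol_embedding_def a_def l_def)
  have "bij_betw (inv_into (carrier N) a \<circ> (l \<circ> a)) (carrier N) (carrier N)"
    using bij_betw_trans[OF bij_betw_trans[OF abij lbij] bij_betw_inv_into[OF abij]] .
  then have "bij_betw h (carrier N) (carrier N)"
    by (rule bij_betw_cong[THEN iffD1, rotated]) (simp add: h_eq)
  then have hB: "h \<in> Bij (carrier N)" by (simp add: Bij_def h_eq)
  then have hc: "h x \<in> carrier N" if "x \<in> carrier N" for x
    using that Bij_imp_funcset by blast
  have ah: "a (h x) = l (a x)" if "x \<in> carrier N" for x
    using that bij_betw_inv_into_right[OF abij] bij_betwE[OF lbij] aQ[OF that] by (simp add: h_eq)
  have a_mult: "a (n \<otimes> x) = \<alpha> n (a x)" if "n \<in> carrier N" "x \<in> carrier N" for n x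
  proof -
    have "\<alpha> (n \<otimes> x) = \<alpha> n \<otimes>\<^bsub>?S\<^esub> \<alpha> x" using \<alpha> that by (simp add: hom_def Q_def)
    then show ?thesis using apS[OF \<alpha>B[OF that(1)] \<alpha>B[OF that(2)] b] by (simp add: a_def base_orbit_map_def)
  qed
  define t where "t n = (\<lambda>x \<in> carrier N. n \<otimes> x)" for n
  have LT: "left_translations N = t ` carrier N" by (simp add: left_translations_def t_def)
  have tB: "t n \<in> Bij (carrier N)" if "n \<in> carrier N" for n
    using that left_translations_subset LT by auto
  have key: "h \<otimes>\<^bsub>?T\<^esub> t n \<otimes>\<^bsub>?T\<^esub> inv\<^bsub>?T\<^esub> h = t n'"
    if n: "n \<in> carrier N" and n': "n' \<in> carrier N"
      and eq: "l \<otimes>\<^bsub>?S\<^esub> \<alpha> n \<otimes>\<^bsub>?S\<^esub> inv\<^bsub>?S\<^esub> l = \<alpha> n'" for n n'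
  proof -
    have "l \<otimes>\<^bsub>?S\<^esub> \<alpha> n = \<alpha> n' \<otimes>\<^bsub>?S\<^esub> l"
      using eq lB \<alpha>B[OF n] \<alpha>B[OF n'] S.inv_solve_right' S.m_closed unfolding carS[symmetric] by blast
    then have *: "l (\<alpha> n y) = \<alpha> n' (l y)" if "y \<in> Q" for y
      using that apS[OF lB \<alpha>B[OF n] that] apS[OF \<alpha>B[OF n'] lB that] by simp
    have "h \<otimes>\<^bsub>?T\<^esub> t n = t n' \<otimes>\<^bsub>?T\<^esub> h"
    proof (rule extensionalityI[of _ "carrier N"])
      show "h \<otimes>\<^bsub>?T\<^esub> t n \<in> extensional (carrier N)" "t n' \<otimes>\<^bsub>?T\<^esub> h \<in> extensional (carrier N)"
        using hB tB n n' by (simp_all add: BijGroup_def)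
      fix x assume x: "x \<in> carrier N"
      have "a (h (n \<otimes> x)) = a (n' \<otimes> h x)"
        using x n n' hc[OF x] aQ[OF x] by (simp add: ah a_mult *)
      then have "h (n \<otimes> x) = n' \<otimes> h x"
        using abij x n n' hc by (auto simp: bij_betw_def inj_on_def)
      then show "(h \<otimes>\<^bsub>?T\<^esub> t n) x = (t n' \<otimes>\<^bsub>?T\<^esub> h) x"
        using x hc[OF x] hB tB[OF n] tB[OF n'] by (simp add: apT t_def)
    qed
    then show ?thesis
      using hB tB[OF n] tB[OF n'] T.inv_solve_right' T.m_closed unfolding carT[symmetric] by blast
  qed
  have "h <#\<^bsub>?T\<^esub> left_translations N #>\<^bsub>?T\<^esub> inv\<^bsub>?T\<^esub> h = left_translations N"
  proof (intro equalityI subsetI)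
    fix f assume "f \<in> h <#\<^bsub>?T\<^esub> left_translations N #>\<^bsub>?T\<^esub> inv\<^bsub>?T\<^esub> h"
    then obtain n where n: "n \<in> carrier N" and f: "f = h \<otimes>\<^bsub>?T\<^esub> t n \<otimes>\<^bsub>?T\<^esub> inv\<^bsub>?T\<^esub> h"
      by (auto simp: l_coset_def r_coset_def LT)
    have "l \<otimes>\<^bsub>?S\<^esub> \<alpha> n \<otimes>\<^bsub>?S\<^esub> inv\<^bsub>?S\<^esub> l \<in> \<alpha> ` carrier N"
      using n by (subst lnorm[symmetric]) (auto simp: l_coset_def r_coset_def)
    then show "f \<in> left_translations N" using key[OF n] f LT by auto
  next
    fix f assume "f \<in> left_translations N"
    then obtain n' where n': "n' \<in> carrier N" and f: "f = t n'" by (auto simp: LT)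
    have "\<alpha> n' \<in> l <#\<^bsub>?S\<^esub> (\<alpha> ` carrier N) #>\<^bsub>?S\<^esub> inv\<^bsub>?S\<^esub> l" using n' lnorm by auto
    then obtain n where n: "n \<in> carrier N" and "l \<otimes>\<^bsub>?S\<^esub> \<alpha> n \<otimes>\<^bsub>?S\<^esub> inv\<^bsub>?S\<^esub> l = \<alpha> n'"
      by (auto simp: l_coset_def r_coset_def)
    then show "f \<in> h <#\<^bsub>?T\<^esub> left_translations N #>\<^bsub>?T\<^esub> inv\<^bsub>?T\<^esub> h"
      using key[OF n n'] f n by (auto simp: l_coset_def r_coset_def LT intro!: bexI[of _ n])
  qed
  then show ?thesis using hB by (simp add: holomorph_iff h_def Let_def)
qed


section \<open>Group algebras and their fixed rings\<close>

text \<open>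
  An element \<open>\<Sum>h. x\<^sub>h h\<close> of the group algebra of a finite group \<open>H\<close> over \<open>F\<close> is its coefficient
  function \<open>h \<mapsto> x\<^sub>h\<close>.
\<close>

definition group_algebra ::
    "('a, 'b) ring_scheme \<Rightarrow> ('h, 'k) monoid_scheme \<Rightarrow> ('a, 'h \<Rightarrow> 'a) module" where
  "group_algebra F H =
     \<lparr>carrier = carrier H \<rightarrow>\<^sub>E carrier F,
      monoid.mult = (\<lambda>x y. \<lambda>h \<in> carrier H. \<Oplus>\<^bsub>F\<^esub>k \<in> carrier H. x k \<otimes>\<^bsub>F\<^esub> y (inv\<^bsub>H\<^esub> k \<otimes>\<^bsub>H\<^esub> h)),
      one = (\<lambda>h \<in> carrier H. if h = \<one>\<^bsub>H\<^esub> then \<one>\<^bsub>F\<^esub> else \<zero>\<^bsub>F\<^esub>),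
      zero = (\<lambda>h \<in> carrier H. \<zero>\<^bsub>F\<^esub>),
      add = (\<lambda>x y. \<lambda>h \<in> carrier H. x h \<oplus>\<^bsub>F\<^esub> y h),
      smult = (\<lambda>c x. \<lambda>h \<in> carrier H. c \<otimes>\<^bsub>F\<^esub> x h)\<rparr>"

text \<open>
  \<open>\<sigma>\<close> maps \<open>\<Sum>\<nu>. x\<^sub>\<nu> \<nu>\<close> to \<open>\<Sum>\<nu>. \<sigma>(x\<^sub>\<nu>) (\<sigma> * \<nu>)\<close>, whose coefficient at \<open>\<nu>\<close> is \<open>\<sigma>\<close> of the coefficient
  of \<open>x\<close> at \<open>\<sigma>\<^sup>-\<^sup>1 * \<nu>\<close>.
\<close>

definition group_algebra_action ::
    "('a \<Rightarrow> 'a) monoid \<Rightarrow> ('a \<Rightarrow> 'a) set \<Rightarrow> (('a \<Rightarrow> 'a) set \<Rightarrow> ('a \<Rightarrow> 'a) set) set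
      \<Rightarrow> ('a \<Rightarrow> 'a)
      \<Rightarrow> ((('a \<Rightarrow> 'a) set \<Rightarrow> ('a \<Rightarrow> 'a) set) \<Rightarrow> 'a)
      \<Rightarrow> (('a \<Rightarrow> 'a) set \<Rightarrow> ('a \<Rightarrow> 'a) set) \<Rightarrow> 'a" where
  "group_algebra_action G H P \<sigma> x = (\<lambda>\<nu> \<in> P. \<sigma> (x (perm_conj G H (inv\<^bsub>G\<^esub> \<sigma>) \<nu>)))"

text \<open>For \<open>P\<close> a subgroup of \<open>Perm(G/H)\<close> normalised by \<open>G\<close>, this is the fixed ring \<open>E[P]\<^sup>G\<close>.\<close>

definition fixed_group_algebra ::
    "('a, 'b) ring_scheme \<Rightarrow> 'a set \<Rightarrow> ('a \<Rightarrow> 'a) monoid \<Rightarrow> ('a \<Rightarrow> 'a) set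
      \<Rightarrow> (('a \<Rightarrow> 'a) set \<Rightarrow> ('a \<Rightarrow> 'a) set) set
      \<Rightarrow> ('a, (('a \<Rightarrow> 'a) set \<Rightarrow> ('a \<Rightarrow> 'a) set) \<Rightarrow> 'a) module" where
  "fixed_group_algebra R E G H P =
     (let A = group_algebra (R\<lparr>carrier := E\<rparr>) ((BijGroup (lcosets\<^bsub>G\<^esub> H))\<lparr>carrier := P\<rparr>)
      in A\<lparr>carrier := {x \<in> carrier A. \<forall>\<sigma> \<in> carrier G. group_algebra_action G H P \<sigma> x = x}\<rparr>)"

definition algebra_isomorphic ::
    "'a set \<Rightarrow> ('a, 'c, 'm) module_scheme \<Rightarrow> ('a, 'd, 'n) module_scheme \<Rightarrow> bool" where
  "algebra_isomorphic K A B \<longleftrightarrow>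
     (\<exists>f \<in> ring_iso A B. \<forall>k \<in> K. \<forall>x \<in> carrier A. f (k \<odot>\<^bsub>A\<^esub> x) = k \<odot>\<^bsub>B\<^esub> f x)"


section \<open>Characters\<close>

definition characters :: "('n, 'j) monoid_scheme \<Rightarrow> ('a, 'b) ring_scheme \<Rightarrow> ('n \<Rightarrow> 'a) set" where
  "characters N F = hom N (mult_of F) \<inter> extensional (carrier N)"

text \<open>
  In the next two definitions \<open>\<Gamma>\<close> is a group of automorphisms of an extension field of \<open>E\<close>, with
  \<open>restrict \<gamma> E\<close> in the group \<open>G\<close> of automorphisms of \<open>E\<close>.
\<close>

definition galois_act_group ::
    "('n, 'j) monoid_scheme \<Rightarrow> 'a set \<Rightarrow> ('a \<Rightarrow> 'a) monoid \<Rightarrow> ('a \<Rightarrow> 'a) set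
      \<Rightarrow> ('n \<Rightarrow> ('a \<Rightarrow> 'a) set \<Rightarrow> ('a \<Rightarrow> 'a) set) \<Rightarrow> ('a \<Rightarrow> 'a) \<Rightarrow> 'n \<Rightarrow> 'n" where
  "galois_act_group N E G H \<alpha> \<gamma> \<eta> = aut_part N (hol_embedding N G H \<alpha> (restrict \<gamma> E)) \<eta>"

definition galois_act_char ::
    "('n, 'j) monoid_scheme \<Rightarrow> 'a set \<Rightarrow> ('a \<Rightarrow> 'a) monoid \<Rightarrow> ('a \<Rightarrow> 'a) set
      \<Rightarrow> ('a \<Rightarrow> 'a) monoid \<Rightarrow> ('n \<Rightarrow> ('a \<Rightarrow> 'a) set \<Rightarrow> ('a \<Rightarrow> 'a) set)
      \<Rightarrow> ('a \<Rightarrow> 'a) \<Rightarrow> ('n \<Rightarrow> 'a) \<Rightarrow> 'n \<Rightarrow> 'a" where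
  "galois_act_char N E G H \<Gamma> \<alpha> \<gamma> \<chi> =
     (\<lambda>\<eta> \<in> carrier N. \<gamma> (\<chi> (galois_act_group N E G H \<alpha> (inv\<^bsub>\<Gamma>\<^esub> \<gamma>) \<eta>)))"

definition gset_isomorphic ::
    "('g, 'k) monoid_scheme \<Rightarrow> 's set \<Rightarrow> ('g \<Rightarrow> 's \<Rightarrow> 's) \<Rightarrow> 't set \<Rightarrow> ('g \<Rightarrow> 't \<Rightarrow> 't) \<Rightarrow> bool" where
  "gset_isomorphic \<Gamma> S act1 T act2 \<longleftrightarrow>
     (\<exists>f. bij_betw f S T \<and> (\<forall>\<gamma> \<in> carrier \<Gamma>. \<forall>s \<in> S. f (act1 \<gamma> s) = act2 \<gamma> (f s)))"

end

theory Submission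
  imports Defs "HOL-Algebra.Algebraic_Closure"
begin

text \<open>
  Over \<open>E(\<zeta>)\<close> the Fourier transform identifies \<open>E(\<zeta>)[N]\<close> with the functions on \<open>N^\<close>, and
  \<open>E[\<alpha>\<^sub>i(N)]\<^sup>G\<close> with the \<open>\<Gamma>\<close>-equivariant functions from \<open>(N^, *\<^sub>i)\<close> to \<open>E(\<zeta>)\<close>.  So it suffices to
  recover a finite \<open>\<Gamma>\<close>-set \<open>S\<close> from the \<open>K\<close>-algebra of equivariant functions on it: its \<open>K\<close>-algebra
  homomorphisms to \<open>E(\<zeta>)\<close> are exactly the evaluations at points of \<open>S\<close>.  Distinct points give distinct
  evaluations by Dedekind's independence of field automorphisms.  Conversely, a homomorphism \<open>\<phi>\<close> maps
  each \<open>f\<close> to a root of \<open>\<Prod>s. X - f(s) \<in> K[X]\<close>, hence to some \<open>f(s)\<close>, and since \<open>K\<close> is infinite one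
  point \<open>s\<close> serves all \<open>f\<close>.
\<close>

section \<open>Finite sets with a group action and their algebras\<close>

text \<open>Characters take values outside E, so the Fourier transform must be taken over
  E(\<zeta>), whereas the fixed rings have coefficients in E and carry an action of G only. The two
  sides meet because \<Gamma> acts on N through restriction to E: an element of \<Gamma> that is
  trivial on E acts trivially on N, so \<Gamma>-invariance of a coefficient function on N with
  values in E(\<zeta>) forces these values into E, and surjectivity of restriction then gives the
  invariance that defines the fixed ring. Regularity moves the action from permutations to N:
  conjugating \<alpha>(n) by \<lambda>(g) gives \<alpha> of the image of n under the automorphism
  component of \<beta>(g). Characteristic zero serves to divide by the exponent and the order of N
  and by the number of characters, to make K infinite, and to recover an element from a coefficient
  of its minimal polynomial. Taking functions reverses arrows; as both \<Gamma>-sets live on the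
  same finite set of characters, an injective equivariant map is already an isomorphism.\<close>

lemma (in abelian_monoid) finsum_swap:
  assumes "finite A" "finite B" "\<And>x y. x \<in> A \<Longrightarrow> y \<in> B \<Longrightarrow> f x y \<in> carrier G"
  shows "(\<Oplus>x\<in>A. \<Oplus>y\<in>B. f x y) = (\<Oplus>y\<in>B. \<Oplus>x\<in>A. f x y)"
  using assms(1,3)
proof (induction A rule: finite_induct)
  case empty
  then show ?case by simp
next
  case (insert a A)
  have "(\<Oplus>x\<in>insert a A. \<Oplus>y\<in>B. f x y) = (\<Oplus>y\<in>B. f a y) \<oplus> (\<Oplus>y\<in>B. \<Oplus>x\<in>A. f x y)"
    using insert by (subst finsum_insert) (auto intro!: finsum_closed)
  also have "\<dots> = (\<Oplus>y\<in>B. f a y \<oplus> (\<Oplus>x\<in>A. f x y))"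
    using insert by (subst finsum_addf) (auto intro!: finsum_closed)
  also have "\<dots> = (\<Oplus>y\<in>B. \<Oplus>x\<in>insert a A. f x y)"
    using insert by (intro finsum_cong') (auto intro!: finsum_closed simp: finsum_insert Pi_def)
  finally show ?case .
qed

lemma map_poly_ring_hom:
  assumes h: "h \<in> ring_hom A B" and "field A" "field B"
  shows "map h \<in> ring_hom (poly_ring A) (poly_ring B)"
proof (rule ring_hom_memI)
  interpret A: field A by fact
  interpret B: field B by fact
  interpret ring_hom_ring A B h using h by (intro ring_hom_ringI2 A.is_ring B.is_ring)
  interpret UP: domain "poly_ring A" by (rule A.univ_poly_is_domain[OF A.carrier_is_subring])
  note closed = polynomial_hom[OF h assms(2,3)]
  fix p q assume p: "p \<in> carrier (poly_ring A)" and q: "q \<in> carrier (poly_ring A)"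
  show "map h p \<in> carrier (poly_ring B)" by (rule closed[OF p])
  have *: "set p \<subseteq> carrier A" "set q \<subseteq> carrier A"
    using p q by (auto simp flip: univ_poly_carrier dest: A.polynomial_incl)
  \<comment> \<open>\<open>poly_mult_hom'\<close> and \<open>poly_add_hom'\<close> hold up to
    normalization. A homomorphism of fields is injective, so leading coefficients stay nonzero and
    normalizing changes nothing.\<close>
  have norm: "B.normalize (map h r) = map h r" if "r \<in> carrier (poly_ring A)" for r
    using closed[OF that] by (simp add: B.normalize_polynomial flip: univ_poly_carrier)
  show "map h (p \<otimes>\<^bsub>poly_ring A\<^esub> q) = map h p \<otimes>\<^bsub>poly_ring B\<^esub> map h q"
    using poly_mult_hom'[OF *] norm[OF UP.m_closed[OF p q]] by (simp add: univ_poly_mult)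
  show "map h (p \<oplus>\<^bsub>poly_ring A\<^esub> q) = map h p \<oplus>\<^bsub>poly_ring B\<^esub> map h q"
    using poly_add_hom'[OF *] norm[OF UP.a_closed[OF p q]] by (simp add: univ_poly_add)
next
  show "map h \<one>\<^bsub>poly_ring A\<^esub> = \<one>\<^bsub>poly_ring B\<^esub>"
    using ring_hom_one[OF h] by (simp add: univ_poly_one)
qed

lemma (in ring) add_pow_in_subring:
  assumes "subring K R" "k \<in> K" shows "[(n::nat)] \<cdot> k \<in> K"
  using subringE[OF assms(1)] assms(2) by (induction n) auto

lemma (in ring) add_pow_inj_of_char_zero:
  assumes "\<And>n::nat. 0 < n \<Longrightarrow> [n] \<cdot> \<one> \<noteq> \<zero>"
  shows "inj (\<lambda>n::nat. [n] \<cdot> \<one>)"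
proof -
  have "m = n" if "[m] \<cdot> \<one> = [n] \<cdot> \<one>" "m \<le> n" for m n :: nat
  proof -
    have "[n] \<cdot> \<one> = [m] \<cdot> \<one> \<oplus> [(n - m)] \<cdot> \<one>"
      using that(2) by (subst add.nat_pow_mult) auto
    then have "[(n - m)] \<cdot> \<one> = \<zero>" using that(1) add.nat_pow_closed[OF one_closed]
      by (metis add.l_cancel_one)
    then show ?thesis using assms[of "n - m"] that(2) by fastforce
  qed
  then show ?thesis by (intro injI) (metis nat_le_linear)
qed

section \<open>Dedekind's independence of field homomorphisms\<close>

lemma (in cring) mult_diff_expand:
  assumes "a \<in> carrier R" "x \<in> carrier R" "y \<in> carrier R" "z \<in> carrier R"
  shows "(a \<otimes> (x \<ominus> y)) \<otimes> z = a \<otimes> (x \<otimes> z) \<oplus> (\<ominus> y) \<otimes> (a \<otimes> z)"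
  using assms by algebra

text \<open>The elimination step of the independence proof: \<open>a \<otimes> x\<close> comes from
  the homomorphism to be removed, and subtracting \<open>y\<close> times the second relation from
  the first removes it.\<close>

lemma (in cring) cancel_scaled_relation:
  assumes "S \<in> carrier R" "T \<in> carrier R" "a \<in> carrier R" "x \<in> carrier R" "y \<in> carrier R"
    and "a \<otimes> (y \<otimes> x) \<oplus> S = \<zero>" "a \<otimes> x \<oplus> T = \<zero>"
  shows "S \<oplus> (\<ominus> y) \<otimes> T = \<zero>"
proof -
  have "S \<oplus> (\<ominus> y) \<otimes> T = (a \<otimes> (y \<otimes> x) \<oplus> S) \<ominus> y \<otimes> (a \<otimes> x \<oplus> T)"
    using assms(1-5) by algebra
  then show ?thesis using assms by simp
qed

text \<open>Comparing the relation at a product \<open>y \<otimes> x\<close> with \<open>d y\<close>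
  times the relation at \<open>x\<close> eliminates \<open>d\<close> and multiplies the coefficient
  of each remaining \<open>h\<close> by \<open>h y \<ominus> d y\<close>. The element
  \<open>y\<close> is chosen anew for each \<open>h\<close>, so that this factor is nonzero for the
  \<open>h\<close> under consideration.\<close>

lemma (in field) ring_homs_independent:
  assumes "finite H" "\<And>h. h \<in> H \<Longrightarrow> h \<in> ring_hom R R"
    and "\<And>g h. g \<in> H \<Longrightarrow> h \<in> H \<Longrightarrow> g \<noteq> h \<Longrightarrow> \<exists>x\<in>carrier R. g x \<noteq> h x"
    and "\<And>h. h \<in> H \<Longrightarrow> a h \<in> carrier R"
    and "\<And>x. x \<in> carrier R \<Longrightarrow> (\<Oplus>h\<in>H. a h \<otimes> h x) = \<zero>"
  shows "\<forall>h\<in>H. a h = \<zero>"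
  using assms
proof (induction H arbitrary: a rule: finite_induct)
  case empty
  then show ?case by simp
next
  case (insert d H)
  have hc: "h x \<in> carrier R" if "h \<in> insert d H" "x \<in> carrier R" for h x
    using ring_hom_closed[OF insert.prems(1)] that by blast
  have ac: "a h \<in> carrier R" if "h \<in> insert d H" for h using insert.prems(3) that by auto
  have sum: "a d \<otimes> d x \<oplus> (\<Oplus>h\<in>H. a h \<otimes> h x) = \<zero>" if "x \<in> carrier R" for x
    using insert.prems(4)[OF that] insert.hyps hc ac that by (subst (asm) finsum_insert) auto
  have H: "a h = \<zero>" if h: "h \<in> H" for h
  proof -
    obtain y where y: "y \<in> carrier R" "h y \<noteq> d y"
      using insert.prems(2)[of h d] h insert.hyps by auto
    have "(\<Oplus>h\<in>H. (a h \<otimes> (h y \<ominus> d y)) \<otimes> h x) = \<zero>" if x: "x \<in> carrier R" for x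
    proof -
      let ?S = "\<Oplus>h\<in>H. a h \<otimes> h x"
      have S: "?S \<in> carrier R" using hc ac x by (intro finsum_closed) auto
      have S1: "(\<Oplus>h\<in>H. a h \<otimes> h (y \<otimes> x)) \<in> carrier R"
        using hc ac x y by (intro finsum_closed) auto
      have "(\<Oplus>h\<in>H. (a h \<otimes> (h y \<ominus> d y)) \<otimes> h x)
          = (\<Oplus>h\<in>H. a h \<otimes> h (y \<otimes> x) \<oplus> (\<ominus> d y) \<otimes> (a h \<otimes> h x))"
      proof (intro finsum_cong')
        fix h assume h: "h \<in> H"
        then have "h (y \<otimes> x) = h y \<otimes> h x" using insert.prems(1) x y ring_hom_mult by fastforce
        then show "(a h \<otimes> (h y \<ominus> d y)) \<otimes> h x = a h \<otimes> h (y \<otimes> x) \<oplus> (\<ominus> d y) \<otimes> (a h \<otimes> h x)"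
          using h hc[of h x] hc[of h y] hc[of d y] ac[of h] x y mult_diff_expand[of "a h" "h y" "d y" "h x"] by simp
      qed (use hc ac x y in auto)
      also have "\<dots> = (\<Oplus>h\<in>H. a h \<otimes> h (y \<otimes> x)) \<oplus> (\<ominus> d y) \<otimes> ?S"
        using hc ac x y insert.hyps by (subst finsum_addf) (auto simp: finsum_rdistr Pi_def)
      also have "\<dots> = \<zero>"
      proof -
        have "d (y \<otimes> x) = d y \<otimes> d x" using insert.prems(1) x y ring_hom_mult by fastforce
        then have "a d \<otimes> (d y \<otimes> d x) \<oplus> (\<Oplus>h\<in>H. a h \<otimes> h (y \<otimes> x)) = \<zero>"
          "a d \<otimes> d x \<oplus> ?S = \<zero>"
          using sum[OF x] sum[of "y \<otimes> x"] x y by auto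
        then show ?thesis using ac[of d] hc[of d x] hc[of d y] x y S S1
          by (intro cancel_scaled_relation[of _ _ "a d" "d x"]) auto
      qed
      finally show ?thesis .
    qed
    then have "\<forall>h\<in>H. a h \<otimes> (h y \<ominus> d y) = \<zero>"
      using insert.prems hc ac y by (intro insert.IH[of "\<lambda>h. a h \<otimes> (h y \<ominus> d y)"]) auto
    then have "a h \<otimes> (h y \<ominus> d y) = \<zero>" using h by blast
    moreover have "h y \<ominus> d y \<noteq> \<zero>" using y h hc by auto
    ultimately show ?thesis using h hc ac y integral by (meson insertCI minus_closed)
  qed
  \<comment> \<open>The other coefficients being zero, the relation at \<open>\<one>\<close>
    isolates the coefficient of \<open>d\<close>.\<close>
  have d: "d \<one> = \<one>" using insert.prems(1) ring_hom_one by blast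
  have "h \<one> = \<one>" if "h \<in> H" for h using insert.prems(1) ring_hom_one that by blast
  then have "(\<Oplus>h\<in>H. a h \<otimes> h \<one>) = \<zero>" using H hc by (intro add.finprod_one_eqI) (metis insertCI one_closed l_null)
  then have "a d = \<zero>" using sum[of \<one>] d ac[of d] by simp
  then show ?case using H by blast
qed

section \<open>Equivariant functions on a finite set with a group action\<close>

locale finite_automorphism_group = field F for F (structure) +
  fixes \<Gamma> :: "('a \<Rightarrow> 'a) monoid"
  assumes group: "group \<Gamma>"
    and finite: "finite (carrier \<Gamma>)"
    and hom: "\<gamma> \<in> carrier \<Gamma> \<Longrightarrow> \<gamma> \<in> ring_hom F F"
    and mult: "\<lbrakk>\<gamma> \<in> carrier \<Gamma>; \<delta> \<in> carrier \<Gamma>; x \<in> carrier F\<rbrakk> \<Longrightarrow> (\<gamma> \<otimes>\<^bsub>\<Gamma>\<^esub> \<delta>) x = \<gamma> (\<delta> x)"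
    and one: "x \<in> carrier F \<Longrightarrow> \<one>\<^bsub>\<Gamma>\<^esub> x = x"
    and faithful: "\<lbrakk>\<gamma> \<in> carrier \<Gamma>; \<delta> \<in> carrier \<Gamma>; \<gamma> \<noteq> \<delta>\<rbrakk> \<Longrightarrow> \<exists>x\<in>carrier F. \<gamma> x \<noteq> \<delta> x"
begin

sublocale \<Gamma>: group \<Gamma> by (rule group)

lemma closed: "\<gamma> \<in> carrier \<Gamma> \<Longrightarrow> x \<in> carrier F \<Longrightarrow> \<gamma> x \<in> carrier F"
  using hom ring_hom_closed by metis

lemma hom_add: "\<lbrakk>\<gamma> \<in> carrier \<Gamma>; x \<in> carrier F; y \<in> carrier F\<rbrakk> \<Longrightarrow> \<gamma> (x \<oplus> y) = \<gamma> x \<oplus> \<gamma> y"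
  and hom_mult: "\<lbrakk>\<gamma> \<in> carrier \<Gamma>; x \<in> carrier F; y \<in> carrier F\<rbrakk> \<Longrightarrow> \<gamma> (x \<otimes> y) = \<gamma> x \<otimes> \<gamma> y"
  and hom_one: "\<gamma> \<in> carrier \<Gamma> \<Longrightarrow> \<gamma> \<one> = \<one>"
  using hom ring_hom_add ring_hom_mult ring_hom_one by metis+

lemma hom_cring: "\<gamma> \<in> carrier \<Gamma> \<Longrightarrow> ring_hom_cring F F \<gamma>"
  using hom by unfold_locales auto

end

locale finite_gset =
  fixes \<Gamma> :: "('g, 'k) monoid_scheme" and S :: "'s set" and act :: "'g \<Rightarrow> 's \<Rightarrow> 's"
  assumes finite_set: "finite S"
    and act_closed: "\<lbrakk>\<gamma> \<in> carrier \<Gamma>; s \<in> S\<rbrakk> \<Longrightarrow> act \<gamma> s \<in> S"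
    and act_mult: "\<lbrakk>\<gamma> \<in> carrier \<Gamma>; \<delta> \<in> carrier \<Gamma>; s \<in> S\<rbrakk> \<Longrightarrow> act (\<gamma> \<otimes>\<^bsub>\<Gamma>\<^esub> \<delta>) s = act \<gamma> (act \<delta> s)"
    and act_one: "s \<in> S \<Longrightarrow> act \<one>\<^bsub>\<Gamma>\<^esub> s = s"
begin

lemma act_bij:
  assumes "group \<Gamma>" "\<gamma> \<in> carrier \<Gamma>"
  shows "bij_betw (act \<gamma>) S S"
proof -
  interpret group \<Gamma> by fact
  show ?thesis
    by (rule bij_betwI[where g = "act (inv\<^bsub>\<Gamma>\<^esub> \<gamma>)"])
       (use assms in \<open>auto simp: act_closed act_one simp flip: act_mult\<close>)
qed

end

text \<open>The etale algebra that Galois theory attaches to a finite \<Gamma>-set: on a single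
  orbit it is, by evaluation at a point, the fixed field of a stabilizer, and in general the product
  of these over the orbits. Scalar multiplication accepts any \<open>c\<close>; scalars of the field
  that are fixed by \<Gamma> preserve the carrier.\<close>

definition equivariant_algebra ::
    "('a, 'b) ring_scheme \<Rightarrow> ('a \<Rightarrow> 'a) monoid \<Rightarrow> 's set \<Rightarrow> (('a \<Rightarrow> 'a) \<Rightarrow> 's \<Rightarrow> 's) \<Rightarrow> ('a, 's \<Rightarrow> 'a) module" where
  "equivariant_algebra F \<Gamma> S act =
     \<lparr>carrier = {f \<in> S \<rightarrow>\<^sub>E carrier F. \<forall>\<gamma> \<in> carrier \<Gamma>. \<forall>s \<in> S. f (act \<gamma> s) = \<gamma> (f s)},
      monoid.mult = (\<lambda>f g. \<lambda>s \<in> S. f s \<otimes>\<^bsub>F\<^esub> g s),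
      one = (\<lambda>s \<in> S. \<one>\<^bsub>F\<^esub>),
      zero = (\<lambda>s \<in> S. \<zero>\<^bsub>F\<^esub>),
      add = (\<lambda>f g. \<lambda>s \<in> S. f s \<oplus>\<^bsub>F\<^esub> g s),
      smult = (\<lambda>c f. \<lambda>s \<in> S. c \<otimes>\<^bsub>F\<^esub> f s)\<rparr>"

text \<open>Functions are pulled back along the inverse of the bijection, so that the algebra map
  also goes from S to T.\<close>

lemma gset_isomorphic_imp_algebra_isomorphic:
  assumes "finite_gset \<Gamma> S act" "finite_gset \<Gamma> T act'" "gset_isomorphic \<Gamma> S act T act'"
  shows "algebra_isomorphic K (equivariant_algebra F \<Gamma> S act) (equivariant_algebra F \<Gamma> T act')"
proof -
  interpret S: finite_gset \<Gamma> S act by fact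
  interpret T: finite_gset \<Gamma> T act' by fact
  obtain \<psi> where \<psi>: "bij_betw \<psi> S T" and
    eq: "\<And>\<gamma> s. \<gamma> \<in> carrier \<Gamma> \<Longrightarrow> s \<in> S \<Longrightarrow> \<psi> (act \<gamma> s) = act' \<gamma> (\<psi> s)"
    using assms(3) by (auto simp: gset_isomorphic_def)
  define \<phi> where "\<phi> = inv_into S \<psi>"
  have \<phi>: "\<phi> t \<in> S" "\<psi> (\<phi> t) = t" if "t \<in> T" for t
    using \<psi> that by (auto simp: \<phi>_def bij_betw_def inv_into_into f_inv_into_f)
  have \<psi>': "\<psi> s \<in> T" "\<phi> (\<psi> s) = s" if "s \<in> S" for s
    using \<psi> that by (auto simp: \<phi>_def bij_betw_def)
  have eq': "\<phi> (act' \<gamma> t) = act \<gamma> (\<phi> t)" if "\<gamma> \<in> carrier \<Gamma>" "t \<in> T" for \<gamma> t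
    using eq[of \<gamma> "\<phi> t"] that \<phi> \<psi>' S.act_closed by metis
  let ?A = "equivariant_algebra F \<Gamma> S act" and ?B = "equivariant_algebra F \<Gamma> T act'"
  let ?h = "\<lambda>f. \<lambda>t\<in>T. f (\<phi> t)"
  have "bij_betw ?h (carrier ?A) (carrier ?B)"
    by (rule bij_betwI[where g = "\<lambda>f. \<lambda>s\<in>S. f (\<psi> s)"])
       (auto simp: equivariant_algebra_def \<phi> \<psi>' eq eq' S.act_closed T.act_closed PiE_mem
        simp: PiE_iff intro!: extensionalityI[of _ S] extensionalityI[of _ T])
  moreover have "?h \<in> ring_hom ?A ?B"
    by (rule ring_hom_memI)
       (auto simp: equivariant_algebra_def \<phi> eq' T.act_closed fun_eq_iff PiE_mem)
  moreover have "?h (k \<odot>\<^bsub>?A\<^esub> f) = k \<odot>\<^bsub>?B\<^esub> ?h f" for k f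
    by (auto simp: equivariant_algebra_def \<phi> fun_eq_iff)
  ultimately show ?thesis by (auto simp: algebra_isomorphic_def ring_iso_def)
qed

locale equivariant = finite_automorphism_group F \<Gamma> + finite_gset \<Gamma> S act
  for F (structure) and \<Gamma> :: "('a \<Rightarrow> 'a) monoid" and S :: "'s set" and act :: "('a \<Rightarrow> 'a) \<Rightarrow> 's \<Rightarrow> 's"
begin

abbreviation A where "A \<equiv> equivariant_algebra F \<Gamma> S act"

lemma value_closed: "f \<in> carrier A \<Longrightarrow> s \<in> S \<Longrightarrow> f s \<in> carrier F"
  by (auto simp: equivariant_algebra_def)

lemma add_mem: "f \<in> carrier A \<Longrightarrow> g \<in> carrier A \<Longrightarrow> f \<oplus>\<^bsub>A\<^esub> g \<in> carrier A"
  by (auto simp: equivariant_algebra_def hom_add PiE_iff act_closed)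

lemma mult_mem: "f \<in> carrier A \<Longrightarrow> g \<in> carrier A \<Longrightarrow> f \<otimes>\<^bsub>A\<^esub> g \<in> carrier A"
  by (auto simp: equivariant_algebra_def hom_mult PiE_iff act_closed)

lemma smult_mem:
  assumes "k \<in> carrier F" "\<And>\<gamma>. \<gamma> \<in> carrier \<Gamma> \<Longrightarrow> \<gamma> k = k" "f \<in> carrier A"
  shows "k \<odot>\<^bsub>A\<^esub> f \<in> carrier A"
  using assms(1,3) by (auto simp: equivariant_algebra_def hom_mult PiE_iff act_closed assms(2))

lemma one_mem: "\<one>\<^bsub>A\<^esub> \<in> carrier A"
  using act_closed by (auto simp: equivariant_algebra_def hom_one)

lemma add_eval: "s \<in> S \<Longrightarrow> (f \<oplus>\<^bsub>A\<^esub> g) s = f s \<oplus> g s"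
  and mult_eval: "s \<in> S \<Longrightarrow> (f \<otimes>\<^bsub>A\<^esub> g) s = f s \<otimes> g s"
  and smult_eval: "s \<in> S \<Longrightarrow> (k \<odot>\<^bsub>A\<^esub> f) s = k \<otimes> f s"
  and one_eval: "s \<in> S \<Longrightarrow> \<one>\<^bsub>A\<^esub> s = \<one>"
  by (auto simp: equivariant_algebra_def)

text \<open>For each \<open>c\<close> the function \<open>f c\<close> sums \<gamma>(c) over those
  \<gamma> that carry s to the argument. If no \<open>f c\<close> told s from t, the elements fixing
  s, with coefficient 1, and those carrying s to t, with coefficient -1, would satisfy a linear
  relation, against Dedekind: the identity occurs in it with coefficient 1.\<close>

lemma separates_points:
  assumes s: "s \<in> S" and t: "t \<in> S" and eq: "\<And>f. f \<in> carrier A \<Longrightarrow> f s = f t"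
  shows "s = t"
proof (rule ccontr)
  assume ne: "s \<noteq> t"
  define f where "f c = (\<lambda>u\<in>S. \<Oplus>\<gamma>\<in>carrier \<Gamma>. if act \<gamma> s = u then \<gamma> c else \<zero>)" for c
  have fA: "f c \<in> carrier A" if c: "c \<in> carrier F" for c
  proof -
    have "f c (act \<delta> u) = \<delta> (f c u)" if d: "\<delta> \<in> carrier \<Gamma>" and u: "u \<in> S" for \<delta> u
    proof -
      interpret \<delta>: ring_hom_cring F F \<delta> using hom_cring d .
      have bij: "bij_betw (\<lambda>\<gamma>. \<delta> \<otimes>\<^bsub>\<Gamma>\<^esub> \<gamma>) (carrier \<Gamma>) (carrier \<Gamma>)"
        by (rule bij_betwI[where g = "\<lambda>\<gamma>. inv\<^bsub>\<Gamma>\<^esub> \<delta> \<otimes>\<^bsub>\<Gamma>\<^esub> \<gamma>"])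
           (use d in \<open>auto simp flip: \<Gamma>.m_assoc\<close>)
      \<comment> \<open>Replacing \<gamma> by the product of \<delta> and \<gamma> reindexes the
        sum; since \<delta> permutes S, the condition on the point becomes that for
        \<open>u\<close>.\<close>
      have "f c (act \<delta> u) = (\<Oplus>\<gamma>\<in>(\<lambda>\<gamma>. \<delta> \<otimes>\<^bsub>\<Gamma>\<^esub> \<gamma>) ` carrier \<Gamma>. if act \<gamma> s = act \<delta> u then \<gamma> c else \<zero>)"
        using bij d u act_closed by (simp add: f_def bij_betw_def)
      also have "\<dots> = (\<Oplus>\<gamma>\<in>carrier \<Gamma>. if act (\<delta> \<otimes>\<^bsub>\<Gamma>\<^esub> \<gamma>) s = act \<delta> u then (\<delta> \<otimes>\<^bsub>\<Gamma>\<^esub> \<gamma>) c else \<zero>)"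
        using bij c d closed by (subst finsum_reindex) (auto simp: bij_betw_def)
      also have "\<dots> = (\<Oplus>\<gamma>\<in>carrier \<Gamma>. \<delta> (if act \<gamma> s = u then \<gamma> c else \<zero>))"
      proof (intro finsum_cong')
        fix \<gamma> assume g: "\<gamma> \<in> carrier \<Gamma>"
        have "act \<delta> (act \<gamma> s) = act \<delta> u \<longleftrightarrow> act \<gamma> s = u"
          using act_bij[OF group d] act_closed[OF g s] u by (auto simp: bij_betw_def inj_on_def)
        then show "(if act (\<delta> \<otimes>\<^bsub>\<Gamma>\<^esub> \<gamma>) s = act \<delta> u then (\<delta> \<otimes>\<^bsub>\<Gamma>\<^esub> \<gamma>) c else \<zero>)
            = \<delta> (if act \<gamma> s = u then \<gamma> c else \<zero>)"
          using d g c s by (auto simp: mult act_mult)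
      qed (use c d closed in auto)
      also have "\<dots> = \<delta> (\<Oplus>\<gamma>\<in>carrier \<Gamma>. if act \<gamma> s = u then \<gamma> c else \<zero>)"
        using c closed by (subst \<delta>.hom_finsum) (auto simp: comp_def)
      finally show ?thesis using u by (simp add: f_def)
    qed
    moreover have "f c \<in> S \<rightarrow>\<^sub>E carrier F"
      using c closed by (auto simp: f_def intro!: finsum_closed)
    ultimately show ?thesis by (simp add: equivariant_algebra_def)
  qed
  then have fst: "f c s = f c t" if "c \<in> carrier F" for c using eq fA that by blast
  define a where "a \<gamma> = (if act \<gamma> s = s then \<one> else if act \<gamma> s = t then \<ominus> \<one> else \<zero>)" for \<gamma>
  have "\<forall>\<gamma>\<in>carrier \<Gamma>. a \<gamma> = \<zero>"
  proof (rule ring_homs_independent[of "carrier \<Gamma>" a])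
    show "(\<Oplus>\<gamma>\<in>carrier \<Gamma>. a \<gamma> \<otimes> \<gamma> c) = \<zero>" if c: "c \<in> carrier F" for c
    proof -
      have "(\<Oplus>\<gamma>\<in>carrier \<Gamma>. a \<gamma> \<otimes> \<gamma> c) =
          (\<Oplus>\<gamma>\<in>carrier \<Gamma>. (if act \<gamma> s = s then \<gamma> c else \<zero>) \<oplus> \<ominus> \<one> \<otimes> (if act \<gamma> s = t then \<gamma> c else \<zero>))"
        using c closed ne by (intro finsum_cong') (auto simp: a_def l_minus)
      also have "\<dots> = f c s \<oplus> \<ominus> \<one> \<otimes> f c t"
        using c closed finite s t
        by (subst finsum_addf) (auto simp: f_def finsum_rdistr Pi_def)
      also have "\<dots> = \<zero>"
        using fst[OF c] value_closed[OF fA[OF c] t] by (simp add: l_minus r_neg)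
      finally show ?thesis .
    qed
  qed (use finite hom faithful in \<open>auto simp: a_def\<close>)
  then have "a \<one>\<^bsub>\<Gamma>\<^esub> = \<zero>" by blast
  then show False using s by (simp add: a_def act_one)
qed

text \<open>
  The polynomial \<open>\<Prod>s. X - f s\<close> has coefficients in the fixed field and annihilates \<open>f\<close>, so its image
  under an algebra homomorphism is again one of the roots \<open>f s\<close>.
\<close>

lemma annihilating_polynomial:
  assumes f: "f \<in> carrier A"
  obtains p where "p \<in> carrier (poly_ring F)" "\<And>k \<gamma>. k \<in> set p \<Longrightarrow> \<gamma> \<in> carrier \<Gamma> \<Longrightarrow> \<gamma> k = k"
    and "\<And>x. x \<in> carrier F \<Longrightarrow> eval p x = \<zero> \<longleftrightarrow> x \<in> f ` S"
proof -
  interpret UP: domain "poly_ring F" by (rule univ_poly_is_domain[OF carrier_is_subring])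
  define l where "l s = [\<one>, \<ominus> f s]" for s
  have l: "l s \<in> carrier (poly_ring F)" if "s \<in> S" for s
    using value_closed[OF f that] by (auto simp: l_def polynomial_def simp flip: univ_poly_carrier)
  define p where "p = (\<Otimes>\<^bsub>poly_ring F\<^esub>s\<in>S. l s)"
  have p: "p \<in> carrier (poly_ring F)" using l by (auto simp: p_def intro!: UP.finprod_closed)
  have "\<gamma> k = k" if g: "\<gamma> \<in> carrier \<Gamma>" and k: "k \<in> set p" for \<gamma> k
  proof -
    interpret \<gamma>: ring_hom_cring F F \<gamma> using hom_cring g .
    \<comment> \<open>Acting on coefficients permutes the linear factors, since \<gamma>(f s) is the
      value of f at the translate of s. Arbitrary subsets T make the induction possible; for T = S
      the translates run through S again.\<close>
    have "map \<gamma> (\<Otimes>\<^bsub>poly_ring F\<^esub>s\<in>T. l s) = (\<Otimes>\<^bsub>poly_ring F\<^esub>s\<in>T. l (act \<gamma> s))" if "T \<subseteq> S" for T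
      using finite_subset[OF that finite_set] that
    proof (induction T rule: finite_induct)
      case empty
      then show ?case by (simp add: univ_poly_one)
    next
      case (insert t T)
      have "map \<gamma> (l t) = l (act \<gamma> t)"
        using insert.prems f g value_closed[OF f] by (auto simp: l_def equivariant_algebra_def)
      moreover have "map \<gamma> (\<Otimes>\<^bsub>poly_ring F\<^esub>s\<in>insert t T. l s) =
          map \<gamma> (l t) \<otimes>\<^bsub>poly_ring F\<^esub> map \<gamma> (\<Otimes>\<^bsub>poly_ring F\<^esub>s\<in>T. l s)"
        using insert l
        by (subst UP.finprod_insert, (auto)[4],
            subst ring_hom_mult[OF map_poly_ring_hom[OF hom[OF g] field_axioms field_axioms]])
           (auto intro!: UP.finprod_closed)
      ultimately show ?case
        using insert l g act_closed by (subst UP.finprod_insert) (auto intro!: UP.finprod_closed)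
    qed
    from this[of S] have "map \<gamma> p = (\<Otimes>\<^bsub>poly_ring F\<^esub>s\<in>S. l (act \<gamma> s))" by (simp add: p_def)
    also have "\<dots> = (\<Otimes>\<^bsub>poly_ring F\<^esub>s\<in>act \<gamma> ` S. l s)"
      using act_bij[OF group g] l by (subst UP.finprod_reindex) (auto simp: bij_betw_def)
    also have "\<dots> = p" using act_bij[OF group g] by (simp add: p_def bij_betw_def)
    \<comment> \<open>In the form \<open>map id p\<close> the equation lets
      \<open>map_eq_conv\<close> say that every coefficient is fixed.\<close>
    finally have "map \<gamma> p = map id p" by simp
    then show ?thesis using k by (simp only: map_eq_conv) simp
  qed
  moreover have "eval p x = \<zero> \<longleftrightarrow> x \<in> f ` S" if x: "x \<in> carrier F" for x
  proof -
    interpret ev: ring_hom_cring "poly_ring F" F "\<lambda>p. eval p x"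
      using eval_cring_hom[OF carrier_is_subring x] .
    have "eval (\<Otimes>\<^bsub>poly_ring F\<^esub>s\<in>T. l s) x = \<zero> \<longleftrightarrow> x \<in> f ` T" if "T \<subseteq> S" for T
      using finite_subset[OF that finite_set] that
    proof (induction T rule: finite_induct)
      case empty
      then show ?case using x by (simp add: univ_poly_one)
    next
      case (insert t T)
      have ft: "f t \<in> carrier F" using insert.prems value_closed[OF f] by auto
      have "eval (\<Otimes>\<^bsub>poly_ring F\<^esub>s\<in>insert t T. l s) x = eval (l t) x \<otimes> eval (\<Otimes>\<^bsub>poly_ring F\<^esub>s\<in>T. l s) x"
        using insert l by (subst UP.finprod_insert, (auto)[4], subst ev.hom_mult) (auto intro!: UP.finprod_closed)
      moreover have "eval (l t) x = x \<ominus> f t" using x ft by (simp add: l_def a_minus_def)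
      moreover have "eval (\<Otimes>\<^bsub>poly_ring F\<^esub>s\<in>T. l s) x \<in> carrier F"
        using insert l by (intro ev.hom_closed UP.finprod_closed) auto
      ultimately show ?case using insert x ft by (auto simp: integral_iff)
    qed
    from this[of S] show ?thesis by (simp add: p_def)
  qed
  ultimately show ?thesis using that[OF p] by blast
qed

lemma algebra_hom_value:
  assumes K: "K = {x \<in> carrier F. \<forall>\<gamma>\<in>carrier \<Gamma>. \<gamma> x = x}"
    and \<phi>: "\<phi> \<in> carrier A \<rightarrow> carrier F" "\<phi> \<one>\<^bsub>A\<^esub> = \<one>"
      "\<And>f g. f \<in> carrier A \<Longrightarrow> g \<in> carrier A \<Longrightarrow> \<phi> (f \<oplus>\<^bsub>A\<^esub> g) = \<phi> f \<oplus> \<phi> g"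
      "\<And>f g. f \<in> carrier A \<Longrightarrow> g \<in> carrier A \<Longrightarrow> \<phi> (f \<otimes>\<^bsub>A\<^esub> g) = \<phi> f \<otimes> \<phi> g"
      "\<And>k f. k \<in> K \<Longrightarrow> f \<in> carrier A \<Longrightarrow> \<phi> (k \<odot>\<^bsub>A\<^esub> f) = k \<otimes> \<phi> f"
    and f: "f \<in> carrier A"
  shows "\<phi> f \<in> f ` S"
proof -
  have \<phi>c: "\<phi> g \<in> carrier F" if "g \<in> carrier A" for g using \<phi>(1) that by auto
  have smult_mem': "k \<odot>\<^bsub>A\<^esub> g \<in> carrier A" if "k \<in> K" "g \<in> carrier A" for k g
    using that K by (auto intro: smult_mem)
  have zero: "\<zero> \<in> K"
    using hom_cring K by (auto simp: ring_hom_cring.hom_zero)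
  \<comment> \<open>The power f^n and, below, the value p(f) are produced as elements
    \<open>g\<close> of the algebra, described by their values at the points of S and by their image
    under \<phi>.\<close>
  have pow: "\<exists>g\<in>carrier A. \<phi> g = \<phi> f [^] n \<and> (\<forall>s\<in>S. g s = f s [^] n)" for n :: nat
  proof (induction n)
    case 0
    then show ?case using \<phi>(2) one_mem one_eval by auto
  next
    case (Suc n)
    then obtain g where "g \<in> carrier A" "\<phi> g = \<phi> f [^] n" "\<forall>s\<in>S. g s = f s [^] n" by auto
    then show ?case using f \<phi>(4) mult_mem by (intro bexI[of _ "g \<otimes>\<^bsub>A\<^esub> f"]) (auto simp: mult_eval)
  qed
  have ev: "\<exists>g\<in>carrier A. \<phi> g = eval p (\<phi> f) \<and> (\<forall>s\<in>S. g s = eval p (f s))" if "set p \<subseteq> K" for p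
    using that
  proof (induction p)
    case Nil
    \<comment> \<open>The zero function is written as a multiple by the scalar
      \<open>\<zero>\<close>, so that K-linearity of \<phi> gives its image.\<close>
    have "\<phi> (\<zero> \<odot>\<^bsub>A\<^esub> f) = \<zero>" using \<phi>(5)[OF zero f] \<phi>c[OF f] by simp
    then show ?case
      using smult_mem'[OF zero f] value_closed[OF f]
      by (intro bexI[of _ "\<zero> \<odot>\<^bsub>A\<^esub> f"]) (auto simp: smult_eval)
  next
    case (Cons k p)
    then obtain g where g: "g \<in> carrier A" "\<phi> g = eval p (\<phi> f)" "\<forall>s\<in>S. g s = eval p (f s)" by auto
    obtain h where h: "h \<in> carrier A" "\<phi> h = \<phi> f [^] length p" "\<forall>s\<in>S. h s = f s [^] length p"
      using pow by blast
    have k: "k \<in> K" using Cons.prems by simp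
    show ?case
      using g h smult_mem'[OF k h(1)] \<phi>(3)[OF smult_mem'[OF k h(1)] g(1)] \<phi>(5)[OF k h(1)] add_mem
      by (intro bexI[of _ "(k \<odot>\<^bsub>A\<^esub> h) \<oplus>\<^bsub>A\<^esub> g"]) (auto simp: add_eval smult_eval)
  qed
  obtain p where p: "p \<in> carrier (poly_ring F)"
    and coeffs: "\<And>k \<gamma>. k \<in> set p \<Longrightarrow> \<gamma> \<in> carrier \<Gamma> \<Longrightarrow> \<gamma> k = k"
    and root: "\<And>x. x \<in> carrier F \<Longrightarrow> eval p x = \<zero> \<longleftrightarrow> x \<in> f ` S"
    using annihilating_polynomial[OF f] by metis
  have "set p \<subseteq> K"
    using p coeffs K polynomial_incl by (fastforce simp flip: univ_poly_carrier)
  from ev[OF this] obtain g where g: "g \<in> carrier A" "\<phi> g = eval p (\<phi> f)" "\<forall>s\<in>S. g s = eval p (f s)" by auto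
  have "g s = (\<zero> \<odot>\<^bsub>A\<^esub> g) s" if "s \<in> S" for s
    using root[OF value_closed[OF f that]] that g value_closed[OF g(1) that] by (simp add: smult_eval)
  then have "g = \<zero> \<odot>\<^bsub>A\<^esub> g"
    using g(1) by (intro extensionalityI[of _ S]) (auto simp: equivariant_algebra_def PiE_iff)
  then have "\<phi> g = \<zero>" using \<phi>(5)[OF zero g(1)] \<phi>c[OF g(1)] by simp
  then show ?thesis using g root \<phi>c[OF f] by simp
qed

text \<open>For each s the functions f with \<open>\<phi> f = f s\<close> form a K-subspace. By
  \<open>algebra_hom_value\<close> these finitely many subspaces cover the algebra, so over an
  infinite field one of them is everything.\<close>

lemma algebra_hom_is_evaluation:
  assumes char: "\<And>n :: nat. 0 < n \<Longrightarrow> [n] \<cdot> \<one> \<noteq> \<zero>"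
    and K: "K = {x \<in> carrier F. \<forall>\<gamma>\<in>carrier \<Gamma>. \<gamma> x = x}"
    and \<phi>: "\<phi> \<in> carrier A \<rightarrow> carrier F" "\<phi> \<one>\<^bsub>A\<^esub> = \<one>"
      "\<And>f g. f \<in> carrier A \<Longrightarrow> g \<in> carrier A \<Longrightarrow> \<phi> (f \<oplus>\<^bsub>A\<^esub> g) = \<phi> f \<oplus> \<phi> g"
      "\<And>f g. f \<in> carrier A \<Longrightarrow> g \<in> carrier A \<Longrightarrow> \<phi> (f \<otimes>\<^bsub>A\<^esub> g) = \<phi> f \<otimes> \<phi> g"
      "\<And>k f. k \<in> K \<Longrightarrow> f \<in> carrier A \<Longrightarrow> \<phi> (k \<odot>\<^bsub>A\<^esub> f) = k \<otimes> \<phi> f"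
  shows "\<exists>s\<in>S. \<forall>f\<in>carrier A. \<phi> f = f s"
proof (rule ccontr)
  assume "\<not> ?thesis"
  then have ex: "\<exists>f\<in>carrier A. \<phi> f \<noteq> f s" if "s \<in> S" for s using that by auto
  have \<phi>c: "\<phi> g \<in> carrier F" if "g \<in> carrier A" for g using \<phi>(1) that by auto
  \<comment> \<open>a vector space over the infinite field \<open>K\<close> is not a finite union of proper subspaces\<close>
  have "\<exists>f\<in>carrier A. \<forall>s\<in>T. \<phi> f \<noteq> f s" if "T \<subseteq> S" for T
    using finite_subset[OF that finite_set] that
  proof (induction T rule: finite_induct)
    case empty
    then show ?case using one_mem by auto
  next
    case (insert t T)
    then obtain g where g: "g \<in> carrier A" "\<forall>s\<in>T. \<phi> g \<noteq> g s" by auto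
    obtain h where h: "h \<in> carrier A" "\<phi> h \<noteq> h t" using ex[of t] insert.prems by auto
    show ?case
    proof (cases "\<phi> g = g t")
      case False
      then show ?thesis using g by auto
    next
      case True
      \<comment> \<open>The defect is K-linear in f and vanishes at s exactly when f does not tell
        \<phi> from evaluation at s.\<close>
      define d where "d f s = \<phi> f \<ominus> f s" for f s
      \<comment> \<open>For s in T the defect of g is nonzero, so at most one n makes the defect of
        h + n g vanish at s. If there is none, \<open>THE\<close> yields an arbitrary number, whose
        exclusion does no harm. At t the defect of g is zero and that of h is not, so every n works
        there.\<close>
      define bad where "bad s = (THE n :: nat. d h s \<oplus> [n] \<cdot> \<one> \<otimes> d g s = \<zero>)" for s
      have "finite (bad ` T)" using insert.hyps by simp
      then obtain n where n: "n \<notin> bad ` T" using ex_new_if_finite[OF infinite_UNIV_nat] by blast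
      let ?k = "[n] \<cdot> \<one>"
      have k: "?k \<in> K"
      proof -
        have "\<gamma> ([m] \<cdot> \<one>) = [m] \<cdot> \<one>" if "\<gamma> \<in> carrier \<Gamma>" for \<gamma> and m :: nat
        proof -
          interpret \<gamma>: ring_hom_cring F F \<gamma> using hom_cring that .
          show ?thesis by (induction m) auto
        qed
        then show ?thesis using K by auto
      qed
      have kg: "?k \<odot>\<^bsub>A\<^esub> g \<in> carrier A" using smult_mem[OF _ _ g(1), of ?k] k K by auto
      have dc: "d f s \<in> carrier F" if "f \<in> carrier A" "s \<in> S" for f s
        using \<phi>c value_closed that by (auto simp: d_def)
      let ?f = "h \<oplus>\<^bsub>A\<^esub> (?k \<odot>\<^bsub>A\<^esub> g)"
      have d: "d ?f s = d h s \<oplus> ?k \<otimes> d g s" if "s \<in> S" for s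
      proof -
        have "\<phi> ?f = \<phi> h \<oplus> ?k \<otimes> \<phi> g" using \<phi>(3)[OF h(1) kg] \<phi>(5)[OF k g(1)] by simp
        moreover have "\<phi> h \<oplus> ?k \<otimes> \<phi> g \<ominus> (h s \<oplus> ?k \<otimes> g s) = (\<phi> h \<ominus> h s) \<oplus> ?k \<otimes> (\<phi> g \<ominus> g s)"
          if "?k \<in> carrier F" "\<phi> h \<in> carrier F" "\<phi> g \<in> carrier F" "h s \<in> carrier F" "g s \<in> carrier F"
          using that by algebra
        ultimately show ?thesis
          using that g h \<phi>c value_closed k K by (simp add: d_def add_eval smult_eval)
      qed
      have d0: "d f s = \<zero> \<longleftrightarrow> \<phi> f = f s" if "f \<in> carrier A" "s \<in> S" for f s
        using \<phi>c value_closed that by (auto simp: d_def)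
      have f: "?f \<in> carrier A" using h(1) kg by (rule add_mem)
      have "d ?f s \<noteq> \<zero>" if s: "s \<in> insert t T" for s
      proof (cases "s = t")
        case True
        then show ?thesis
          using d[of t] insert.prems d0[of g t] d0[of h t] g h \<open>\<phi> g = g t\<close> dc[of h t] K k by auto
      next
        case False
        then have s: "s \<in> T" "s \<in> S" using s insert.prems by auto
        have gs: "d g s \<noteq> \<zero>" using d0 g s by auto
        show ?thesis
        proof
          assume z: "d ?f s = \<zero>"
          have "m = n" if "d h s \<oplus> [m] \<cdot> \<one> \<otimes> d g s = \<zero>" for m
          proof -
            have "d h s \<oplus> [m] \<cdot> \<one> \<otimes> d g s = d h s \<oplus> [n] \<cdot> \<one> \<otimes> d g s" using that z[unfolded d[OF s(2)]] by (rule trans[OF _ sym])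
            then have "[m] \<cdot> \<one> \<otimes> d g s = [n] \<cdot> \<one> \<otimes> d g s"
              using dc[OF h(1) s(2)] dc[OF g(1) s(2)]
              by (subst (asm) add.l_cancel) (auto intro!: m_closed add.nat_pow_closed)
            then have "[m] \<cdot> \<one> = [n] \<cdot> \<one>"
              using dc[OF g(1) s(2)] gs by (simp add: m_rcancel)
            then show ?thesis using injD[OF add_pow_inj_of_char_zero[OF char]] by blast
          qed
          then have "bad s = n" unfolding bad_def using z[unfolded d[OF s(2)]] by (intro the_equality)
          then show False using n s by auto
        qed
      qed
      then show ?thesis using d0[OF f] insert.prems by (intro bexI[OF _ f]) blast
    qed
  qed
  from this[of S] obtain f where "f \<in> carrier A" "\<forall>s\<in>S. \<phi> f \<noteq> f s" by auto
  then show False using algebra_hom_value[OF K \<phi>, of f] by auto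
qed

end

text \<open>Following the given isomorphism by evaluation at s gives a K-algebra homomorphism on the
  algebra of T, hence evaluation at a point of T, which is taken as \<psi>(s). Surjectivity of the
  isomorphism and separation of points of S make \<psi> injective; separation of points of T makes
  it equivariant.\<close>

lemma equivariant_injection:
  assumes "equivariant F \<Gamma> S act" "equivariant F \<Gamma> T act'"
    and char: "\<And>n :: nat. 0 < n \<Longrightarrow> [n] \<cdot>\<^bsub>F\<^esub> \<one>\<^bsub>F\<^esub> \<noteq> \<zero>\<^bsub>F\<^esub>"
    and K: "K = {x \<in> carrier F. \<forall>\<gamma>\<in>carrier \<Gamma>. \<gamma> x = x}"
    and iso: "algebra_isomorphic K (equivariant_algebra F \<Gamma> T act') (equivariant_algebra F \<Gamma> S act)"
  shows "\<exists>\<psi>. inj_on \<psi> S \<and> \<psi> ` S \<subseteq> T \<and> (\<forall>\<gamma>\<in>carrier \<Gamma>. \<forall>s\<in>S. \<psi> (act \<gamma> s) = act' \<gamma> (\<psi> s))"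
proof -
  interpret S: equivariant F \<Gamma> S act by fact
  interpret T: equivariant F \<Gamma> T act' by fact
  obtain h where h: "h \<in> ring_iso T.A S.A"
    and lin: "\<And>k f. k \<in> K \<Longrightarrow> f \<in> carrier T.A \<Longrightarrow> h (k \<odot>\<^bsub>T.A\<^esub> f) = k \<odot>\<^bsub>S.A\<^esub> h f"
    using iso by (auto simp: algebra_isomorphic_def)
  note h' = ring_iso_memE[OF h]
  have "\<exists>t\<in>T. \<forall>f\<in>carrier T.A. h f s = f t" if s: "s \<in> S" for s
    using h' lin s
    by (intro T.algebra_hom_is_evaluation[OF char K])
       (auto simp: S.add_eval S.mult_eval S.smult_eval S.one_eval intro!: S.value_closed)
  then obtain \<psi> where \<psi>: "\<And>s. s \<in> S \<Longrightarrow> \<psi> s \<in> T" "\<And>s f. s \<in> S \<Longrightarrow> f \<in> carrier T.A \<Longrightarrow> h f s = f (\<psi> s)"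
    by metis
  have "inj_on \<psi> S"
  proof (rule inj_onI)
    fix s t assume st: "s \<in> S" "t \<in> S" "\<psi> s = \<psi> t"
    have "g s = g t" if g: "g \<in> carrier S.A" for g
    proof -
      obtain f where "f \<in> carrier T.A" "g = h f" using h'(5) g by (auto simp: bij_betw_def)
      then show ?thesis using \<psi>(2) st by metis
    qed
    then show "s = t" using S.separates_points st by blast
  qed
  moreover have "\<psi> (act \<gamma> s) = act' \<gamma> (\<psi> s)" if g: "\<gamma> \<in> carrier \<Gamma>" and s: "s \<in> S" for \<gamma> s
  proof (rule T.separates_points)
    fix f assume f: "f \<in> carrier T.A"
    have "f (\<psi> (act \<gamma> s)) = h f (act \<gamma> s)" using \<psi>(2) f g s S.act_closed by simp
    also have "\<dots> = \<gamma> (h f s)" using h'(1)[OF f] g s by (simp add: equivariant_algebra_def)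
    also have "\<dots> = \<gamma> (f (\<psi> s))" using \<psi>(2) f s by simp
    also have "\<dots> = f (act' \<gamma> (\<psi> s))" using f g \<psi>(1)[OF s] by (simp add: equivariant_algebra_def)
    finally show "f (\<psi> (act \<gamma> s)) = f (act' \<gamma> (\<psi> s))" .
  qed (use g s \<psi> S.act_closed T.act_closed in auto)
  ultimately show ?thesis using \<psi>(1) by blast
qed

text \<open>Equal finite cardinality turns the injection into a bijection. The algebras stand in the
  order opposite to the sets because taking functions reverses arrows.\<close>

lemma algebra_isomorphic_iff_gset_isomorphic:
  assumes "equivariant F \<Gamma> S act" "equivariant F \<Gamma> T act'" and "card S = card T"
    and "\<And>n :: nat. 0 < n \<Longrightarrow> [n] \<cdot>\<^bsub>F\<^esub> \<one>\<^bsub>F\<^esub> \<noteq> \<zero>\<^bsub>F\<^esub>"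
    and "K = {x \<in> carrier F. \<forall>\<gamma>\<in>carrier \<Gamma>. \<gamma> x = x}"
  shows "algebra_isomorphic K (equivariant_algebra F \<Gamma> T act') (equivariant_algebra F \<Gamma> S act)
    \<longleftrightarrow> gset_isomorphic \<Gamma> S act T act'"
proof
  assume "algebra_isomorphic K (equivariant_algebra F \<Gamma> T act') (equivariant_algebra F \<Gamma> S act)"
  from equivariant_injection[OF assms(1,2,4,5) this] obtain \<psi> where
    \<psi>: "inj_on \<psi> S" "\<psi> ` S \<subseteq> T" "\<forall>\<gamma>\<in>carrier \<Gamma>. \<forall>s\<in>S. \<psi> (act \<gamma> s) = act' \<gamma> (\<psi> s)" by auto
  have "finite T" using assms(2) finite_gset.finite_set equivariant.axioms(2) by blast
  then have "\<psi> ` S = T" using \<psi> assms(3) by (intro card_subset_eq) (auto simp: card_image)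
  then show "gset_isomorphic \<Gamma> S act T act'" using \<psi> by (auto simp: gset_isomorphic_def bij_betw_def)
next
  assume "gset_isomorphic \<Gamma> S act T act'"
  then obtain \<psi> where \<psi>: "bij_betw \<psi> S T" "\<forall>\<gamma>\<in>carrier \<Gamma>. \<forall>s\<in>S. \<psi> (act \<gamma> s) = act' \<gamma> (\<psi> s)"
    by (auto simp: gset_isomorphic_def)
  interpret S: equivariant F \<Gamma> S act by fact
  have "inv_into S \<psi> (act' \<gamma> t) = act \<gamma> (inv_into S \<psi> t)" if "\<gamma> \<in> carrier \<Gamma>" "t \<in> T" for \<gamma> t
  proof -
    obtain s where s: "s \<in> S" "t = \<psi> s" using \<psi>(1) \<open>t \<in> T\<close> by (auto simp: bij_betw_def)
    then have "act' \<gamma> t = \<psi> (act \<gamma> s)" using \<psi>(2) that by simp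
    then show ?thesis using \<psi>(1) s S.act_closed that by (simp add: bij_betw_def)
  qed
  then have "gset_isomorphic \<Gamma> T act' S act"
    using bij_betw_inv_into[OF \<psi>(1)] by (auto simp: gset_isomorphic_def)
  then show "algebra_isomorphic K (equivariant_algebra F \<Gamma> T act') (equivariant_algebra F \<Gamma> S act)"
    using gset_isomorphic_imp_algebra_isomorphic[OF equivariant.axioms(2)[OF assms(2)] equivariant.axioms(2)[OF assms(1)]]
    by blast
qed

section \<open>Characters and the Fourier transform\<close>

text \<open>Shift invariance of a sum over a full period is behind both the vanishing of geometric
  sums of roots of unity and the eigenvector property of \<open>proj\<close>.\<close>

lemma (in abelian_group) finsum_cyclic_shift:
  fixes g :: "nat \<Rightarrow> 'a"
  assumes g: "\<And>i. g i \<in> carrier G" and "g n = g 0"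
  shows "(\<Oplus>i\<in>{..<n}. g (Suc i)) = (\<Oplus>i\<in>{..<n}. g i)"
proof -
  have cl: "(\<Oplus>i\<in>{..<m}. g (Suc i)) \<in> carrier G" "(\<Oplus>i\<in>{..<m}. g i) \<in> carrier G" for m
    using g by (auto intro!: finsum_closed)
  \<comment> \<open>Partial sums are not periodic, so the induction keeps both boundary terms; they
    cancel only at m = n.\<close>
  have "(\<Oplus>i\<in>{..<m}. g (Suc i)) \<oplus> g 0 = (\<Oplus>i\<in>{..<m}. g i) \<oplus> g m" for m
  proof (induction m)
    case 0
    then show ?case by simp
  next
    case (Suc m)
    have "(\<Oplus>i\<in>{..<Suc m}. g (Suc i)) \<oplus> g 0 = g (Suc m) \<oplus> ((\<Oplus>i\<in>{..<m}. g (Suc i)) \<oplus> g 0)"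
      using g cl by (simp add: lessThan_Suc finsum_insert a_assoc)
    also have "\<dots> = (\<Oplus>i\<in>{..<Suc m}. g i) \<oplus> g (Suc m)"
      using g cl by (simp add: Suc.IH lessThan_Suc finsum_insert a_ac)
    finally show ?case .
  qed
  from this[of n] show ?thesis using assms cl by simp
qed

text \<open>Multiplication by u shifts the exponents cyclically and therefore fixes the sum,
  although u is not 1.\<close>

lemma (in field) finsum_roots_of_unity_zero:
  assumes u: "u \<in> carrier R" "u [^] n = \<one>" "u \<noteq> \<one>"
  shows "(\<Oplus>j\<in>{..<n :: nat}. u [^] j) = \<zero>"
proof -
  let ?S = "\<Oplus>j\<in>{..<n}. u [^] j"
  have S: "?S \<in> carrier R" using u by (auto intro!: finsum_closed)
  have "u \<otimes> ?S = (\<Oplus>j\<in>{..<n}. u [^] Suc j)"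
    using u by (subst finsum_rdistr) (auto intro!: finsum_cong' simp: m_comm)
  also have "\<dots> = ?S" using u by (intro finsum_cyclic_shift) auto
  finally have "(u \<ominus> \<one>) \<otimes> ?S = \<zero>" using u S by (simp add: a_minus_def l_distr l_minus r_neg)
  then show ?thesis using u S by (simp add: integral_iff)
qed

text \<open>Translation by b permutes the summands and multiplies the sum by \<open>c b\<close>.
  Here \<open>c\<close> is a bare function so that it can be the product
  \<open>\<chi> (inv \<eta>) \<otimes> \<psi> \<eta>\<close> in \<open>fourier_surj\<close>.\<close>

lemma (in field) finsum_hom_zero:
  assumes "group N" "finite (carrier N)"
    and c: "\<And>a. a \<in> carrier N \<Longrightarrow> c a \<in> carrier R"
    and m: "\<And>a b. a \<in> carrier N \<Longrightarrow> b \<in> carrier N \<Longrightarrow> c (a \<otimes>\<^bsub>N\<^esub> b) = c a \<otimes> c b"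
    and b: "b \<in> carrier N" "c b \<noteq> \<one>"
  shows "(\<Oplus>a\<in>carrier N. c a) = \<zero>"
proof -
  interpret N: group N by fact
  let ?S = "\<Oplus>a\<in>carrier N. c a"
  have S: "?S \<in> carrier R" using c by (auto intro!: finsum_closed)
  have bij: "bij_betw (\<lambda>a. b \<otimes>\<^bsub>N\<^esub> a) (carrier N) (carrier N)"
    by (rule bij_betwI[where g = "\<lambda>a. inv\<^bsub>N\<^esub> b \<otimes>\<^bsub>N\<^esub> a"]) (use b in \<open>auto simp flip: N.m_assoc\<close>)
  have "c b \<otimes> ?S = (\<Oplus>a\<in>carrier N. c (b \<otimes>\<^bsub>N\<^esub> a))"
    using b c m assms(2) by (subst finsum_rdistr) (auto intro!: finsum_cong')
  also have "\<dots> = (\<Oplus>a\<in>(\<lambda>a. b \<otimes>\<^bsub>N\<^esub> a) ` carrier N. c a)"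
    using bij c b by (subst finsum_reindex) (auto simp: bij_betw_def)
  also have "\<dots> = ?S" using bij by (simp add: bij_betw_def)
  finally have "(c b \<ominus> \<one>) \<otimes> ?S = \<zero>" using b c S by (simp add: a_minus_def l_distr l_minus r_neg)
  then show ?thesis using b c S by (simp add: integral_iff)
qed

lemma (in ring) finsum_one_card: "(\<Oplus>a\<in>A. \<one>) = [card A] \<cdot> \<one>"
  by (simp add: add.finprod_const)

lemma group_exponent:
  assumes "group N" "finite (carrier N)"
  shows "0 < group_exponent N" and "x \<in> carrier N \<Longrightarrow> x [^]\<^bsub>N\<^esub> group_exponent N = \<one>\<^bsub>N\<^esub>"
proof -
  interpret group N by fact
  have "0 < order N \<and> (\<forall>x \<in> carrier N. x [^]\<^bsub>N\<^esub> order N = \<one>\<^bsub>N\<^esub>)"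
    using assms(2) pow_order_eq_1 order_gt_0_iff_finite by blast
  from LeastI[of "\<lambda>n. 0 < n \<and> (\<forall>x \<in> carrier N. x [^]\<^bsub>N\<^esub> n = \<one>\<^bsub>N\<^esub>)", OF this]
  show "0 < group_exponent N" and "x \<in> carrier N \<Longrightarrow> x [^]\<^bsub>N\<^esub> group_exponent N = \<one>\<^bsub>N\<^esub>"
    by (auto simp: group_exponent_def)
qed

text \<open>The polynomial X^n - 1. For \<open>n = 0\<close> the truncated \<open>n - 1\<close>
  yields X - 1 instead, whence \<open>0 < n\<close> in the lemmas on its values and its
  degree.\<close>

definition (in ring) unity_poly :: "nat \<Rightarrow> 'a list" where
  "unity_poly n = \<one> # replicate (n - 1) \<zero> @ [\<ominus> \<one>]"

lemma (in ring) eval_unity_poly: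
  assumes "0 < n" "x \<in> carrier R" shows "eval (unity_poly n) x = x [^] n \<ominus> \<one>"
proof -
  have "eval (replicate k \<zero> @ [\<ominus> \<one>]) x = \<ominus> \<one>" for k
    using assms(2) by (induction k) auto
  then show ?thesis using assms by (simp add: unity_poly_def a_minus_def)
qed

lemma (in domain) unity_poly_closed: "subring K R \<Longrightarrow> unity_poly n \<in> carrier (K[X])"
proof -
  assume K: "subring K R"
  have "\<one> \<in> K" "\<zero> \<in> K" "\<ominus> \<one> \<in> K" using subringE(2,3)[OF K] subringE(5)[OF K] by auto
  then show ?thesis unfolding univ_poly_carrier[symmetric] polynomial_def unity_poly_def by auto
qed

lemma (in ring) degree_unity_poly: "0 < n \<Longrightarrow> degree (unity_poly n) = n"
  by (simp add: unity_poly_def)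

section \<open>Enough characters from joint eigenvectors of the translations\<close>

locale character_duality = field F for F (structure) +
  fixes N :: "('n, 'c) monoid_scheme" and \<zeta> :: 'a
  assumes comm: "comm_group N" and fin: "finite (carrier N)"
    and char: "\<And>n :: nat. 0 < n \<Longrightarrow> [n] \<cdot> \<one> \<noteq> \<zero>"
    and prim: "primitive_root_of_unity F (group_exponent N) \<zeta>"
begin

sublocale N: comm_group N by (rule comm)

abbreviation mult_N (infixl \<open>\<bullet>\<close> 70) where "a \<bullet> b \<equiv> a \<otimes>\<^bsub>N\<^esub> b"

abbreviation e where "e \<equiv> group_exponent N"

lemma e_pos: "0 < e" and pow_e: "x \<in> carrier N \<Longrightarrow> x [^]\<^bsub>N\<^esub> e = \<one>\<^bsub>N\<^esub>"
  using group_exponent[OF N.is_group fin] by auto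

lemma \<zeta>: "\<zeta> \<in> carrier F" "\<zeta> [^] e = \<one>" "0 < k \<Longrightarrow> k < e \<Longrightarrow> \<zeta> [^] k \<noteq> \<one>"
  using prim by (auto simp: primitive_root_of_unity_def)

text \<open>
  Up to scaling, the projection to the eigenspace of translation by \<open>a\<close> for the eigenvalue \<open>\<zeta>\<^sup>-\<^sup>j\<close>.  A joint
  eigenvector \<open>v\<close> of all translations yields the character \<open>v / v(1)\<close>.
\<close>

definition proj :: "'n \<Rightarrow> nat \<Rightarrow> ('n \<Rightarrow> 'a) \<Rightarrow> 'n \<Rightarrow> 'a" where
  "proj a j v x = (\<Oplus>i\<in>{..<e}. (\<zeta> [^] j) [^] i \<otimes> v (a [^]\<^bsub>N\<^esub> i \<bullet> x))"

lemma proj_closed: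
  "\<lbrakk>v \<in> carrier N \<rightarrow> carrier F; a \<in> carrier N; x \<in> carrier N\<rbrakk> \<Longrightarrow> proj a j v x \<in> carrier F"
  unfolding proj_def using \<zeta> by (auto intro!: finsum_closed)

text \<open>Translating by a and multiplying by \<zeta>^j shifts the summation index by one. The sum
  is cyclic because the e-th powers of \<zeta>^j and of a are trivial.\<close>

lemma proj_eigen:
  assumes v: "v \<in> carrier N \<rightarrow> carrier F" and a: "a \<in> carrier N" and x: "x \<in> carrier N"
  shows "proj a j v x = \<zeta> [^] j \<otimes> proj a j v (a \<bullet> x)"
proof -
  let ?g = "\<lambda>i::nat. (\<zeta> [^] j) [^] i \<otimes> v (a [^]\<^bsub>N\<^esub> i \<bullet> x)"
  have vc: "v (a [^]\<^bsub>N\<^esub> i \<bullet> y) \<in> carrier F" if "y \<in> carrier N" for i :: nat and y using v a that by auto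
  have "\<zeta> [^] j \<otimes> proj a j v (a \<bullet> x) = (\<Oplus>i\<in>{..<e}. ?g (Suc i))"
    unfolding proj_def
  proof (subst finsum_rdistr, (use \<zeta> vc a x in \<open>auto\<close>)[3], intro finsum_cong')
    fix i :: nat
    have "a [^]\<^bsub>N\<^esub> i \<bullet> (a \<bullet> x) = a [^]\<^bsub>N\<^esub> Suc i \<bullet> x"
      using a x by (simp add: N.m_assoc)
    moreover have "\<zeta> [^] j \<otimes> ((\<zeta> [^] j) [^] i \<otimes> y) = (\<zeta> [^] j) [^] Suc i \<otimes> y" if "y \<in> carrier F" for y
      using \<zeta> that by (simp add: m_ac)
    ultimately show "\<zeta> [^] j \<otimes> ((\<zeta> [^] j) [^] i \<otimes> v (a [^]\<^bsub>N\<^esub> i \<bullet> (a \<bullet> x))) = ?g (Suc i)"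
      using vc[OF x] by metis
  qed (use \<zeta> v a x in \<open>auto intro!: m_closed\<close>)
  also have "\<dots> = (\<Oplus>i\<in>{..<e}. ?g i)"
  proof (rule finsum_cyclic_shift[of ?g])
    have "(\<zeta> [^] j) [^] e = \<one>" using \<zeta> by (simp add: nat_pow_pow mult.commute[of j]) (simp flip: nat_pow_pow)
    then show "?g e = ?g 0" using a x v by (simp add: pow_e)
  qed (use \<zeta> vc[OF x] in auto)
  finally show ?thesis by (simp add: proj_def)
qed

text \<open>Translations by a and b commute since N is abelian, so projecting for a preserves the
  eigenvector relation for b with the same constant.\<close>

lemma proj_commute:
  assumes v: "v \<in> carrier N \<rightarrow> carrier F" and a: "a \<in> carrier N" and b: "b \<in> carrier N" and c: "c \<in> carrier F"
    and eig: "\<And>x. x \<in> carrier N \<Longrightarrow> v x = c \<otimes> v (b \<bullet> x)" and x: "x \<in> carrier N"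
  shows "proj a j v x = c \<otimes> proj a j v (b \<bullet> x)"
proof -
  have vc: "v (a [^]\<^bsub>N\<^esub> i \<bullet> y) \<in> carrier F" if "y \<in> carrier N" for i :: nat and y using v a that by auto
  have "c \<otimes> proj a j v (b \<bullet> x) = (\<Oplus>i\<in>{..<e}. c \<otimes> ((\<zeta> [^] j) [^] i \<otimes> v (a [^]\<^bsub>N\<^esub> i \<bullet> (b \<bullet> x))))"
    unfolding proj_def using \<zeta> vc b c x by (subst finsum_rdistr) auto
  also have "\<dots> = proj a j v x"
    unfolding proj_def
  proof (intro finsum_cong')
    fix i :: nat
    have "a [^]\<^bsub>N\<^esub> i \<bullet> (b \<bullet> x) = b \<bullet> (a [^]\<^bsub>N\<^esub> i \<bullet> x)" using a b x by (simp add: N.m_ac)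
    moreover have "c \<otimes> ((\<zeta> [^] j) [^] i \<otimes> y) = (\<zeta> [^] j) [^] i \<otimes> (c \<otimes> y)" if "y \<in> carrier F" for y
      using \<zeta> c that by (simp add: m_ac)
    ultimately show "c \<otimes> ((\<zeta> [^] j) [^] i \<otimes> v (a [^]\<^bsub>N\<^esub> i \<bullet> (b \<bullet> x))) = (\<zeta> [^] j) [^] i \<otimes> v (a [^]\<^bsub>N\<^esub> i \<bullet> x)"
      using vc[of "b \<bullet> x" i] b x a eig[of "a [^]\<^bsub>N\<^esub> i \<bullet> x"] by simp
  qed (use \<zeta> vc[OF x] in auto)
  finally show ?thesis by simp
qed

text \<open>Summing over j leaves only the term i = 0: for 0 < i < e primitivity makes \<zeta>^i
  different from 1, and the sum of its powers vanishes. As e is invertible in characteristic zero, v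
  is a combination of its projections.\<close>

lemma sum_proj:
  assumes v: "v \<in> carrier N \<rightarrow> carrier F" and a: "a \<in> carrier N" and x: "x \<in> carrier N"
  shows "(\<Oplus>j\<in>{..<e}. proj a j v x) = [e] \<cdot> \<one> \<otimes> v x"
proof -
  have vc: "v (a [^]\<^bsub>N\<^esub> i \<bullet> x) \<in> carrier F" for i :: nat using v a x by auto
  have "(\<Oplus>j\<in>{..<e}. proj a j v x) = (\<Oplus>i\<in>{..<e}. \<Oplus>j\<in>{..<e}. (\<zeta> [^] j) [^] i \<otimes> v (a [^]\<^bsub>N\<^esub> i \<bullet> x))"
    unfolding proj_def using \<zeta> vc by (intro finsum_swap) auto
  also have "\<dots> = (\<Oplus>i\<in>{..<e}. if i = 0 then [e] \<cdot> \<one> \<otimes> v x else \<zero>)"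
  proof (intro finsum_cong')
    fix i assume i: "i \<in> {..<e}"
    have "(\<Oplus>j\<in>{..<e}. (\<zeta> [^] j) [^] i \<otimes> v (a [^]\<^bsub>N\<^esub> i \<bullet> x))
        = (\<Oplus>j\<in>{..<e}. (\<zeta> [^] i) [^] j) \<otimes> v (a [^]\<^bsub>N\<^esub> i \<bullet> x)"
      using \<zeta> vc by (subst finsum_ldistr) (auto simp: nat_pow_pow mult.commute)
    also have "(\<Oplus>j\<in>{..<e}. (\<zeta> [^] i) [^] j) = (if i = 0 then [e] \<cdot> \<one> else \<zero>)"
    proof (cases "i = 0")
      case True
      then show ?thesis by (simp add: finsum_one_card)
    next
      case False
      have "(\<zeta> [^] i) [^] e = \<one>" using \<zeta> by (simp add: nat_pow_pow mult.commute[of i]) (simp flip: nat_pow_pow)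
      then show ?thesis using False i \<zeta> by (simp add: finsum_roots_of_unity_zero)
    qed
    finally show "(\<Oplus>j\<in>{..<e}. (\<zeta> [^] j) [^] i \<otimes> v (a [^]\<^bsub>N\<^esub> i \<bullet> x)) = (if i = 0 then [e] \<cdot> \<one> \<otimes> v x else \<zero>)"
      using vc[of i] x by auto
  qed (use v x in \<open>auto intro!: m_closed\<close>)
  also have "\<dots> = [e] \<cdot> \<one> \<otimes> v x"
    using add.finprod_singleton_swap[of 0 "{..<e}" "\<lambda>_. [e] \<cdot> \<one> \<otimes> v x"] e_pos funcset_mem[OF v x] by auto
  finally show ?thesis .
qed

lemma exists_proj_nonzero:
  assumes v: "v \<in> carrier N \<rightarrow> carrier F" and a: "a \<in> carrier N" and x: "x \<in> carrier N" "v x \<noteq> \<zero>"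
  shows "\<exists>j<e. proj a j v x \<noteq> \<zero>"
proof (rule ccontr)
  assume "\<not> ?thesis"
  then have "(\<Oplus>j\<in>{..<e}. proj a j v x) = \<zero>" by (intro add.finprod_one_eqI) auto
  then show False using sum_proj[OF v a x(1)] char[OF e_pos] x funcset_mem[OF v x(1)] by (auto simp: integral_iff)
qed

text \<open>The translations by H are diagonalized one at a time. The relation for \<eta>, with a
  constant other than 1, is arranged first; later projections preserve all earlier relations by
  \<open>proj_commute\<close>, and \<open>exists_proj_nonzero\<close> finds one that does not kill
  v.\<close>

lemma exists_separating_eigenvector:
  assumes \<eta>: "\<eta> \<in> carrier N" "\<eta> \<noteq> \<one>\<^bsub>N\<^esub>" and "finite H" "H \<subseteq> carrier N"
  shows "\<exists>v \<in> carrier N \<rightarrow> carrier F. (\<exists>x \<in> carrier N. v x \<noteq> \<zero>) \<and>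
    (\<exists>c \<in> carrier F. c \<noteq> \<one> \<and> (\<forall>x \<in> carrier N. v x = c \<otimes> v (\<eta> \<bullet> x))) \<and>
    (\<forall>a \<in> H. \<exists>c \<in> carrier F. \<forall>x \<in> carrier N. v x = c \<otimes> v (a \<bullet> x))"
  using assms(3,4)
proof (induction H rule: finite_induct)
  case empty
  \<comment> \<open>The delta function at the identity. Were all its projections with j > 0 zero, it
    would be a multiple of its projection for j = 0 and so invariant under translation by \<eta>,
    which moves the identity.\<close>
  define v where "v x = (if x = \<one>\<^bsub>N\<^esub> then \<one> else \<zero>)" for x
  have v: "v \<in> carrier N \<rightarrow> carrier F" by (auto simp: v_def)
  have "\<exists>j. 0 < j \<and> j < e \<and> (\<exists>x \<in> carrier N. proj \<eta> j v x \<noteq> \<zero>)"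
  proof (rule ccontr)
    assume *: "\<not> ?thesis"
    have "[e] \<cdot> \<one> \<otimes> v x = proj \<eta> 0 v x" if x: "x \<in> carrier N" for x
    proof -
      have "[e] \<cdot> \<one> \<otimes> v x = (\<Oplus>j\<in>{..<e}. if j = 0 then proj \<eta> j v x else \<zero>)"
        unfolding sum_proj[OF v \<eta>(1) x, symmetric]
        using * x proj_closed[OF v \<eta>(1) x] by (intro finsum_cong') auto
      also have "\<dots> = proj \<eta> 0 v x"
        using e_pos proj_closed[OF v \<eta>(1) x] by (intro add.finprod_singleton_swap) auto
      finally show ?thesis .
    qed
    from this[of "\<one>\<^bsub>N\<^esub>"] this[of \<eta>] show False
      using proj_eigen[OF v \<eta>(1), of "\<one>\<^bsub>N\<^esub>" 0] proj_closed[OF v \<eta>(1) \<eta>(1), of 0] char[OF e_pos] \<eta>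
      by (auto simp: v_def)
  qed
  then obtain j x where j: "0 < j" "j < e" and x: "x \<in> carrier N" "proj \<eta> j v x \<noteq> \<zero>" by blast
  then show ?case
    using \<zeta> proj_closed[OF v \<eta>(1)] proj_eigen[OF v \<eta>(1)]
    by (intro bexI[of _ "proj \<eta> j v"] conjI bexI[of _ x] bexI[of _ "\<zeta> [^] j"]) auto
next
  case (insert b H)
  then obtain v x c where v: "v \<in> carrier N \<rightarrow> carrier F" and x: "x \<in> carrier N" "v x \<noteq> \<zero>"
    and c: "c \<in> carrier F" "c \<noteq> \<one>" "\<And>x. x \<in> carrier N \<Longrightarrow> v x = c \<otimes> v (\<eta> \<bullet> x)"
    and H: "\<forall>a \<in> H. \<exists>c \<in> carrier F. \<forall>x \<in> carrier N. v x = c \<otimes> v (a \<bullet> x)"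
    by auto
  have b: "b \<in> carrier N" using insert.prems by auto
  obtain j where j: "proj b j v x \<noteq> \<zero>" using exists_proj_nonzero[OF v b x] by auto
  have "\<exists>c \<in> carrier F. \<forall>x \<in> carrier N. proj b j v x = c \<otimes> proj b j v (a \<bullet> x)" if a: "a \<in> insert b H" for a
  proof (cases "a = b")
    case True
    then show ?thesis using \<zeta> proj_eigen[OF v b] by (intro bexI[of _ "\<zeta> [^] j"]) auto
  next
    case False
    then obtain d where "d \<in> carrier F" "\<forall>x \<in> carrier N. v x = d \<otimes> v (a \<bullet> x)" "a \<in> carrier N"
      using H a insert.prems by blast
    then show ?thesis using proj_commute[OF v b, of a d] by (intro bexI[of _ d]) blast
  qed
  then show ?case
    using j x c proj_closed[OF v b] proj_commute[OF v b \<eta>(1) c(1) c(3)]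
    by (intro bexI[of _ "proj b j v"] conjI bexI[of _ x] bexI[of _ c]) auto
qed

abbreviation dual where "dual \<equiv> characters N F"

lemma char_closed: "\<chi> \<in> dual \<Longrightarrow> a \<in> carrier N \<Longrightarrow> \<chi> a \<in> carrier F"
  and char_nonzero: "\<chi> \<in> dual \<Longrightarrow> a \<in> carrier N \<Longrightarrow> \<chi> a \<noteq> \<zero>"
  and char_mult: "\<chi> \<in> dual \<Longrightarrow> a \<in> carrier N \<Longrightarrow> b \<in> carrier N \<Longrightarrow> \<chi> (a \<bullet> b) = \<chi> a \<otimes> \<chi> b"
  by (auto simp: characters_def hom_def)

lemma char_one: assumes "\<chi> \<in> dual" shows "\<chi> \<one>\<^bsub>N\<^esub> = \<one>"
proof -
  have "\<chi> \<one>\<^bsub>N\<^esub> \<otimes> \<chi> \<one>\<^bsub>N\<^esub> = \<chi> \<one>\<^bsub>N\<^esub> \<otimes> \<one>"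
    using char_mult[OF assms, of "\<one>\<^bsub>N\<^esub>" "\<one>\<^bsub>N\<^esub>"] char_closed[OF assms, of "\<one>\<^bsub>N\<^esub>"] by simp
  then show ?thesis
    using char_closed[OF assms, of "\<one>\<^bsub>N\<^esub>"] char_nonzero[OF assms, of "\<one>\<^bsub>N\<^esub>"]
    by (subst (asm) m_lcancel) auto
qed

lemma char_memI:
  assumes "\<chi> \<in> extensional (carrier N)" "\<And>a. a \<in> carrier N \<Longrightarrow> \<chi> a \<in> carrier F"
    "\<And>a. a \<in> carrier N \<Longrightarrow> \<chi> a \<noteq> \<zero>"
    "\<And>a b. a \<in> carrier N \<Longrightarrow> b \<in> carrier N \<Longrightarrow> \<chi> (a \<bullet> b) = \<chi> a \<otimes> \<chi> b"
  shows "\<chi> \<in> dual"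
  using assms by (auto simp: characters_def hom_def)

lemma exists_separating_character:
  assumes \<eta>: "\<eta> \<in> carrier N" "\<eta> \<noteq> \<one>\<^bsub>N\<^esub>"
  shows "\<exists>\<chi>\<in>dual. \<chi> \<eta> \<noteq> \<one>"
proof -
  from exists_separating_eigenvector[OF \<eta> fin subset_refl]
  obtain v x c where v: "\<And>a. a \<in> carrier N \<Longrightarrow> v a \<in> carrier F" and x: "x \<in> carrier N" "v x \<noteq> \<zero>"
    and c: "c \<in> carrier F" "c \<noteq> \<one>" "\<And>x. x \<in> carrier N \<Longrightarrow> v x = c \<otimes> v (\<eta> \<bullet> x)"
    and eig: "\<forall>a \<in> carrier N. \<exists>c \<in> carrier F. \<forall>x \<in> carrier N. v x = c \<otimes> v (a \<bullet> x)"
    unfolding Pi_def by blast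
  from eig obtain C where C: "\<And>a. a \<in> carrier N \<Longrightarrow> C a \<in> carrier F"
       "\<And>a x. a \<in> carrier N \<Longrightarrow> x \<in> carrier N \<Longrightarrow> v x = C a \<otimes> v (a \<bullet> x)"
    by metis
  have C0: "C a \<noteq> \<zero>" if "a \<in> carrier N" for a
    using C(2)[OF that x(1)] x v that by auto
  \<comment> \<open>The value at the identity is \<open>C x\<close> times the value at x, and both
    factors are nonzero.\<close>
  have v1: "v \<one>\<^bsub>N\<^esub> \<noteq> \<zero>"
    using C(2)[OF x(1), of "\<one>\<^bsub>N\<^esub>"] C0[OF x(1)] C(1)[OF x(1)] v x by (auto simp: integral_iff)
  have inv1: "inv (v \<one>\<^bsub>N\<^esub>) \<in> carrier F" "inv (v \<one>\<^bsub>N\<^esub>) \<otimes> v \<one>\<^bsub>N\<^esub> = \<one>"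
    using v1 v[of "\<one>\<^bsub>N\<^esub>"] field_Units by auto
  \<comment> \<open>Both sides are multiplied by \<open>C a\<close>, which turns v(ab) into v(b) and
    v(a) into v(1), and then \<open>C a\<close> is cancelled.\<close>
  have mult: "v (a \<bullet> b) \<otimes> v \<one>\<^bsub>N\<^esub> = v a \<otimes> v b" if "a \<in> carrier N" "b \<in> carrier N" for a b
  proof -
    have "C a \<otimes> (v (a \<bullet> b) \<otimes> v \<one>\<^bsub>N\<^esub>) = (C a \<otimes> v (a \<bullet> b)) \<otimes> v \<one>\<^bsub>N\<^esub>"
      using that v C(1) by (simp add: m_assoc)
    also have "\<dots> = v b \<otimes> (C a \<otimes> v a)"
      using C(2)[of a b, symmetric] C(2)[of a "\<one>\<^bsub>N\<^esub>", symmetric] that by simp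
    also have "\<dots> = C a \<otimes> (v a \<otimes> v b)" using that v C(1) by (simp add: m_ac)
    finally show ?thesis using that v C(1) C0 by (subst (asm) m_lcancel) auto
  qed
  define \<chi> where "\<chi> = (\<lambda>a\<in>carrier N. v a \<otimes> inv (v \<one>\<^bsub>N\<^esub>))"
  have "\<chi> \<in> dual"
  proof (rule char_memI)
    fix a assume a: "a \<in> carrier N"
    have "v a \<noteq> \<zero>" using C(2)[OF a, of "\<one>\<^bsub>N\<^esub>"] C(1)[OF a] v1 a by auto
    moreover have "inv (v \<one>\<^bsub>N\<^esub>) \<noteq> \<zero>" using inv1 v[of "\<one>\<^bsub>N\<^esub>"] by auto
    ultimately show "\<chi> a \<noteq> \<zero>" using a v inv1 by (simp add: \<chi>_def integral_iff)
    fix b assume b: "b \<in> carrier N"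
    have "v (a \<bullet> b) \<otimes> inv (v \<one>\<^bsub>N\<^esub>) = (v (a \<bullet> b) \<otimes> v \<one>\<^bsub>N\<^esub>) \<otimes> inv (v \<one>\<^bsub>N\<^esub>) \<otimes> inv (v \<one>\<^bsub>N\<^esub>)"
      using a b v inv1 v[of "\<one>\<^bsub>N\<^esub>"] by (simp add: m_assoc m_comm[of "v \<one>\<^bsub>N\<^esub>"])
    then show "\<chi> (a \<bullet> b) = \<chi> a \<otimes> \<chi> b"
      unfolding mult[OF a b] using a b v inv1 by (simp add: \<chi>_def m_ac)
  qed (use v inv1 in \<open>auto simp: \<chi>_def\<close>)
  moreover have "\<chi> \<eta> \<noteq> \<one>"
  proof
    assume "\<chi> \<eta> = \<one>"
    then have "v \<eta> \<otimes> inv (v \<one>\<^bsub>N\<^esub>) \<otimes> v \<one>\<^bsub>N\<^esub> = v \<one>\<^bsub>N\<^esub>" using \<eta> v by (simp add: \<chi>_def)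
    then have "v \<eta> = v \<one>\<^bsub>N\<^esub>" using \<eta> v inv1 by (simp add: m_assoc)
    then have "c \<otimes> v \<one>\<^bsub>N\<^esub> = \<one> \<otimes> v \<one>\<^bsub>N\<^esub>" using c(3)[of "\<one>\<^bsub>N\<^esub>"] \<eta> v by simp
    then show False using c v1 v by (subst (asm) m_rcancel) auto
  qed
  ultimately show ?thesis by blast
qed

text \<open>All values of a character are roots of X^e - 1, of which there are finitely
  many.\<close>

lemma finite_dual: "finite dual"
proof -
  have roots: "finite {x \<in> carrier F. x [^] e = \<one>}"
  proof -
    have "is_root (unity_poly e) x" if "x \<in> carrier F" "x [^] e = \<one>" for x
      using eval_unity_poly[OF e_pos that(1)] that by (simp add: is_root_def) (simp add: unity_poly_def)
    then have "{x \<in> carrier F. x [^] e = \<one>} \<subseteq> {x. is_root (unity_poly e) x}" by blast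
    then show ?thesis
      using finite_number_of_roots[OF unity_poly_closed[OF carrier_is_subring]] by (rule finite_subset)
  qed
  have pow: "\<chi> a [^] e = \<one>" if "\<chi> \<in> dual" "a \<in> carrier N" for \<chi> a
  proof -
    have "\<chi> (a [^]\<^bsub>N\<^esub> k) = \<chi> a [^] k" for k :: nat
      using that by (induction k) (auto simp: char_one char_mult)
    then show ?thesis using that pow_e char_one by metis
  qed
  have "dual \<subseteq> carrier N \<rightarrow>\<^sub>E {x \<in> carrier F. x [^] e = \<one>}"
  proof
    fix \<chi> assume \<chi>: "\<chi> \<in> dual"
    then have "\<chi> \<in> extensional (carrier N)" by (simp add: characters_def)
    then show "\<chi> \<in> carrier N \<rightarrow>\<^sub>E {x \<in> carrier F. x [^] e = \<one>}"
      using pow[OF \<chi>] char_closed[OF \<chi>] by (simp add: PiE_iff)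
  qed
  moreover have "finite (carrier N \<rightarrow>\<^sub>E {x \<in> carrier F. x [^] e = \<one>})"
    using fin roots by (rule finite_PiE)
  ultimately show ?thesis by (rule finite_subset)
qed

section \<open>Orthogonality relations and Fourier inversion\<close>

definition fourier :: "('n \<Rightarrow> 'a) \<Rightarrow> ('n \<Rightarrow> 'a) \<Rightarrow> 'a" where
  "fourier x \<chi> = (\<Oplus>\<eta>\<in>carrier N. x \<eta> \<otimes> \<chi> \<eta>)"

lemma fourier_closed:
  "x \<in> carrier N \<rightarrow> carrier F \<Longrightarrow> \<chi> \<in> dual \<Longrightarrow> fourier x \<chi> \<in> carrier F"
  unfolding fourier_def using char_closed by (auto intro!: finsum_closed m_closed)

lemma fourier_cong:
  assumes "\<And>\<eta>. \<eta> \<in> carrier N \<Longrightarrow> x \<eta> = y \<eta>" "y \<in> carrier N \<rightarrow> carrier F" "\<chi> \<in> dual"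
  shows "fourier x \<chi> = fourier y \<chi>"
  unfolding fourier_def using assms(1) funcset_mem[OF assms(2)] char_closed[OF assms(3)] by (intro finsum_cong') auto

lemma fourier_add:
  assumes "x \<in> carrier N \<rightarrow> carrier F" "y \<in> carrier N \<rightarrow> carrier F" "\<chi> \<in> dual"
  shows "fourier (\<lambda>\<eta>. x \<eta> \<oplus> y \<eta>) \<chi> = fourier x \<chi> \<oplus> fourier y \<chi>"
proof -
  note cl = funcset_mem[OF assms(1)] funcset_mem[OF assms(2)] char_closed[OF assms(3)]
  have "fourier (\<lambda>\<eta>. x \<eta> \<oplus> y \<eta>) \<chi> = (\<Oplus>\<eta>\<in>carrier N. x \<eta> \<otimes> \<chi> \<eta> \<oplus> y \<eta> \<otimes> \<chi> \<eta>)"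
    unfolding fourier_def using cl by (intro finsum_cong') (auto simp: l_distr)
  then show ?thesis unfolding fourier_def using cl by (simp add: finsum_addf)
qed

lemma fourier_smult:
  assumes "c \<in> carrier F" "x \<in> carrier N \<rightarrow> carrier F" "\<chi> \<in> dual"
  shows "fourier (\<lambda>\<eta>. c \<otimes> x \<eta>) \<chi> = c \<otimes> fourier x \<chi>"
proof -
  note cl = assms(1) funcset_mem[OF assms(2)] char_closed[OF assms(3)]
  have "fourier (\<lambda>\<eta>. c \<otimes> x \<eta>) \<chi> = (\<Oplus>\<eta>\<in>carrier N. c \<otimes> (x \<eta> \<otimes> \<chi> \<eta>))"
    unfolding fourier_def using cl by (intro finsum_cong') (auto simp: m_assoc)
  then show ?thesis unfolding fourier_def using cl fin by (simp add: finsum_rdistr)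
qed

lemma fourier_unit:
  assumes "\<chi> \<in> dual"
  shows "fourier (\<lambda>\<eta>. if \<eta> = \<one>\<^bsub>N\<^esub> then \<one> else \<zero>) \<chi> = \<one>"
proof -
  have "fourier (\<lambda>\<eta>. if \<eta> = \<one>\<^bsub>N\<^esub> then \<one> else \<zero>) \<chi> = (\<Oplus>\<eta>\<in>carrier N. if \<eta> = \<one>\<^bsub>N\<^esub> then \<chi> \<eta> else \<zero>)"
    unfolding fourier_def using char_closed[OF assms] by (intro finsum_cong') auto
  also have "\<dots> = \<chi> \<one>\<^bsub>N\<^esub>"
    using fin char_closed[OF assms] by (intro add.finprod_singleton_swap) auto
  finally show ?thesis using char_one[OF assms] by simp
qed

lemma char_inv_mult:
  assumes "\<chi> \<in> dual" "a \<in> carrier N" shows "\<chi> a \<otimes> \<chi> (inv\<^bsub>N\<^esub> a) = \<one>"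
  using char_mult[OF assms(1,2), of "inv\<^bsub>N\<^esub> a"] char_one assms by simp

text \<open>A character \<psi> with \<open>\<psi> \<eta>\<close> different from 1 permutes the dual
  by multiplication and thereby scales the sum by \<open>\<psi> \<eta>\<close>. Its pointwise
  inverse \<open>\<psi>'\<close> gives the inverse permutation.\<close>

lemma sum_characters:
  assumes \<eta>: "\<eta> \<in> carrier N"
  shows "(\<Oplus>\<chi>\<in>dual. \<chi> \<eta>) = (if \<eta> = \<one>\<^bsub>N\<^esub> then [card dual] \<cdot> \<one> else \<zero>)"
proof (cases "\<eta> = \<one>\<^bsub>N\<^esub>")
  case True
  have "(\<Oplus>\<chi>\<in>dual. \<chi> \<eta>) = (\<Oplus>\<chi>\<in>dual. \<one>)" using True by (intro finsum_cong') (auto simp: char_one)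
  then show ?thesis using True by (simp add: finsum_one_card)
next
  case False
  obtain \<psi> where \<psi>: "\<psi> \<in> dual" "\<psi> \<eta> \<noteq> \<one>" using exists_separating_character[OF \<eta> False] by auto
  let ?S = "\<Oplus>\<chi>\<in>dual. \<chi> \<eta>"
  let ?m = "\<lambda>\<phi> \<chi>. \<lambda>a\<in>carrier N. \<phi> a \<otimes> \<chi> a"
  have S: "?S \<in> carrier F" using char_closed \<eta> by (auto intro!: finsum_closed)
  have m: "?m \<phi> \<chi> \<in> dual" if "\<phi> \<in> dual" "\<chi> \<in> dual" for \<phi> \<chi>
    using that by (intro char_memI) (auto simp: char_closed char_mult char_nonzero integral_iff m_ac)
  define \<psi>' where "\<psi>' = (\<lambda>a\<in>carrier N. \<psi> (inv\<^bsub>N\<^esub> a))"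
  have \<psi>': "\<psi>' \<in> dual"
    using \<psi> by (intro char_memI) (auto simp: \<psi>'_def char_closed char_mult char_nonzero N.inv_mult)
  have inv: "\<psi> a \<otimes> \<psi>' a = \<one>" "\<psi>' a \<otimes> \<psi> a = \<one>" if "a \<in> carrier N" for a
    using \<psi>(1) that by (auto simp: \<psi>'_def char_inv_mult char_closed m_comm)
  have bij: "bij_betw (?m \<psi>) dual dual"
  proof (rule bij_betwI[where g = "?m \<psi>'"])
    fix \<chi> assume \<chi>: "\<chi> \<in> dual"
    have "\<psi>' a \<otimes> (\<psi> a \<otimes> \<chi> a) = \<chi> a" "\<psi> a \<otimes> (\<psi>' a \<otimes> \<chi> a) = \<chi> a" if "a \<in> carrier N" for a
      using inv[OF that] \<chi> \<psi>(1) \<psi>' that by (auto simp: char_closed simp flip: m_assoc)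
    moreover have "\<chi> \<in> extensional (carrier N)" using \<chi> by (simp add: characters_def)
    ultimately show "?m \<psi>' (?m \<psi> \<chi>) = \<chi>" "?m \<psi> (?m \<psi>' \<chi>) = \<chi>"
      by (auto simp: fun_eq_iff extensional_def)
  qed (use m \<psi> \<psi>' in auto)
  have "\<psi> \<eta> \<otimes> ?S = (\<Oplus>\<chi>\<in>dual. ?m \<psi> \<chi> \<eta>)"
    using \<psi> \<eta> finite_dual by (subst finsum_rdistr) (auto simp: char_closed)
  also have "\<dots> = (\<Oplus>\<chi>\<in>?m \<psi> ` dual. \<chi> \<eta>)"
    using bij m[OF \<psi>(1)] \<eta> by (subst finsum_reindex) (auto simp: bij_betw_def char_closed)
  also have "\<dots> = ?S" using bij by (simp add: bij_betw_def)
  finally have "(\<psi> \<eta> \<ominus> \<one>) \<otimes> ?S = \<zero>" using \<psi> \<eta> S by (simp add: char_closed a_minus_def l_distr l_minus r_neg)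
  then show ?thesis using False \<psi> \<eta> S by (simp add: char_closed integral_iff)
qed

text \<open>After exchanging the sums, orthogonality over the dual leaves the single term \<eta> =
  \<theta>. The constant counts characters because the remaining inner sum runs over them.\<close>

lemma fourier_inversion:
  assumes x: "x \<in> carrier N \<rightarrow> carrier F" and \<theta>: "\<theta> \<in> carrier N"
  shows "(\<Oplus>\<chi>\<in>dual. fourier x \<chi> \<otimes> \<chi> (inv\<^bsub>N\<^esub> \<theta>)) = [card dual] \<cdot> \<one> \<otimes> x \<theta>"
proof -
  have xc: "x \<eta> \<in> carrier F" if "\<eta> \<in> carrier N" for \<eta> using x that by auto
  have "(\<Oplus>\<chi>\<in>dual. fourier x \<chi> \<otimes> \<chi> (inv\<^bsub>N\<^esub> \<theta>))
      = (\<Oplus>\<chi>\<in>dual. \<Oplus>\<eta>\<in>carrier N. x \<eta> \<otimes> \<chi> (\<eta> \<bullet> inv\<^bsub>N\<^esub> \<theta>))"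
    using \<theta> fin xc unfolding fourier_def
    by (intro finsum_cong') (auto simp: finsum_ldistr char_closed char_mult m_assoc Pi_def intro!: finsum_closed finsum_cong')
  also have "\<dots> = (\<Oplus>\<eta>\<in>carrier N. \<Oplus>\<chi>\<in>dual. x \<eta> \<otimes> \<chi> (\<eta> \<bullet> inv\<^bsub>N\<^esub> \<theta>))"
    using \<theta> fin finite_dual xc by (intro finsum_swap) (auto simp: char_closed)
  also have "\<dots> = (\<Oplus>\<eta>\<in>carrier N. if \<eta> = \<theta> then [card dual] \<cdot> \<one> \<otimes> x \<eta> else \<zero>)"
  proof (intro finsum_cong')
    fix \<eta> assume \<eta>: "\<eta> \<in> carrier N"
    have "(\<Oplus>\<chi>\<in>dual. x \<eta> \<otimes> \<chi> (\<eta> \<bullet> inv\<^bsub>N\<^esub> \<theta>)) = x \<eta> \<otimes> (\<Oplus>\<chi>\<in>dual. \<chi> (\<eta> \<bullet> inv\<^bsub>N\<^esub> \<theta>))"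
      using \<eta> \<theta> xc finite_dual by (subst finsum_rdistr) (auto simp: char_closed)
    moreover have "\<eta> \<bullet> inv\<^bsub>N\<^esub> \<theta> = \<one>\<^bsub>N\<^esub> \<longleftrightarrow> \<eta> = \<theta>"
      using \<eta> \<theta> by (metis N.inv_equality N.inv_inv N.r_inv N.inv_closed)
    ultimately show "(\<Oplus>\<chi>\<in>dual. x \<eta> \<otimes> \<chi> (\<eta> \<bullet> inv\<^bsub>N\<^esub> \<theta>)) = (if \<eta> = \<theta> then [card dual] \<cdot> \<one> \<otimes> x \<eta> else \<zero>)"
      using \<eta> \<theta> xc by (auto simp: sum_characters m_comm)
  qed (use xc in auto)
  also have "\<dots> = [card dual] \<cdot> \<one> \<otimes> x \<theta>"
    using \<theta> fin xc by (intro add.finprod_singleton_swap) auto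
  finally show ?thesis .
qed

text \<open>The trivial character makes the dual nonempty, so in characteristic zero the constant of
  \<open>fourier_inversion\<close> can be cancelled.\<close>

lemma fourier_inj:
  assumes "x \<in> carrier N \<rightarrow> carrier F" "y \<in> carrier N \<rightarrow> carrier F"
    and "\<And>\<chi>. \<chi> \<in> dual \<Longrightarrow> fourier x \<chi> = fourier y \<chi>" and \<theta>: "\<theta> \<in> carrier N"
  shows "x \<theta> = y \<theta>"
proof -
  have "(\<lambda>a\<in>carrier N. \<one>) \<in> dual" by (rule char_memI) auto
  then have "0 < card dual" using finite_dual card_gt_0_iff by blast
  moreover have "[card dual] \<cdot> \<one> \<otimes> x \<theta> = [card dual] \<cdot> \<one> \<otimes> y \<theta>"
    unfolding fourier_inversion[OF assms(1) \<theta>, symmetric] fourier_inversion[OF assms(2) \<theta>, symmetric]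
    using assms(2,3) \<theta> by (intro finsum_cong') (auto simp: fourier_closed char_closed)
  moreover have "x \<theta> \<in> carrier F" "y \<theta> \<in> carrier F" using assms by auto
  ultimately show ?thesis using char by (subst (asm) m_lcancel) auto
qed

text \<open>This rests on the other orthogonality relation, the one over N: the inner sum is that of
  the homomorphism \<chi>^-1 \<psi>, which is nontrivial unless \<chi> = \<psi>. Hence the inverse
  transform here divides by the order of N.\<close>

lemma fourier_surj:
  assumes f: "\<And>\<chi>. \<chi> \<in> dual \<Longrightarrow> f \<chi> \<in> carrier F"
  shows "\<exists>x \<in> carrier N \<rightarrow> carrier F. \<forall>\<chi> \<in> dual. fourier x \<chi> = f \<chi>"
proof -
  let ?n = "[card (carrier N)] \<cdot> \<one>"
  have "0 < card (carrier N)" using fin card_gt_0_iff by blast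
  then have "?n \<noteq> \<zero>" by (rule char)
  then have n: "inv ?n \<in> carrier F" "inv ?n \<otimes> ?n = \<one>" using field_Units by auto
  define y where "y \<eta> = inv ?n \<otimes> (\<Oplus>\<chi>\<in>dual. f \<chi> \<otimes> \<chi> (inv\<^bsub>N\<^esub> \<eta>))" for \<eta>
  have s: "(\<Oplus>\<chi>\<in>dual. f \<chi> \<otimes> \<chi> (inv\<^bsub>N\<^esub> \<eta>)) \<in> carrier F" if "\<eta> \<in> carrier N" for \<eta>
    using that f by (auto simp: char_closed intro!: finsum_closed)
  then have y: "y \<in> carrier N \<rightarrow> carrier F" using n by (auto simp: y_def)
  have "fourier y \<psi> = f \<psi>" if \<psi>: "\<psi> \<in> dual" for \<psi>
  proof -
    have "fourier y \<psi> = (\<Oplus>\<eta>\<in>carrier N. inv ?n \<otimes> ((\<Oplus>\<chi>\<in>dual. f \<chi> \<otimes> \<chi> (inv\<^bsub>N\<^esub> \<eta>)) \<otimes> \<psi> \<eta>))"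
      unfolding fourier_def using n s \<psi> by (intro finsum_cong') (auto simp: y_def m_assoc char_closed)
    also have "\<dots> = inv ?n \<otimes> (\<Oplus>\<eta>\<in>carrier N. (\<Oplus>\<chi>\<in>dual. f \<chi> \<otimes> \<chi> (inv\<^bsub>N\<^esub> \<eta>)) \<otimes> \<psi> \<eta>)"
      using n s \<psi> fin by (subst finsum_rdistr) (auto simp: char_closed)
    also have "(\<Oplus>\<eta>\<in>carrier N. (\<Oplus>\<chi>\<in>dual. f \<chi> \<otimes> \<chi> (inv\<^bsub>N\<^esub> \<eta>)) \<otimes> \<psi> \<eta>)
        = (\<Oplus>\<eta>\<in>carrier N. \<Oplus>\<chi>\<in>dual. f \<chi> \<otimes> (\<chi> (inv\<^bsub>N\<^esub> \<eta>) \<otimes> \<psi> \<eta>))"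
      using finite_dual f \<psi>
      by (intro finsum_cong') (auto simp: finsum_ldistr char_closed m_assoc Pi_def intro!: finsum_closed finsum_cong')
    also have "\<dots> = (\<Oplus>\<chi>\<in>dual. \<Oplus>\<eta>\<in>carrier N. f \<chi> \<otimes> (\<chi> (inv\<^bsub>N\<^esub> \<eta>) \<otimes> \<psi> \<eta>))"
      using fin finite_dual f \<psi> by (intro finsum_swap) (auto simp: char_closed)
    also have "\<dots> = (\<Oplus>\<chi>\<in>dual. if \<chi> = \<psi> then f \<chi> \<otimes> ?n else \<zero>)"
    proof (intro finsum_cong')
      fix \<chi> assume \<chi>: "\<chi> \<in> dual"
      have 1: "(\<Oplus>\<eta>\<in>carrier N. f \<chi> \<otimes> (\<chi> (inv\<^bsub>N\<^esub> \<eta>) \<otimes> \<psi> \<eta>)) = f \<chi> \<otimes> (\<Oplus>\<eta>\<in>carrier N. \<chi> (inv\<^bsub>N\<^esub> \<eta>) \<otimes> \<psi> \<eta>)"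
        using \<chi> \<psi> f fin by (subst finsum_rdistr) (auto simp: char_closed)
      show "(\<Oplus>\<eta>\<in>carrier N. f \<chi> \<otimes> (\<chi> (inv\<^bsub>N\<^esub> \<eta>) \<otimes> \<psi> \<eta>)) = (if \<chi> = \<psi> then f \<chi> \<otimes> ?n else \<zero>)"
      proof (cases "\<chi> = \<psi>")
        case True
        have "(\<Oplus>\<eta>\<in>carrier N. \<chi> (inv\<^bsub>N\<^esub> \<eta>) \<otimes> \<psi> \<eta>) = (\<Oplus>\<eta>\<in>carrier N. \<one>)"
          using True \<psi> by (intro finsum_cong') (auto simp: char_inv_mult char_closed m_comm[of "\<psi> (inv\<^bsub>N\<^esub> _)"])
        then show ?thesis using 1 True by (simp add: finsum_one_card)
      next
        case False
        have "\<chi> \<in> extensional (carrier N)" "\<psi> \<in> extensional (carrier N)"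
          using \<chi> \<psi> by (auto simp: characters_def)
        then obtain b where b: "b \<in> carrier N" "\<chi> b \<noteq> \<psi> b" using False extensionalityI by metis
        have "(\<Oplus>\<eta>\<in>carrier N. \<chi> (inv\<^bsub>N\<^esub> \<eta>) \<otimes> \<psi> \<eta>) = \<zero>"
        proof (rule finsum_hom_zero[OF N.is_group fin, where b = b])
          show "\<chi> (inv\<^bsub>N\<^esub> b) \<otimes> \<psi> b \<noteq> \<one>"
          proof
            assume "\<chi> (inv\<^bsub>N\<^esub> b) \<otimes> \<psi> b = \<one>"
            then have "\<chi> b \<otimes> (\<chi> (inv\<^bsub>N\<^esub> b) \<otimes> \<psi> b) = \<chi> b" using \<chi> b by (simp add: char_closed)
            then show False using \<chi> \<psi> b by (simp add: char_closed char_inv_mult flip: m_assoc)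
          qed
        qed (use \<chi> \<psi> b in \<open>auto simp: char_closed char_mult N.inv_mult m_ac\<close>)
        then show ?thesis using 1 False f \<chi> by simp
      qed
    qed (use f in auto)
    also have "\<dots> = f \<psi> \<otimes> ?n"
      using \<psi> finite_dual f by (intro add.finprod_singleton_swap) auto
    also have "inv ?n \<otimes> (f \<psi> \<otimes> ?n) = f \<psi>"
      using n f[OF \<psi>] by (simp add: m_comm[of "f \<psi>"] flip: m_assoc)
    finally show ?thesis .
  qed
  then show ?thesis using y by blast
qed

text \<open>For fixed \<chi> the transform is the linear extension of \<chi> to the group algebra,
  hence multiplicative; the computation substitutes h = k a.\<close>

lemma fourier_convolution:
  assumes x: "x \<in> carrier N \<rightarrow> carrier F" and y: "y \<in> carrier N \<rightarrow> carrier F" and \<chi>: "\<chi> \<in> dual"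
  shows "fourier (\<lambda>h. \<Oplus>k\<in>carrier N. x k \<otimes> y (inv\<^bsub>N\<^esub> k \<bullet> h)) \<chi> = fourier x \<chi> \<otimes> fourier y \<chi>"
proof -
  have xc: "x \<eta> \<in> carrier F" if "\<eta> \<in> carrier N" for \<eta> using x that by auto
  have yc: "y \<eta> \<in> carrier F" if "\<eta> \<in> carrier N" for \<eta> using y that by auto
  have "fourier (\<lambda>h. \<Oplus>k\<in>carrier N. x k \<otimes> y (inv\<^bsub>N\<^esub> k \<bullet> h)) \<chi>
      = (\<Oplus>h\<in>carrier N. \<Oplus>k\<in>carrier N. x k \<otimes> y (inv\<^bsub>N\<^esub> k \<bullet> h) \<otimes> \<chi> h)"
    unfolding fourier_def using \<chi> xc yc fin
    by (intro finsum_cong') (auto simp: finsum_ldistr char_closed Pi_def intro!: finsum_closed)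
  also have "\<dots> = (\<Oplus>k\<in>carrier N. \<Oplus>h\<in>carrier N. x k \<otimes> y (inv\<^bsub>N\<^esub> k \<bullet> h) \<otimes> \<chi> h)"
    using \<chi> xc yc fin by (intro finsum_swap) (auto simp: char_closed)
  also have "\<dots> = (\<Oplus>k\<in>carrier N. x k \<otimes> \<chi> k \<otimes> fourier y \<chi>)"
  proof (intro finsum_cong')
    fix k assume k: "k \<in> carrier N"
    have bij: "bij_betw (\<lambda>a. k \<bullet> a) (carrier N) (carrier N)"
      by (rule bij_betwI[where g = "\<lambda>a. inv\<^bsub>N\<^esub> k \<bullet> a"]) (use k in \<open>auto simp flip: N.m_assoc\<close>)
    have "(\<Oplus>h\<in>carrier N. x k \<otimes> y (inv\<^bsub>N\<^esub> k \<bullet> h) \<otimes> \<chi> h)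
        = (\<Oplus>h\<in>(\<lambda>a. k \<bullet> a) ` carrier N. x k \<otimes> y (inv\<^bsub>N\<^esub> k \<bullet> h) \<otimes> \<chi> h)"
      using bij by (simp add: bij_betw_def)
    also have "\<dots> = (\<Oplus>a\<in>carrier N. x k \<otimes> y (inv\<^bsub>N\<^esub> k \<bullet> (k \<bullet> a)) \<otimes> \<chi> (k \<bullet> a))"
      using bij k xc yc \<chi> by (subst finsum_reindex) (auto simp: bij_betw_def char_closed)
    also have "\<dots> = (\<Oplus>a\<in>carrier N. x k \<otimes> \<chi> k \<otimes> (y a \<otimes> \<chi> a))"
      using k xc yc \<chi>
      by (intro finsum_cong') (auto simp: char_closed char_mult m_ac simp flip: N.m_assoc)
    also have "\<dots> = x k \<otimes> \<chi> k \<otimes> fourier y \<chi>"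
      unfolding fourier_def using k xc yc \<chi> fin by (subst finsum_rdistr) (auto simp: char_closed)
    finally show "(\<Oplus>h\<in>carrier N. x k \<otimes> y (inv\<^bsub>N\<^esub> k \<bullet> h) \<otimes> \<chi> h) = x k \<otimes> \<chi> k \<otimes> fourier y \<chi>" .
  qed (use xc \<chi> y in \<open>auto simp: char_closed fourier_closed\<close>)
  also have "\<dots> = fourier x \<chi> \<otimes> fourier y \<chi>"
    unfolding fourier_def[of x] using xc \<chi> y fin
    by (subst finsum_ldistr) (auto simp: char_closed fourier_closed)
  finally show ?thesis .
qed

end

section \<open>Extension of field homomorphisms and fixed fields\<close>

context field
begin

lemma poly_ring_subfield: "subfield F R \<Longrightarrow> poly_ring (R\<lparr>carrier := F\<rparr>) = F[X]"
  by (simp add: univ_poly_consistent subfieldE(1))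

lemma poly_set_incl: "p \<in> carrier (F[X]) \<Longrightarrow> set p \<subseteq> F"
  by (auto simp flip: univ_poly_carrier dest: polynomial_incl)

lemma subfield_hom_eval:
  assumes F: "subfield F R" and M: "subfield M R"
    and \<phi>: "\<phi> \<in> ring_hom (R\<lparr>carrier := F\<rparr>) (R\<lparr>carrier := M\<rparr>)"
    and "set p \<subseteq> F" "x \<in> F"
  shows "\<phi> (eval p x) = eval (map \<phi> p) (\<phi> x)"
proof -
  interpret S: field "R\<lparr>carrier := F\<rparr>" using F by (rule subfield_iff(2))
  interpret T: field "R\<lparr>carrier := M\<rparr>" using M by (rule subfield_iff(2))
  interpret ring_hom_ring "R\<lparr>carrier := F\<rparr>" "R\<lparr>carrier := M\<rparr>" \<phi>
    using \<phi> by (intro ring_hom_ringI2 S.is_ring T.is_ring)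
  show ?thesis
    using eval_hom'[of x p] assms(4,5) eval_consistent[OF subfieldE(1)[OF F]] eval_consistent[OF subfieldE(1)[OF M]]
    by simp
qed

text \<open>An element of the simple extension is p(x) for some p and is sent to the value of
  \<open>map \<phi> p\<close> at y. Two choices of p differ by a multiple of the minimal polynomial
  of x, whose image vanishes at y, so the choice made by \<open>SOME\<close> is immaterial.\<close>

lemma extend_hom_to_simple_extension:
  assumes F: "subfield F R" and M: "subfield M R"
    and \<phi>: "\<phi> \<in> ring_hom (R\<lparr>carrier := F\<rparr>) (R\<lparr>carrier := M\<rparr>)"
    and x: "x \<in> carrier R" "(algebraic over F) x"
    and y: "y \<in> M" "eval (map \<phi> (Irr F x)) y = \<zero>"
  shows "\<exists>\<tau> \<in> ring_hom (R\<lparr>carrier := simple_extension F x\<rparr>) (R\<lparr>carrier := M\<rparr>). (\<forall>a\<in>F. \<tau> a = \<phi> a) \<and> \<tau> x = y"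
proof -
  let ?S = "R\<lparr>carrier := F\<rparr>" and ?T = "R\<lparr>carrier := M\<rparr>"
  interpret S: field ?S using F by (rule subfield_iff(2))
  interpret T: field ?T using M by (rule subfield_iff(2))
  interpret PF: domain "F[X]" by (rule univ_poly_is_domain[OF subfieldE(1)[OF F]])
  define \<Psi> where "\<Psi> = (\<lambda>p. eval (map \<phi> p) y)"
  have "map \<phi> \<in> ring_hom (F[X]) (M[X])"
    using map_poly_ring_hom[OF \<phi> S.field_axioms T.field_axioms] poly_ring_subfield F M by simp
  moreover have "(\<lambda>p. eval p y) \<in> ring_hom (M[X]) ?T"
    using T.eval_is_hom[OF T.carrier_is_subring, of y] y poly_ring_subfield[OF M]
      eval_consistent[OF subfieldE(1)[OF M]] by simp
  ultimately have "\<Psi> \<in> ring_hom (F[X]) ?T"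
    using ring_hom_trans[of "map \<phi>" "F[X]" "M[X]" "\<lambda>p. eval p y" ?T] by (simp add: \<Psi>_def comp_def)
  then interpret \<Psi>: ring_hom_ring "F[X]" ?T \<Psi>
    by (intro ring_hom_ringI2 PF.ring_axioms T.ring_axioms)
  interpret ev: ring_hom_ring "F[X]" R "\<lambda>p. eval p x"
    by (rule eval_ring_hom[OF subfieldE(1)[OF F] x(1)])
  note Irr = IrrE[OF F x]
  have wd: "\<Psi> p = \<Psi> q" if p: "p \<in> carrier (F[X])" and q: "q \<in> carrier (F[X])" and eq: "eval p x = eval q x" for p q
  proof -
    define d where "d = p \<ominus>\<^bsub>F[X]\<^esub> q"
    have d: "d \<in> carrier (F[X])" using p q by (simp add: d_def)
    have "eval d x = \<zero>" unfolding d_def a_minus_def using p q eq by (simp add: r_neg)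
    then have "Irr F x pdivides d" using Irr_minimal[OF F x d] by simp
    then obtain r where r: "r \<in> carrier (F[X])" "d = Irr F x \<otimes>\<^bsub>F[X]\<^esub> r"
      using pdivides_iff_shell[OF F Irr(1) d] by (auto simp: factor_def)
    then have "\<Psi> d = \<zero>" using \<Psi>.hom_mult[OF Irr(1) r(1)] y(2) \<Psi>.hom_closed[OF r(1)] subfieldE(3)[OF M] by (auto simp: \<Psi>_def)
    moreover have "p = d \<oplus>\<^bsub>F[X]\<^esub> q" using p q by (simp add: d_def a_minus_def PF.a_assoc PF.l_neg)
    ultimately show ?thesis using \<Psi>.hom_add[OF d q] \<Psi>.hom_closed[OF q] T.l_zero by simp
  qed
  define \<tau> where "\<tau> a = \<Psi> (SOME p. p \<in> carrier (F[X]) \<and> eval p x = a)" for a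
  have \<tau>: "\<tau> (eval p x) = \<Psi> p" if "p \<in> carrier (F[X])" for p
  proof -
    let ?P = "\<lambda>q. q \<in> carrier (F[X]) \<and> eval q x = eval p x"
    have "?P (SOME q. ?P q)" using that by (intro someI[of ?P p]) simp
    then show ?thesis unfolding \<tau>_def using wd that by blast
  qed
  have img: "simple_extension F x = (\<lambda>p. eval p x) ` carrier (F[X])"
    using simple_extension_as_eval_img[OF subfieldE(3)[OF F] x(1)] .
  have "\<tau> \<in> ring_hom (R\<lparr>carrier := simple_extension F x\<rparr>) ?T"
  proof (rule ring_hom_memI)
    fix a b assume "a \<in> carrier (R\<lparr>carrier := simple_extension F x\<rparr>)" "b \<in> carrier (R\<lparr>carrier := simple_extension F x\<rparr>)"
    then obtain p q where p: "p \<in> carrier (F[X])" "a = eval p x" and q: "q \<in> carrier (F[X])" "b = eval q x"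
      by (auto simp: img)
    show "\<tau> a \<in> carrier ?T" using p \<tau> \<Psi>.hom_closed by simp
    show "\<tau> (a \<otimes>\<^bsub>R\<lparr>carrier := simple_extension F x\<rparr>\<^esub> b) = \<tau> a \<otimes>\<^bsub>?T\<^esub> \<tau> b"
      using p q \<tau>[of p] \<tau>[of q] \<tau>[OF PF.m_closed[OF p(1) q(1)]] \<Psi>.hom_mult[OF p(1) q(1)] by simp
    show "\<tau> (a \<oplus>\<^bsub>R\<lparr>carrier := simple_extension F x\<rparr>\<^esub> b) = \<tau> a \<oplus>\<^bsub>?T\<^esub> \<tau> b"
      using p q \<tau>[of p] \<tau>[of q] \<tau>[OF PF.a_closed[OF p(1) q(1)]] \<Psi>.hom_add[OF p(1) q(1)] by simp
  next
    show "\<tau> \<one>\<^bsub>R\<lparr>carrier := simple_extension F x\<rparr>\<^esub> = \<one>\<^bsub>?T\<^esub>"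
      using \<tau>[OF PF.one_closed] \<Psi>.hom_one ev.hom_one by simp
  qed
  moreover have "\<tau> a = \<phi> a" if a: "a \<in> F" for a
  \<comment> \<open>The zero constant is the empty list; \<open>[a]\<close> is a polynomial only for
    nonzero \<open>a\<close>.\<close>
  proof (cases "a = \<zero>")
    case True
    have "\<phi> \<zero> = \<zero>" using ring_hom_zero[OF \<phi> S.is_ring T.is_ring] by simp
    then show ?thesis using \<tau>[OF PF.zero_closed] True by (simp add: univ_poly_zero \<Psi>_def)
  next
    case False
    then have "[a] \<in> carrier (F[X])" using a by (auto simp flip: univ_poly_carrier)
    moreover have "\<phi> a \<in> carrier R" "a \<in> carrier R"
      using ring_hom_closed[OF \<phi>, of a] a subfieldE(3)[OF M] subfieldE(3)[OF F] by auto
    moreover have "y \<in> carrier R" using y subfieldE(3)[OF M] by auto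
    ultimately show ?thesis using \<tau>[of "[a]"] x by (simp add: \<Psi>_def)
  qed
  moreover have "\<tau> x = y"
  proof -
    have "[\<one>, \<zero>] \<in> carrier (F[X])"
      using subringE(2,3)[OF subfieldE(1)[OF F]] by (auto simp: polynomial_def simp flip: univ_poly_carrier)
    moreover have "\<phi> \<zero> = \<zero>" using ring_hom_zero[OF \<phi> S.is_ring T.is_ring] by simp
    moreover have "\<phi> \<one> = \<one>" using ring_hom_one[OF \<phi>] by simp
    moreover have "y \<in> carrier R" using y subfieldE(3)[OF M] by auto
    ultimately show ?thesis using \<tau>[of "[\<one>, \<zero>]"] x by (simp add: \<Psi>_def)
  qed
  ultimately show ?thesis by blast
qed

lemma splitted_factor_has_root:
  assumes M: "subfield M R" and p: "p \<in> carrier (M[X])" "p \<noteq> []" "ring.splitted (R\<lparr>carrier := M\<rparr>) p"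
    and q: "q \<in> carrier (M[X])" "q divides\<^bsub>M[X]\<^esub> p" "0 < degree q"
  shows "\<exists>y\<in>M. eval q y = \<zero>"
proof -
  interpret M: field "R\<lparr>carrier := M\<rparr>" using M by (rule subfield_iff(2))
  note [simp] = univ_poly_consistent[OF subfieldE(1)[OF M]] eval_consistent[OF subfieldE(1)[OF M]]
  have "M.splitted q"
    using M.pdivides_imp_splitted[of q p] p q by (simp add: pdivides_def)
  then have "M.roots q \<noteq> {#}" using q(3) by (auto simp: M.splitted_def)
  then obtain y where "y \<in># M.roots q" by blast
  then have "M.is_root q y" using M.roots_mem_iff_is_root[of q] q(1) by simp
  then show ?thesis by (auto simp: M.is_root_def)
qed

text \<open>The minimal polynomial of z over F divides p. Having coefficients in K, p is unchanged
  by \<open>map \<phi>\<close>, so the image of the minimal polynomial divides p as well and has a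
  root in M, where p splits.\<close>

lemma extend_hom_by_split_element:
  assumes K: "subfield K R" and F: "subfield F R" and M: "subfield M R" and "K \<subseteq> F" "F \<subseteq> M"
    and \<phi>: "\<phi> \<in> ring_hom (R\<lparr>carrier := F\<rparr>) (R\<lparr>carrier := M\<rparr>)" "\<And>k. k \<in> K \<Longrightarrow> \<phi> k = k"
    and z: "z \<in> M" and p: "p \<in> carrier (K[X])" "p \<noteq> []" "ring.splitted (R\<lparr>carrier := M\<rparr>) p" "eval p z = \<zero>"
  shows "\<exists>\<tau> \<in> ring_hom (R\<lparr>carrier := simple_extension F z\<rparr>) (R\<lparr>carrier := M\<rparr>). (\<forall>a\<in>F. \<tau> a = \<phi> a)"
proof -
  interpret S: field "R\<lparr>carrier := F\<rparr>" using F by (rule subfield_iff(2))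
  interpret T: field "R\<lparr>carrier := M\<rparr>" using M by (rule subfield_iff(2))
  have zR: "z \<in> carrier R" using z subfieldE(3)[OF M] by auto
  have mono: "carrier (A[X]) \<subseteq> carrier (B[X])" if "A \<subseteq> B" for A B
    using that by (auto simp: polynomial_def simp flip: univ_poly_carrier) blast
  have pF: "p \<in> carrier (F[X])" and pM: "p \<in> carrier (M[X])" using mono[of K F] mono[of K M] p(1) assms(4,5) by auto
  have alg: "(algebraic over F) z" using pF p by (intro algebraicI)
  note Irr = IrrE[OF F zR alg]
  obtain r where r: "r \<in> carrier (F[X])" "p = Irr F z \<otimes>\<^bsub>F[X]\<^esub> r"
    using Irr_minimal[OF F zR alg pF p(4)] pdivides_iff_shell[OF F Irr(1) pF] by (auto simp: factor_def)
  have hom: "map \<phi> \<in> ring_hom (F[X]) (M[X])"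
    using map_poly_ring_hom[OF \<phi>(1) S.field_axioms T.field_axioms] poly_ring_subfield F M by simp
  have "map \<phi> p = p" using poly_set_incl[OF p(1)] \<phi>(2) by (intro map_idI) auto
  then have "p = map \<phi> (Irr F z) \<otimes>\<^bsub>M[X]\<^esub> map \<phi> r" using r ring_hom_mult[OF hom Irr(1) r(1)] by simp
  then have "map \<phi> (Irr F z) divides\<^bsub>M[X]\<^esub> p" using ring_hom_closed[OF hom r(1)] by (auto simp: factor_def)
  moreover have "0 < degree (Irr F z)" using pirreducible_degree[OF F Irr(1,2)] by simp
  ultimately obtain y where "y \<in> M" "eval (map \<phi> (Irr F z)) y = \<zero>"
    using splitted_factor_has_root[OF M pM p(2,3) ring_hom_closed[OF hom Irr(1)]] by auto
  then show ?thesis using extend_hom_to_simple_extension[OF F M \<phi>(1) zR alg] by blast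
qed

text \<open>The elements are adjoined one at a time. The final field is only claimed to contain the
  list; once the list spans M over K, this makes it equal to M.\<close>

lemma extend_hom_by_split_elements:
  assumes K: "subfield K R" and M: "subfield M R"
    and "set us \<subseteq> M"
    and "\<And>u. u \<in> set us \<Longrightarrow> \<exists>p\<in>carrier (K[X]). p \<noteq> [] \<and> ring.splitted (R\<lparr>carrier := M\<rparr>) p \<and> eval p u = \<zero>"
    and "subfield F R" "K \<subseteq> F" "F \<subseteq> M"
    and "\<phi> \<in> ring_hom (R\<lparr>carrier := F\<rparr>) (R\<lparr>carrier := M\<rparr>)" "\<And>k. k \<in> K \<Longrightarrow> \<phi> k = k"
  shows "\<exists>F' \<tau>. subfield F' R \<and> F \<subseteq> F' \<and> F' \<subseteq> M \<and> set us \<subseteq> F' \<and>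
    \<tau> \<in> ring_hom (R\<lparr>carrier := F'\<rparr>) (R\<lparr>carrier := M\<rparr>) \<and> (\<forall>a\<in>F. \<tau> a = \<phi> a)"
  using assms(3-)
proof (induction us arbitrary: F \<phi>)
  case Nil
  then show ?case by (intro exI[of _ F] exI[of _ \<phi>]) auto
next
  case (Cons u us)
  obtain p where p: "p \<in> carrier (K[X])" "p \<noteq> []" "ring.splitted (R\<lparr>carrier := M\<rparr>) p" "eval p u = \<zero>"
    using Cons.prems(2)[of u] by auto
  have u: "u \<in> M" "u \<in> carrier R" using Cons.prems(1) subfieldE(3)[OF M] by auto
  have "(algebraic over K) u" using p by (intro algebraicI)
  then have alg: "(algebraic over F) u" using algebraic_mono[OF Cons.prems(4)] by blast
  let ?F = "simple_extension F u"
  obtain \<tau> where \<tau>: "\<tau> \<in> ring_hom (R\<lparr>carrier := ?F\<rparr>) (R\<lparr>carrier := M\<rparr>)" "\<forall>a\<in>F. \<tau> a = \<phi> a"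
    using extend_hom_by_split_element[OF K Cons.prems(3) M Cons.prems(4-7) u(1) p] by blast
  have F: "subfield ?F R" using simple_extension_is_subfield[OF Cons.prems(3) u(2)] alg by simp
  have incl: "F \<subseteq> ?F" "u \<in> ?F" "?F \<subseteq> M"
    using simple_extension_incl[OF subfieldE(3)[OF Cons.prems(3)] u(2)]
      simple_extension_mem[OF subfieldE(1)[OF Cons.prems(3)] u(2)]
      simple_extension_subring_incl[OF subfieldE(1)[OF M] Cons.prems(5) u(1)] by auto
  have "\<tau> k = k" if "k \<in> K" for k using \<tau>(2) that Cons.prems(4,7) by auto
  from Cons.IH[OF _ _ F subset_trans[OF Cons.prems(4) incl(1)] incl(3) \<tau>(1) this] Cons.prems(1,2,4) incl
  obtain F' \<rho> where "subfield F' R" "?F \<subseteq> F'" "F' \<subseteq> M" "set us \<subseteq> F'"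
    "\<rho> \<in> ring_hom (R\<lparr>carrier := F'\<rparr>) (R\<lparr>carrier := M\<rparr>)" "\<forall>a\<in>?F. \<rho> a = \<tau> a"
    by auto
  then show ?case using incl \<tau>(2) by (intro exI[of _ F'] exI[of _ \<rho>]) auto
qed

text \<open>An endomorphism over \<open>K\<close> permutes the finitely many roots of each polynomial over \<open>K\<close>.\<close>

lemma algebraic_endomorphism_in_galois_group:
  assumes K: "subfield K R" and M: "subfield M R" and "K \<subseteq> M" and alg: "\<And>z. z \<in> M \<Longrightarrow> (algebraic over K) z"
    and \<tau>: "\<tau> \<in> ring_hom (R\<lparr>carrier := M\<rparr>) (R\<lparr>carrier := M\<rparr>)" "\<And>k. k \<in> K \<Longrightarrow> \<tau> k = k"
  shows "restrict \<tau> M \<in> carrier (galois_group R M K)"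
proof -
  interpret M: field "R\<lparr>carrier := M\<rparr>" using M by (rule subfield_iff(2))
  have inj: "inj_on \<tau> M"
    using non_trivial_field_hom_is_inj[OF \<tau>(1) M.field_axioms M.field_axioms] by simp
  have closed: "\<tau> z \<in> M" if "z \<in> M" for z using ring_hom_closed[OF \<tau>(1)] that by simp
  have "M \<subseteq> \<tau> ` M"
  proof
    fix z assume z: "z \<in> M"
    obtain p where p: "p \<in> carrier (K[X])" "p \<noteq> []" "eval p z = \<zero>"
      using algebraicE[OF subfieldE(1)[OF K] _ alg[OF z]] z subfieldE(3)[OF M] by auto
    define Z where "Z = {w \<in> M. eval p w = \<zero>}"
    have "p \<in> carrier (poly_ring R)" using carrier_polynomial_shell[OF subfieldE(1)[OF K] p(1)] .
    then have "finite {w. is_root p w}" by (rule finite_number_of_roots)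
    then have "finite Z"
      by (rule rev_finite_subset) (use p(2) subfieldE(3)[OF M] in \<open>auto simp: Z_def is_root_def\<close>)
    moreover have "\<tau> ` Z \<subseteq> Z"
    proof
      fix v assume "v \<in> \<tau> ` Z"
      then obtain w where w: "w \<in> M" "eval p w = \<zero>" "v = \<tau> w" by (auto simp: Z_def)
      have "map \<tau> p = p" using poly_set_incl[OF p(1)] \<tau>(2) by (intro map_idI) auto
      then have "eval p v = \<tau> (eval p w)"
        using subfield_hom_eval[OF M M \<tau>(1) _ w(1), of p] poly_set_incl[OF p(1)] assms(3) w(3) by auto
      also have "\<dots> = \<zero>" using w(2) ring_hom_zero[OF \<tau>(1) M.is_ring M.is_ring] by simp
      finally show "v \<in> Z" using closed w by (simp add: Z_def)
    qed
    moreover have "inj_on \<tau> Z" using inj by (rule inj_on_subset) (auto simp: Z_def)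
    ultimately have "\<tau> ` Z = Z" by (intro endo_inj_surj)
    moreover have "z \<in> Z" using z p by (simp add: Z_def)
    ultimately show "z \<in> \<tau> ` M" by (auto simp: Z_def)
  qed
  then have "bij_betw \<tau> M M" using inj closed by (auto simp: bij_betw_def)
  then have "restrict \<tau> M \<in> Bij M" by (auto simp: Bij_def bij_betw_def inj_on_def)
  moreover have "restrict \<tau> M \<in> ring_hom (R\<lparr>carrier := M\<rparr>) (R\<lparr>carrier := M\<rparr>)"
    using \<tau>(1) M.m_closed M.a_closed M.one_closed by (auto simp: ring_hom_def)
  ultimately show ?thesis using \<tau>(2) assms(3) by (auto simp: galois_group_def)
qed

text \<open>By normality the minimal polynomials of a spanning list of M over K split in M, so
  \<phi> extends along the list to all of M, and an endomorphism of M over K is an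
  automorphism.\<close>

lemma normal_extension_hom_extends:
  assumes K: "subfield K R" and M: "subfield M R" and "K \<subseteq> M" and fd: "finite_dimension K M" and nrm: "normal_extension R K M"
    and F: "subfield F R" "K \<subseteq> F" "F \<subseteq> M"
    and \<phi>: "\<phi> \<in> ring_hom (R\<lparr>carrier := F\<rparr>) (R\<lparr>carrier := M\<rparr>)" "\<And>k. k \<in> K \<Longrightarrow> \<phi> k = k"
  shows "\<exists>\<tau> \<in> carrier (galois_group R M K). \<forall>a\<in>F. \<tau> a = \<phi> a"
proof -
  have alg: "(algebraic over K) z" if "z \<in> M" for z using nrm that by (auto simp: normal_extension_def over_def)
  obtain us where us: "set us \<subseteq> carrier R" "Span K us = M"
    using finite_dimensionE'[OF fd] exists_base[OF K] by metis
  then have usM: "set us \<subseteq> M" using Span_base_incl[OF K us(1)] by simp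
  have "\<exists>p\<in>carrier (K[X]). p \<noteq> [] \<and> ring.splitted (R\<lparr>carrier := M\<rparr>) p \<and> eval p u = \<zero>" if u: "u \<in> set us" for u
  proof -
    have u': "u \<in> M" "u \<in> carrier R" using u us usM by auto
    note Irr = IrrE[OF K u'(2) alg[OF u'(1)]]
    then have "ring.splitted (R\<lparr>carrier := M\<rparr>) (Irr K u)" using nrm u' by (auto simp: normal_extension_def)
    moreover have "Irr K u \<noteq> []" using pirreducibleE(1)[OF subfieldE(1)[OF K] Irr(1,2)] .
    ultimately show ?thesis using Irr by blast
  qed
  from extend_hom_by_split_elements[OF K M usM this F \<phi>]
  obtain F' \<tau> where F': "subfield F' R" "F \<subseteq> F'" "F' \<subseteq> M" "set us \<subseteq> F'"
    and \<tau>: "\<tau> \<in> ring_hom (R\<lparr>carrier := F'\<rparr>) (R\<lparr>carrier := M\<rparr>)" "\<forall>a\<in>F. \<tau> a = \<phi> a" by auto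
  have "k \<otimes> u \<in> F'" if "k \<in> K" "u \<in> set us" for k u
    using that F' F(2) by (intro subringE(6)[OF subfieldE(1)[OF F'(1)]]) auto
  then have "Span K us \<subseteq> F'"
    by (intro Span_min[OF K us(1) subring.axioms(1)[OF subfieldE(1)[OF F'(1)]]]) (auto simp: set_mult_def)
  then have "F' = M" using F' us by auto
  moreover have "\<tau> k = k" if "k \<in> K" for k using \<tau>(2) \<phi>(2) F(2) that by auto
  ultimately have "restrict \<tau> M \<in> carrier (galois_group R M K)"
    using algebraic_endomorphism_in_galois_group[OF K M \<open>K \<subseteq> M\<close> alg] \<tau>(1) by blast
  then show ?thesis using \<tau>(2) F(3) by (intro bexI[of _ "restrict \<tau> M"]) auto
qed

end

section \<open>Fixed field of a finite normal extension\<close>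

lemma (in domain) coeff_linear_mult:
  assumes a: "a \<in> carrier R" and r: "r \<in> carrier (poly_ring R)"
  shows "coeff ([\<one>, \<ominus> a] \<otimes>\<^bsub>poly_ring R\<^esub> r) (Suc i) = coeff r i \<oplus> \<ominus> a \<otimes> coeff r (Suc i)"
proof -
  have set: "set [\<one>, \<ominus> a] \<subseteq> carrier R" "set r \<subseteq> carrier R"
    using a r by (auto simp flip: univ_poly_carrier dest: polynomial_incl)
  have c: "coeff r j \<in> carrier R" for j using set by simp
  let ?h = "\<lambda>k. coeff [\<one>, \<ominus> a] k \<otimes> coeff r (Suc i - k)"
  have "coeff ([\<one>, \<ominus> a] \<otimes>\<^bsub>poly_ring R\<^esub> r) (Suc i) = (\<Oplus>k\<in>{..Suc i}. ?h k)"
    by (simp only: univ_poly_mult poly_mult_coeff[OF set])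
  also have "\<dots> = (\<Oplus>k\<in>{0, 1}. ?h k)"
    by (rule add.finprod_mono_neutral_cong_left[symmetric]) (use a c in auto)
  also have "\<dots> = \<ominus> a \<otimes> coeff r (Suc i) \<oplus> coeff r i"
    using a c by (simp add: finsum_insert)
  finally show ?thesis using a c by (simp add: a_comm)
qed

text \<open>Takes one linear factor off a power of X - x. The cofactor is again monic and split with
  no root but x, so the step can be repeated.\<close>

lemma (in field) single_root_factor:
  assumes x: "x \<in> carrier R" and p: "p \<in> carrier (poly_ring R)" "lead_coeff p = \<one>" "splitted p"
    "\<And>y. is_root p y \<Longrightarrow> y = x" "degree p = Suc n"
  obtains r where "r \<in> carrier (poly_ring R)" "p = [\<one>, \<ominus> x] \<otimes>\<^bsub>poly_ring R\<^esub> r" "lead_coeff r = \<one>"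
    "splitted r" "\<And>y. is_root r y \<Longrightarrow> y = x" "degree r = n" "r \<noteq> []"
proof -
  interpret P: domain "poly_ring R" by (rule univ_poly_is_domain[OF carrier_is_subring])
  have lin: "[\<one>, \<ominus> x] \<in> carrier (poly_ring R)" using x by (auto simp: polynomial_def simp flip: univ_poly_carrier)
  have pne: "p \<noteq> []" using p(5) by auto
  have "roots p \<noteq> {#}" using p(3,5) by (auto simp: splitted_def)
  then obtain y where "y \<in># roots p" by blast
  then have "is_root p x" using p(4) roots_mem_iff_is_root[OF p(1)] by metis
  then have "[\<one>, \<ominus> x] pdivides p" by (rule is_root_imp_pdivides[OF p(1)])
  then obtain r where r: "r \<in> carrier (poly_ring R)" "p = [\<one>, \<ominus> x] \<otimes>\<^bsub>poly_ring R\<^esub> r"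
    by (auto simp: pdivides_def factor_def)
  have rne: "r \<noteq> []" using r pne P.r_null[OF lin] by (auto simp: univ_poly_zero)
  have pol: "polynomial (carrier R) [\<one>, \<ominus> x]" "polynomial (carrier R) r"
    using lin r(1) by (simp_all add: univ_poly_carrier)
  have rp: "r pdivides p"
    using r lin P.m_comm by (auto simp: pdivides_def factor_def)
  have "splitted r" by (rule pdivides_imp_splitted[OF r(1) p(1) pne p(3) rp])
  moreover have "y = x" if "is_root r y" for y
    using pdivides_imp_root_sharing[OF r(1) rp] that p(4) pne by (auto simp: is_root_def)
  moreover have "lead_coeff p = \<one> \<otimes> lead_coeff r"
    using poly_mult_lead_coeff[OF carrier_is_subring pol] rne r(2) by (simp add: univ_poly_mult)
  moreover have "lead_coeff r \<in> carrier R" using pol(2) rne by (cases r) (auto simp: polynomial_def)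
  moreover have "degree p = Suc (degree r)"
    using poly_mult_degree_eq[OF carrier_is_subring pol] rne r(2) by (simp add: univ_poly_mult)
  ultimately show ?thesis using that[OF r] rne p(2,5) by auto
qed

text \<open>Such a polynomial is (X - x)^(n+1), whose second coefficient is an integer multiple of
  x. In characteristic zero x can therefore be read off from one coefficient.\<close>

lemma (in field) single_root_coeff:
  assumes x: "x \<in> carrier R" and "p \<in> carrier (poly_ring R)" "lead_coeff p = \<one>" "splitted p"
    "\<And>y. is_root p y \<Longrightarrow> y = x" "degree p = Suc n"
  shows "coeff p n = \<ominus> ([Suc n] \<cdot> x)"
  using assms(2-)
proof (induction n arbitrary: p)
  case 0
  interpret P: domain "poly_ring R" by (rule univ_poly_is_domain[OF carrier_is_subring])
  have lin: "[\<one>, \<ominus> x] \<in> carrier (poly_ring R)" using x by (auto simp: polynomial_def simp flip: univ_poly_carrier)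
  from single_root_factor[OF x 0] obtain r where r: "r \<in> carrier (poly_ring R)" "p = [\<one>, \<ominus> x] \<otimes>\<^bsub>poly_ring R\<^esub> r"
     "lead_coeff r = \<one>" "degree r = 0" "r \<noteq> []" by metis
  then have "r = \<one>\<^bsub>poly_ring R\<^esub>" by (cases r) (auto simp: univ_poly_one)
  then have "p = [\<one>, \<ominus> x]" using r(2) P.r_one[OF lin] by simp
  then show ?case using x by simp
next
  case (Suc n)
  from single_root_factor[OF x Suc.prems] obtain r where r: "r \<in> carrier (poly_ring R)" "p = [\<one>, \<ominus> x] \<otimes>\<^bsub>poly_ring R\<^esub> r"
     "lead_coeff r = \<one>" "splitted r" "\<And>y. is_root r y \<Longrightarrow> y = x" "degree r = Suc n" "r \<noteq> []" by metis
  have "coeff r (Suc n) = \<one>" using lead_coeff_simp[OF r(7)] r(3,6) by simp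
  then have "coeff p (Suc n) = \<ominus> ([Suc n] \<cdot> x) \<oplus> \<ominus> x"
    using coeff_linear_mult[OF x r(1), of n] Suc.IH[OF r(1,3,4,5,6)] r(2) x by simp
  also have "\<dots> = \<ominus> ([Suc (Suc n)] \<cdot> x)" using x by (simp add: minus_add)
  finally show ?case .
qed

text \<open>Every root in M of the minimal polynomial of x is the image of x under an element of the
  Galois group, hence equals x, so the polynomial is a power of X - x. Its second coefficient lies
  in K and is minus the degree times x; the degree is invertible in K.\<close>

lemma (in field) normal_extension_fixed_field:
  assumes char: "\<And>n :: nat. 0 < n \<Longrightarrow> [n] \<cdot> \<one> \<noteq> \<zero>"
    and K: "subfield K R" and M: "subfield M R" and "K \<subseteq> M" and fd: "finite_dimension K M" and nrm: "normal_extension R K M"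
    and x: "x \<in> M" and fixed: "\<And>\<tau>. \<tau> \<in> carrier (galois_group R M K) \<Longrightarrow> \<tau> x = x"
  shows "x \<in> K"
proof -
  let ?S = "R\<lparr>carrier := M\<rparr>"
  interpret S: field ?S using M by (rule subfield_iff(2))
  note [simp] = univ_poly_consistent[OF subfieldE(1)[OF M]] eval_consistent[OF subfieldE(1)[OF M]]
    coeff_consistent[OF subfieldE(1)[OF M]]
  have xR: "x \<in> carrier R" using x subfieldE(3)[OF M] by auto
  have alg: "(algebraic over K) x" using nrm x by (auto simp: normal_extension_def over_def)
  define p where "p = Irr K x"
  note Irr = IrrE[OF K xR alg, folded p_def]
  have split: "S.splitted p" using nrm x Irr by (auto simp: normal_extension_def)
  have pM: "p \<in> carrier (M[X])"
    using poly_set_incl[OF Irr(1)] Irr(1) \<open>K \<subseteq> M\<close> by (auto simp: polynomial_def simp flip: univ_poly_carrier)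
  have only: "y = x" if y: "S.is_root p y" for y
  proof -
    have y': "y \<in> M" "eval p y = \<zero>" using y by (auto simp: S.is_root_def)
    have id: "id \<in> ring_hom (R\<lparr>carrier := K\<rparr>) ?S" using \<open>K \<subseteq> M\<close> by (auto simp: ring_hom_def)
    have "eval (map id (Irr K x)) y = \<zero>" using y'(2) by (simp add: p_def)
    from extend_hom_to_simple_extension[OF K M id xR alg y'(1) this]
    obtain \<phi> where \<phi>: "\<phi> \<in> ring_hom (R\<lparr>carrier := simple_extension K x\<rparr>) ?S" "\<forall>a\<in>K. \<phi> a = a" "\<phi> x = y"
      by auto
    have F: "subfield (simple_extension K x) R" using simple_extension_is_subfield[OF K xR] alg by simp
    have incl: "K \<subseteq> simple_extension K x" "x \<in> simple_extension K x" "simple_extension K x \<subseteq> M"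
      using simple_extension_incl[OF subfieldE(3)[OF K] xR] simple_extension_mem[OF subfieldE(1)[OF K] xR]
        simple_extension_subring_incl[OF subfieldE(1)[OF M] \<open>K \<subseteq> M\<close> x] by auto
    obtain \<tau> where "\<tau> \<in> carrier (galois_group R M K)" "\<forall>a\<in>simple_extension K x. \<tau> a = \<phi> a"
      using normal_extension_hom_extends[OF K M \<open>K \<subseteq> M\<close> fd nrm F incl(1,3) \<phi>(1)] \<phi>(2) by blast
    then show ?thesis using fixed incl(2) \<phi>(3) by metis
  qed
  have "1 \<le> degree p" using pirreducible_degree[OF K Irr(1,2)] .
  then obtain n where n: "degree p = Suc n" by (cases "degree p") auto
  \<comment> \<open>\<open>single_root_coeff\<close> is applied in the ring with carrier M; its
    multiples and negatives are translated back to R.\<close>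
  have pow: "[k] \<cdot>\<^bsub>?S\<^esub> x = [k] \<cdot> x" for k :: nat
    by (induction k) (simp_all add: add_pow_def nat_pow_def)
  have inv: "\<ominus>\<^bsub>?S\<^esub> z = \<ominus> z" if "z \<in> M" for z
    using S.minus_equality[of "\<ominus> z" z] that subfieldE(3)[OF M] subringE(5)[OF subfieldE(1)[OF M], of z] by (auto simp: l_neg)
  have kx: "[k] \<cdot> x \<in> M" for k :: nat using x subfieldE(1)[OF M] by (intro add_pow_in_subring)
  have "coeff p n = \<ominus> ([Suc n] \<cdot> x)"
    using S.single_root_coeff[OF _ _ _ split only n] x pM Irr(3) pow inv[OF kx[of "Suc n"]] by simp
  moreover have "coeff p n \<in> K"
    using rangeI[of "coeff p" n, unfolded coeff_img(3)] poly_set_incl[OF Irr(1)] subringE(2)[OF subfieldE(1)[OF K]] by auto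
  ultimately have "\<ominus> ([Suc n] \<cdot> x) \<in> K" by simp
  then have "[Suc n] \<cdot> x \<in> K"
    using subringE(5)[OF subfieldE(1)[OF K]] xR minus_minus add.nat_pow_closed by metis
  moreover have "[Suc n] \<cdot> x = [Suc n] \<cdot> \<one> \<otimes> x" using xR by (simp add: add_pow_ldistr del: add.nat_pow_Suc)
  moreover have "[Suc n] \<cdot> \<one> \<in> K - {\<zero>}"
    using char[of "Suc n"] add_pow_in_subring[OF subfieldE(1)[OF K] subringE(3)[OF subfieldE(1)[OF K]], of "Suc n"]
    by (simp del: add.nat_pow_Suc)
  ultimately show ?thesis using subfield_m_inv_simprule[OF K _ xR] by metis
qed

section \<open>The Galois group: finiteness and restriction to a normal subextension\<close>

lemma (in field) galois_group_is_group:
  assumes K: "subfield K R" and M: "subfield M R" and "K \<subseteq> M"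
  shows "group (galois_group R M K)"
proof -
  let ?S = "R\<lparr>carrier := M\<rparr>"
  interpret S: field ?S using M by (rule subfield_iff(2))
  interpret B: group "BijGroup M" by (rule group_BijGroup)
  let ?H = "{\<sigma>' \<in> Bij M. \<sigma>' \<in> ring_hom ?S ?S \<and> (\<forall>x \<in> K. \<sigma>' x = x)}"
  have mem: "g x \<in> M" if "g \<in> Bij M" "x \<in> M" for g x using Bij_imp_funcset[OF that(1)] that(2) by auto
  have "subgroup ?H (BijGroup M)"
  proof (rule B.subgroupI)
    show "?H \<subseteq> carrier (BijGroup M)" by (auto simp: BijGroup_def)
    have "(\<lambda>x\<in>M. x) \<in> ?H"
      using \<open>K \<subseteq> M\<close> id_Bij S.m_closed S.a_closed S.one_closed by (auto simp: ring_hom_def)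
    then show "?H \<noteq> {}" by blast
    fix g assume g: "g \<in> ?H"
    let ?i = "\<lambda>x\<in>M. inv_into M g x"
    have bij: "bij_betw g M M" using g by (auto simp: Bij_def)
    have inv: "inv\<^bsub>BijGroup M\<^esub> g = ?i" using g by (simp add: inv_BijGroup)
    have gi: "g (inv_into M g x) = x" "inv_into M g x \<in> M" if "x \<in> M" for x
      using bij that by (auto simp: bij_betw_def f_inv_into_f inv_into_into)
    have uniq: "inv_into M g x = z" if "z \<in> M" "g z = x" for x z
      using bij that by (auto simp: bij_betw_def)
    have "inv_into M g (x \<otimes> y) = inv_into M g x \<otimes> inv_into M g y" "inv_into M g (x \<oplus> y) = inv_into M g x \<oplus> inv_into M g y"
      if "x \<in> M" "y \<in> M" for x y
      using that g gi S.m_closed S.a_closed by (auto simp: ring_hom_def intro!: uniq)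
    moreover have "inv_into M g \<one> = \<one>" using g S.one_closed by (auto simp: ring_hom_def intro!: uniq)
    moreover have "inv_into M g k = k" if "k \<in> K" for k using g that \<open>K \<subseteq> M\<close> by (auto intro!: uniq)
    ultimately show "inv\<^bsub>BijGroup M\<^esub> g \<in> ?H"
      unfolding inv using g gi restrict_inv_into_Bij[of g M] S.m_closed S.a_closed S.one_closed \<open>K \<subseteq> M\<close>
      by (auto simp: ring_hom_def)
    fix h assume h: "h \<in> ?H"
    then show "g \<otimes>\<^bsub>BijGroup M\<^esub> h \<in> ?H"
      using g mem \<open>K \<subseteq> M\<close> S.m_closed S.a_closed S.one_closed
      by (auto simp: BijGroup_def compose_Bij ring_hom_def compose_eq subset_iff)
  qed
  then show ?thesis unfolding galois_group_def by (rule subgroup.subgroup_is_group) (rule group_BijGroup)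
qed

lemma galois_groupD:
  assumes "\<gamma> \<in> carrier (galois_group R M K)"
  shows "\<gamma> \<in> ring_hom (R\<lparr>carrier := M\<rparr>) (R\<lparr>carrier := M\<rparr>)" "k \<in> K \<Longrightarrow> \<gamma> k = k" "\<gamma> \<in> Bij M"
    "x \<in> M \<Longrightarrow> \<gamma> x \<in> M" "\<gamma> \<in> extensional M"
  using assms Bij_imp_funcset[of \<gamma> M] by (auto simp: galois_group_def Bij_def)

lemma galois_group_mult:
  assumes "\<gamma> \<in> carrier (galois_group R M K)" "\<delta> \<in> carrier (galois_group R M K)"
  shows "\<gamma> \<otimes>\<^bsub>galois_group R M K\<^esub> \<delta> = compose M \<gamma> \<delta>"
  using assms by (auto simp: galois_group_def BijGroup_def)

lemma galois_group_one: "\<one>\<^bsub>galois_group R M K\<^esub> = (\<lambda>x\<in>M. x)"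
  by (simp add: galois_group_def BijGroup_def)

text \<open>An automorphism over K is determined by its values on a finite spanning list, and each
  value is one of finitely many roots of a polynomial over K.\<close>

lemma (in field) finite_galois_group:
  assumes K: "subfield K R" and M: "subfield M R" and "K \<subseteq> M" and fd: "finite_dimension K M"
  shows "finite (carrier (galois_group R M K))"
proof -
  let ?S = "R\<lparr>carrier := M\<rparr>" and ?G = "carrier (galois_group R M K)"
  interpret S: field ?S using M by (rule subfield_iff(2))
  obtain us where us: "set us \<subseteq> carrier R" "Span K us = M"
    using finite_dimensionE'[OF fd] exists_base[OF K] by metis
  then have usM: "set us \<subseteq> M" using Span_base_incl[OF K us(1)] by simp
  have alg: "(algebraic over K) z" if "z \<in> M" for z
    using finite_dimension_imp_algebraic[OF K subfieldE(1)[OF M] fd that] .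
  have "\<exists>Z. finite Z \<and> (\<forall>\<gamma>\<in>?G. \<gamma> u \<in> Z)" if u: "u \<in> M" for u
  proof -
    obtain p where p: "p \<in> carrier (K[X])" "p \<noteq> []" "eval p u = \<zero>"
      using algebraicE[OF subfieldE(1)[OF K] _ alg[OF u]] u subfieldE(3)[OF M] by auto
    have "p \<in> carrier (poly_ring R)" using carrier_polynomial_shell[OF subfieldE(1)[OF K] p(1)] .
    then have "finite {w. is_root p w}" by (rule finite_number_of_roots)
    moreover have "is_root p (\<gamma> u)" if g: "\<gamma> \<in> ?G" for \<gamma>
    proof -
      have "map \<gamma> p = p" using poly_set_incl[OF p(1)] galois_groupD(2)[OF g] by (intro map_idI) auto
      then have "eval p (\<gamma> u) = \<gamma> (eval p u)"
        using subfield_hom_eval[OF M M galois_groupD(1)[OF g] _ u, of p] poly_set_incl[OF p(1)] assms(3) by auto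
      also have "\<dots> = \<zero>" using p(3) ring_hom_zero[OF galois_groupD(1)[OF g] S.is_ring S.is_ring] by simp
      finally show ?thesis using p(2) galois_groupD(4)[OF g u] subfieldE(3)[OF M] by (auto simp: is_root_def)
    qed
    ultimately show ?thesis by blast
  qed
  then obtain Z where Z: "\<And>u. u \<in> M \<Longrightarrow> finite (Z u)" "\<And>u \<gamma>. u \<in> M \<Longrightarrow> \<gamma> \<in> ?G \<Longrightarrow> \<gamma> u \<in> Z u" by metis
  have "(\<lambda>\<gamma>. restrict \<gamma> (set us)) ` ?G \<subseteq> (\<Pi>\<^sub>E u\<in>set us. Z u)" using Z(2) usM by auto
  moreover have "finite (\<Pi>\<^sub>E u\<in>set us. Z u)" using Z(1) usM by (intro finite_PiE) auto
  ultimately have "finite ((\<lambda>\<gamma>. restrict \<gamma> (set us)) ` ?G)" by (rule finite_subset)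
  moreover have "inj_on (\<lambda>\<gamma>. restrict \<gamma> (set us)) ?G"
  proof (rule inj_onI)
    fix \<gamma> \<delta> assume g: "\<gamma> \<in> ?G" and d: "\<delta> \<in> ?G" and eq: "restrict \<gamma> (set us) = restrict \<delta> (set us)"
    have eq': "\<gamma> u = \<delta> u" if "u \<in> set us" for u using fun_cong[OF eq, of u] that by simp
    have comb: "combine Ks vs \<in> M \<and> \<gamma> (combine Ks vs) = \<delta> (combine Ks vs)"
      if "set Ks \<subseteq> K" "set vs \<subseteq> set us" for Ks vs
      using that
    proof (induction Ks vs rule: combine.induct)
      case (1 k Ks v vs)
      then have kv: "k \<in> M" "v \<in> M" "k \<otimes> v \<in> M" "combine Ks vs \<in> M" "\<gamma> (combine Ks vs) = \<delta> (combine Ks vs)"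
        using usM assms(3) subringE(6)[OF subfieldE(1)[OF M]] by auto
      have "\<gamma> (k \<otimes> v \<oplus> combine Ks vs) = \<gamma> k \<otimes> \<gamma> v \<oplus> \<gamma> (combine Ks vs)"
        using ring_hom_add[OF galois_groupD(1)[OF g]] ring_hom_mult[OF galois_groupD(1)[OF g]] kv by simp
      also have "\<dots> = \<delta> k \<otimes> \<delta> v \<oplus> \<delta> (combine Ks vs)"
        using 1 kv eq' galois_groupD(2)[OF g] galois_groupD(2)[OF d] by auto
      also have "\<dots> = \<delta> (k \<otimes> v \<oplus> combine Ks vs)"
        using ring_hom_add[OF galois_groupD(1)[OF d]] ring_hom_mult[OF galois_groupD(1)[OF d]] kv by simp
      finally show ?case using kv subringE(7)[OF subfieldE(1)[OF M]] by simp
    qed (use subringE(2)[OF subfieldE(1)[OF M]] ring_hom_zero[OF galois_groupD(1)[OF g] S.is_ring S.is_ring]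
       ring_hom_zero[OF galois_groupD(1)[OF d] S.is_ring S.is_ring] in auto)
    show "\<gamma> = \<delta>"
    proof (rule extensionalityI[OF galois_groupD(5)[OF g] galois_groupD(5)[OF d]])
      fix z assume "z \<in> M"
      then obtain Ks where "set Ks \<subseteq> K" "z = combine Ks us"
        using us(2) Span_eq_combine_set[OF K us(1)] by auto
      then show "\<gamma> z = \<delta> z" using comb by blast
    qed
  qed
  ultimately show ?thesis by (rule finite_imageD)
qed

text \<open>\<gamma>(x) is a root of the minimal polynomial of x over K, which splits over E. So the
  minimal polynomial of \<gamma>(x) over E is an irreducible factor of a split polynomial, hence
  linear, and its constant term is minus \<gamma>(x).\<close>

lemma (in field) normal_extension_stable:
  assumes K: "subfield K R" and E: "subfield E R" and M: "subfield M R" and "K \<subseteq> E" "E \<subseteq> M" and nrm: "normal_extension R K E"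
    and g: "\<gamma> \<in> carrier (galois_group R M K)" and x: "x \<in> E"
  shows "\<gamma> x \<in> E"
proof -
  let ?S = "R\<lparr>carrier := E\<rparr>"
  interpret S: field ?S using E by (rule subfield_iff(2))
  interpret M: field "R\<lparr>carrier := M\<rparr>" using M by (rule subfield_iff(2))
  note [simp] = univ_poly_consistent[OF subfieldE(1)[OF E]] eval_consistent[OF subfieldE(1)[OF E]]
  have xM: "x \<in> M" and xR: "x \<in> carrier R" using x \<open>E \<subseteq> M\<close> subfieldE(3)[OF E] by auto
  have alg: "(algebraic over K) x" using nrm x by (auto simp: normal_extension_def over_def)
  define p where "p = Irr K x"
  note Irr = IrrE[OF K xR alg, folded p_def]
  have pne: "p \<noteq> []" using pirreducibleE(1)[OF subfieldE(1)[OF K] Irr(1,2)] .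
  have split: "S.splitted p" using nrm x Irr by (auto simp: normal_extension_def)
  have pE: "p \<in> carrier (E[X])"
    using poly_set_incl[OF Irr(1)] Irr(1) \<open>K \<subseteq> E\<close> by (auto simp: polynomial_def simp flip: univ_poly_carrier)
  have "map \<gamma> p = p" using poly_set_incl[OF Irr(1)] galois_groupD(2)[OF g] by (intro map_idI) auto
  then have "eval p (\<gamma> x) = \<gamma> (eval p x)"
    using subfield_hom_eval[OF M M galois_groupD(1)[OF g] _ xM, of p] poly_set_incl[OF Irr(1)] assms(4,5) by auto
  also have "\<dots> = \<zero>" using Irr(4) ring_hom_zero[OF galois_groupD(1)[OF g] M.is_ring M.is_ring] by simp
  finally have root: "eval p (\<gamma> x) = \<zero>" .
  have yR: "\<gamma> x \<in> carrier R" using galois_groupD(4)[OF g xM] subfieldE(3)[OF M] by auto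
  have alg': "(algebraic over E) (\<gamma> x)" using pE pne root by (intro algebraicI)
  note Irr' = IrrE[OF E yR alg']
  have "Irr E (\<gamma> x) divides\<^bsub>E[X]\<^esub> p"
    using Irr_minimal[OF E yR alg' pE root] pdivides_iff_shell[OF E Irr'(1) pE] by simp
  then have "degree (Irr E (\<gamma> x)) = 1"
    using S.splitted_imp_trivial_factors[of p "Irr E (\<gamma> x)"] split pE pne Irr'(1,2) by (simp add: pdivides_def)
  then obtain a b where ab: "a \<in> E" "b \<in> E" "Irr E (\<gamma> x) = [a, b]" using degree_oneE[OF Irr'(1)] by metis
  then have "\<gamma> x \<oplus> b = \<zero>" using Irr'(3,4) yR subfieldE(3)[OF E] by auto
  then have "\<gamma> x = \<ominus> b" using minus_equality[of "\<gamma> x" b] yR ab subfieldE(3)[OF E] by auto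
  then show ?thesis using subringE(5)[OF subfieldE(1)[OF E] ab(2)] by simp
qed

lemma (in field) galois_restrict_mem:
  assumes K: "subfield K R" and E: "subfield E R" and M: "subfield M R" and "K \<subseteq> E" "E \<subseteq> M" and nrm: "normal_extension R K E"
    and g: "\<gamma> \<in> carrier (galois_group R M K)"
  shows "restrict \<gamma> E \<in> carrier (galois_group R E K)"
proof (rule algebraic_endomorphism_in_galois_group[OF K E \<open>K \<subseteq> E\<close>])
  show "(algebraic over K) z" if "z \<in> E" for z using nrm that by (auto simp: normal_extension_def over_def)
  show "\<gamma> \<in> ring_hom (R\<lparr>carrier := E\<rparr>) (R\<lparr>carrier := E\<rparr>)"
    using galois_groupD(1)[OF g] normal_extension_stable[OF assms] \<open>E \<subseteq> M\<close> by (auto simp: ring_hom_def subset_iff)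
  show "\<gamma> k = k" if "k \<in> K" for k using galois_groupD(2)[OF g that] .
qed

section \<open>Adjoining a root of unity\<close>

lemma size_eq_card_of_subset_mset_set:
  assumes "A \<subseteq># mset_set S" shows "card (set_mset A) = size A"
proof -
  have "count A a \<le> 1" for a
    using mset_subset_eq_count[OF assms, of a] by (cases "finite S") (auto simp: count_mset_set' split: if_splits)
  moreover have "0 < count A a" if "a \<in># A" for a using that by simp
  ultimately have "count A a = (if a \<in># A then 1 else 0)" for a by (auto simp: not_in_iff intro: le_antisym)
  then have "A = mset_set (set_mset A)" by (intro multiset_eqI) (simp add: count_mset_set')
  then show ?thesis by (metis size_mset_set)
qed

text \<open>The first n powers of z are distinct by primitivity and already account for the full
  degree of X^n - 1, so the polynomial splits with simple roots.\<close>

lemma (in field) unity_poly_roots: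
  assumes n: "0 < n" and z: "primitive_root_of_unity R n z"
  shows "splitted (unity_poly n)" and "roots (unity_poly n) = mset_set (set_mset (roots (unity_poly n)))"
proof -
  let ?P = "unity_poly n"
  have P: "?P \<in> carrier (poly_ring R)" by (rule unity_poly_closed[OF carrier_is_subring])
  have zc: "z \<in> carrier R" "z [^] n = \<one>" and prim: "\<And>k. 0 < k \<Longrightarrow> k < n \<Longrightarrow> z [^] k \<noteq> \<one>"
    using z by (auto simp: primitive_root_of_unity_def)
  have "inj_on (\<lambda>i::nat. z [^] i) {..<n}"
  proof -
    have "False" if "i < j" "j < n" "z [^] i = z [^] j" for i j :: nat
    proof -
      have "z [^] i \<otimes> z [^] (j - i) = z [^] j" "z [^] i \<otimes> z [^] (n - i) = z [^] n"
        using nat_pow_mult[OF zc(1), of i "j - i"] nat_pow_mult[OF zc(1), of i "n - i"] that by auto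
      then have "z [^] i \<otimes> z [^] (j - i) = z [^] i \<otimes> \<one>" "z [^] i \<noteq> \<zero>" using that(3) zc by auto
      then have "z [^] (j - i) = \<one>" using zc by (subst (asm) m_lcancel) auto
      then show False using prim[of "j - i"] that by simp
    qed
    then show ?thesis by (intro inj_onI) (metis lessThan_iff nat_neq_iff)
  qed
  then have "card ((\<lambda>i. z [^] i) ` {..<n}) = n" by (simp add: card_image)
  moreover have "(\<lambda>i. z [^] i) ` {..<n} \<subseteq> set_mset (roots ?P)"
  proof
    fix y assume "y \<in> (\<lambda>i. z [^] i) ` {..<n}"
    then obtain i :: nat where y: "y = z [^] i" by auto
    have "y [^] n = \<one>" using zc by (simp add: y nat_pow_pow mult.commute[of i]) (simp flip: nat_pow_pow)
    then have "is_root ?P y" using eval_unity_poly[OF n, of y] zc by (simp add: is_root_def y) (simp add: unity_poly_def)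
    then show "y \<in> set_mset (roots ?P)" using roots_mem_iff_is_root[OF P] by simp
  qed
  ultimately have "n \<le> card (set_mset (roots ?P))" using card_mono[OF finite_set_mset] by metis
  moreover have sub: "mset_set (set_mset (roots ?P)) \<subseteq># roots ?P" by (rule mset_set_set_mset_msubset)
  moreover have "size (roots ?P) \<le> n" using size_roots_le_degree[OF P] degree_unity_poly[OF n] by simp
  ultimately have size: "size (roots ?P) = n" "size (mset_set (set_mset (roots ?P))) = n"
    using size_mset_mono[OF sub] by auto
  show "splitted ?P" using size degree_unity_poly[OF n] by (simp add: splitted_def)
  show "roots ?P = mset_set (set_mset (roots ?P))"
    using size mset_subset_size[of "mset_set (set_mset (roots ?P))" "roots ?P"] sub
    by (auto simp: subset_mset.le_less)
qed

locale cyclotomic_extension = field R for R (structure) +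
  fixes K E :: "'a set" and \<zeta> :: 'a and n :: nat
  assumes char: "\<And>n :: nat. 0 < n \<Longrightarrow> [n] \<cdot> \<one> \<noteq> \<zero>"
    and K: "subfield K R" and E: "subfield E R" and KE: "K \<subseteq> E"
    and fd: "finite_dimension K E" and nrm: "normal_extension R K E"
    and n: "0 < n" and prim: "primitive_root_of_unity R n \<zeta>"
begin

definition M where "M = generate_field R (E \<union> {\<zeta>})"
abbreviation G where "G \<equiv> galois_group R E K"
abbreviation \<Gamma> where "\<Gamma> \<equiv> galois_group R M K"

lemma \<zeta>_carrier: "\<zeta> \<in> carrier R" using prim by (simp add: primitive_root_of_unity_def)

lemma \<zeta>_root: "eval (unity_poly n) \<zeta> = \<zero>"
  using eval_unity_poly[OF n \<zeta>_carrier] prim by (simp add: primitive_root_of_unity_def)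

lemma \<zeta>_algebraic: "subfield F R \<Longrightarrow> (algebraic over F) \<zeta>"
  using unity_poly_closed[OF subfieldE(1)] \<zeta>_root by (intro algebraicI[of "unity_poly n"]) (auto simp: unity_poly_def)

text \<open>As a simple extension, M consists of polynomials in \<zeta> over E and falls under the
  extension lemmas above.\<close>

lemma M_eq: "M = simple_extension E \<zeta>"
proof
  have sub: "E \<union> {\<zeta>} \<subseteq> carrier R" using subfieldE(3)[OF E] \<zeta>_carrier by auto
  have "subfield (simple_extension E \<zeta>) R"
    using simple_extension_is_subfield[OF E \<zeta>_carrier] \<zeta>_algebraic[OF E] by simp
  moreover have "E \<union> {\<zeta>} \<subseteq> simple_extension E \<zeta>"
    using simple_extension_incl[OF subfieldE(3)[OF E] \<zeta>_carrier] simple_extension_mem[OF subfieldE(1)[OF E] \<zeta>_carrier] by auto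
  ultimately show "M \<subseteq> simple_extension E \<zeta>" unfolding M_def by (rule generate_field_min_subfield1[OF sub])
  show "simple_extension E \<zeta> \<subseteq> M"
    unfolding M_def by (rule simple_extension_subring_incl[OF subfieldE(1)[OF generate_field_is_subfield[OF sub]]])
       (auto intro: generate_field.incl)
qed

lemma M: "subfield M R" and EM: "E \<subseteq> M" and \<zeta>M: "\<zeta> \<in> M" and KM: "K \<subseteq> M"
  using subfieldE(3)[OF E] \<zeta>_carrier KE unfolding M_def
  by (auto intro!: generate_field_is_subfield generate_field.incl)

lemma fdM: "finite_dimension K M"
  using telescopic_base_dim(1)[OF K E fd] finite_dimension_simple_extension[OF E \<zeta>_carrier] \<zeta>_algebraic[OF E] M_eq by simp

lemma algM: "z \<in> M \<Longrightarrow> (algebraic over K) z"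
  using finite_dimension_imp_algebraic[OF K subfieldE(1)[OF M] fdM] .

lemma field_M: "field (R\<lparr>carrier := M\<rparr>)" using M by (rule subfield_iff(2))

lemma M_consistent:
  "univ_poly (R\<lparr>carrier := M\<rparr>) = univ_poly R" "ring.eval (R\<lparr>carrier := M\<rparr>) = eval"
  "ring.unity_poly (R\<lparr>carrier := M\<rparr>) = unity_poly" "primitive_root_of_unity (R\<lparr>carrier := M\<rparr>) n \<zeta>"
proof -
  interpret M: field "R\<lparr>carrier := M\<rparr>" by (rule field_M)
  show "univ_poly (R\<lparr>carrier := M\<rparr>) = univ_poly R" "M.eval = eval"
    using univ_poly_consistent eval_consistent subfieldE(1)[OF M] by auto
  have "\<one> \<in> M" "\<ominus> \<one> \<in> M" using subringE(3,5)[OF subfieldE(1)[OF M]] by auto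
  then have "\<ominus>\<^bsub>R\<lparr>carrier := M\<rparr>\<^esub> \<one> = \<ominus> \<one>"
    using M.minus_equality[of "\<ominus> \<one>" \<one>] by (simp add: l_neg)
  then show "M.unity_poly = unity_poly" by (simp add: fun_eq_iff M.unity_poly_def unity_poly_def)
  show "primitive_root_of_unity (R\<lparr>carrier := M\<rparr>) n \<zeta>"
    using prim \<zeta>M by (simp add: primitive_root_of_unity_def nat_pow_consistent[symmetric])
qed

text \<open>X^n - 1 has coefficients in K, vanishes at \<zeta> and splits in M, so an automorphism
  of E over K extends to an endomorphism of M over K, which is an automorphism.\<close>

lemma restriction_surj:
  assumes g: "\<sigma>' \<in> carrier G"
  shows "\<exists>\<gamma> \<in> carrier \<Gamma>. restrict \<gamma> E = \<sigma>'"
proof -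
  interpret M: field "R\<lparr>carrier := M\<rparr>" by (rule field_M)
  have hom: "\<sigma>' \<in> ring_hom (R\<lparr>carrier := E\<rparr>) (R\<lparr>carrier := M\<rparr>)"
    using galois_groupD(1)[OF g] EM by (auto simp: ring_hom_def)
  have split: "M.splitted (unity_poly n)" using M.unity_poly_roots(1)[OF n] M_consistent by simp
  have "unity_poly n \<noteq> []" by (simp add: unity_poly_def)
  then obtain \<tau> where \<tau>: "\<tau> \<in> ring_hom (R\<lparr>carrier := M\<rparr>) (R\<lparr>carrier := M\<rparr>)" "\<forall>a\<in>E. \<tau> a = \<sigma>' a"
    using extend_hom_by_split_element[OF K E M KE EM hom galois_groupD(2)[OF g] \<zeta>M unity_poly_closed[OF subfieldE(1)[OF K]] _ split \<zeta>_root]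
    unfolding M_eq[symmetric] by blast
  have "\<tau> k = k" if "k \<in> K" for k using \<tau>(2) galois_groupD(2)[OF g that] that KE by auto
  then have "restrict \<tau> M \<in> carrier \<Gamma>"
    using algebraic_endomorphism_in_galois_group[OF K M KM algM \<tau>(1)] by blast
  moreover have "restrict (restrict \<tau> M) E = \<sigma>'"
    using \<tau>(2) EM galois_groupD(5)[OF g] by (auto simp: fun_eq_iff extensional_def)
  ultimately show ?thesis by blast
qed

text \<open>
  Writing \<open>x = g(\<zeta>)\<close> with \<open>deg g < deg m\<close> for the minimal polynomial \<open>m\<close> of \<open>\<zeta>\<close> over \<open>E\<close>, all \<open>deg m\<close>
  roots of \<open>m\<close> are roots of \<open>g - x\<close>, so \<open>g\<close> is constant.
\<close>

lemma fixed_by_relative_galois_group: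
  assumes x: "x \<in> M"
    and fixed: "\<And>\<gamma>. \<gamma> \<in> carrier \<Gamma> \<Longrightarrow> (\<And>a. a \<in> E \<Longrightarrow> \<gamma> a = a) \<Longrightarrow> \<gamma> x = x"
  shows "x \<in> E"
proof -
  let ?S = "R\<lparr>carrier := M\<rparr>"
  interpret M: field ?S by (rule field_M)
  note [simp] = M_consistent(1,2)
  have xR: "x \<in> carrier R" using x subfieldE(3)[OF M] by auto
  define m where "m = Irr E \<zeta>"
  note Irr = IrrE[OF E \<zeta>_carrier \<zeta>_algebraic[OF E], folded m_def]
  have mono: "carrier (E[X]) \<subseteq> carrier (M[X])"
    using EM by (auto simp: polynomial_def simp flip: univ_poly_carrier) blast
  have mM: "m \<in> carrier (M[X])" using Irr(1) mono by auto
  have PE: "unity_poly n \<in> carrier (E[X])" by (rule unity_poly_closed[OF subfieldE(1)[OF E]])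
  have Pne: "unity_poly n \<noteq> []" by (simp add: unity_poly_def)
  have mne: "m \<noteq> []" using pirreducibleE(1)[OF subfieldE(1)[OF E] Irr(1,2)] .
  have "m divides\<^bsub>E[X]\<^esub> unity_poly n"
    using Irr_minimal[OF E \<zeta>_carrier \<zeta>_algebraic[OF E] PE \<zeta>_root] pdivides_iff_shell[OF E Irr(1) PE] by (simp add: m_def)
  then have div: "m pdivides\<^bsub>?S\<^esub> unity_poly n"
    using mono by (simp add: pdivides_def factor_def univ_poly_mult) blast
  have P: "M.splitted (unity_poly n)" "M.roots (unity_poly n) = mset_set (set_mset (M.roots (unity_poly n)))"
    using M.unity_poly_roots[OF n] M_consistent by auto
  have PM: "unity_poly n \<in> carrier (poly_ring ?S)" using PE mono by auto
  have "M.splitted m" using M.pdivides_imp_splitted[OF _ PM Pne P(1) div] mM by simp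
  moreover have "M.roots m \<subseteq># mset_set (set_mset (M.roots (unity_poly n)))"
    using M.pdivides_imp_roots_incl[OF _ PM Pne div] mM P(2) by simp
  \<comment> \<open>As a divisor of X^n - 1, \<open>m\<close> splits with simple roots, so it has as
    many distinct roots as its degree.\<close>
  ultimately have card: "card (set_mset (M.roots m)) = degree m"
    using size_eq_card_of_subset_mset_set by (metis M.splitted_def)
  \<comment> \<open>Length at most \<open>degree m\<close> means degree below that of
    \<open>m\<close>, since a nonempty list is one longer than its degree.\<close>
  have "x \<in> (\<lambda>p. eval p \<zeta>) ` {p \<in> carrier (E[X]). length p \<le> degree m}"
    using x M_eq Span_exp_base[OF E \<zeta>_carrier \<zeta>_algebraic[OF E]] Span_eq_eval_img[OF E \<zeta>_carrier] by (simp add: m_def)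
  then obtain g where g: "g \<in> carrier (E[X])" "length g \<le> degree m" "x = eval g \<zeta>" by auto
  have root: "eval g y = x" if y: "y \<in># M.roots m" for y
  proof -
    have y': "y \<in> M" "eval m y = \<zero>" using M.roots_mem_iff_is_root[of m y] y mM by (auto simp: M.is_root_def)
    have id: "id \<in> ring_hom (R\<lparr>carrier := E\<rparr>) ?S" using EM by (auto simp: ring_hom_def)
    have "eval (map id (Irr E \<zeta>)) y = \<zero>" using y'(2) by (simp add: m_def)
    \<comment> \<open>Each root y of \<open>m\<close> is the image of \<zeta> under an automorphism
      trivial on E. It fixes x by assumption and maps g(\<zeta>) to g(y).\<close>
    from extend_hom_to_simple_extension[OF E M id \<zeta>_carrier \<zeta>_algebraic[OF E] y'(1) this]
    obtain \<tau> where \<tau>: "\<tau> \<in> ring_hom ?S ?S" "\<forall>a\<in>E. \<tau> a = a" "\<tau> \<zeta> = y"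
      unfolding M_eq[symmetric] by auto
    have "restrict \<tau> M \<in> carrier \<Gamma>"
      using algebraic_endomorphism_in_galois_group[OF K M KM algM \<tau>(1)] \<tau>(2) KE by blast
    then have "\<tau> x = x" using fixed[of "restrict \<tau> M"] \<tau>(2) EM x by (auto simp: subset_iff)
    moreover have "\<tau> x = eval (map \<tau> g) y"
      using subfield_hom_eval[OF M M \<tau>(1) _ \<zeta>M, of g] poly_set_incl[OF g(1)] EM g(3) \<tau>(3) by auto
    moreover have "map \<tau> g = g" using poly_set_incl[OF g(1)] \<tau>(2) by (intro map_idI) auto
    ultimately show ?thesis by simp
  qed
  show ?thesis
  proof (cases g rule: rev_cases)
    case Nil
    then show ?thesis using g(3) subringE(2)[OF subfieldE(1)[OF E]] by simp
  next
    case (snoc g' c)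
    \<comment> \<open>This is g - x, the last entry of a list being the constant term. For constant
      g the result may be the list of a single zero, so roots are counted for the normalized
      list.\<close>
    define h where "h = g' @ [c \<ominus> x]"
    have gs: "set g' \<subseteq> E" "c \<in> E" using poly_set_incl[OF g(1)] snoc by auto
    have cx: "c \<ominus> x \<in> M"
      using gs(2) EM x subringE(5,7)[OF subfieldE(1)[OF M]] by (auto simp: a_minus_def)
    have hM: "set h \<subseteq> carrier ?S" using gs EM cx by (auto simp: h_def)
    have hev: "eval h y = \<zero>" if y: "y \<in># M.roots m" for y
    proof -
      have yR: "y \<in> carrier R"
        using M.roots_mem_iff_is_root[of m y] y mM subfieldE(3)[OF M] by (auto simp: M.is_root_def)
      have gR: "set g' \<subseteq> carrier R" "c \<in> carrier R" using gs subfieldE(3)[OF E] by auto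
      have "eval (g' @ [a]) y = eval (g' @ [\<zero>]) y \<oplus> a" if "a \<in> carrier R" for a
        using gR(1) that yR
      proof (induction g')
        case (Cons b g')
        then show ?case using eval_in_carrier[of "g' @ [\<zero>]" y] by (simp add: a_assoc)
      qed simp
      from this[of c] this[of "c \<ominus> x"] have "eval g y = eval (g' @ [\<zero>]) y \<oplus> c" "eval h y = eval (g' @ [\<zero>]) y \<oplus> (c \<ominus> x)"
        using gR xR snoc by (auto simp: h_def)
      then have "eval h y = eval g y \<ominus> x"
        using gR xR yR eval_in_carrier[of "g' @ [\<zero>]" y] by (simp add: a_minus_def a_assoc)
      then show ?thesis using root[OF y] xR by simp
    qed
    have hp: "M.normalize h \<in> carrier (poly_ring ?S)"
      using M.normalize_gives_polynomial[OF hM] by (simp add: univ_poly_carrier)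
    \<comment> \<open>A nonzero g - x would have at least \<open>degree m\<close> roots but smaller
      degree. Once it is zero, its constant coefficient gives x = c.\<close>
    have "M.normalize h = []"
    proof (rule ccontr)
      assume ne: "M.normalize h \<noteq> []"
      have "set_mset (M.roots m) \<subseteq> set_mset (M.roots (M.normalize h))"
      proof
        fix y assume y: "y \<in># M.roots m"
        then have "y \<in> M" using M.roots_mem_iff_is_root[of m y] mM by (auto simp: M.is_root_def)
        then have "M.is_root (M.normalize h) y"
          using M.eval_normalize[OF hM, of y] hev[OF y] ne by (simp add: M.is_root_def)
        then show "y \<in># M.roots (M.normalize h)" using M.roots_mem_iff_is_root[OF hp] by simp
      qed
      then have "degree m \<le> card (set_mset (M.roots (M.normalize h)))"
        unfolding card[symmetric] by (intro card_mono) auto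
      also have "\<dots> \<le> size (M.roots (M.normalize h))"
        using size_mset_mono[OF mset_set_set_mset_msubset[of "M.roots (M.normalize h)"]] by simp
      also have "\<dots> \<le> degree (M.normalize h)" by (rule M.size_roots_le_degree[OF hp])
      also have "\<dots> < degree m"
      proof -
        have "length (M.normalize h) \<le> length g" using M.normalize_length_le[of h] snoc by (simp add: h_def)
        moreover have "0 < length (M.normalize h)" using ne by simp
        ultimately show ?thesis using g(2) by linarith
      qed
      finally show False by simp
    qed
    then have "M.coeff h 0 = \<zero>" using fun_cong[OF M.normalize_coeff[of h], of 0] by simp
    moreover have "M.coeff h 0 = c \<ominus> x"
    proof -
      have "M.coeff (l @ [a]) 0 = a" for l a by (induction l) auto
      then show ?thesis by (simp add: h_def)
    qed
    ultimately have "c \<ominus> x = \<zero>" by simp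
    then have "x = c" using xR gs(2) subfieldE(3)[OF E] by auto
    then show ?thesis using gs(2) by simp
  qed
qed

text \<open>In two stages: the elements of \<Gamma> trivial on E confine a fixed x to E; since every
  element of G is a restriction from \<Gamma>, x is then fixed by G and lies in K.\<close>

lemma fixed_field_M: "K = {x \<in> M. \<forall>\<gamma> \<in> carrier \<Gamma>. \<gamma> x = x}"
proof
  show "K \<subseteq> {x \<in> M. \<forall>\<gamma> \<in> carrier \<Gamma>. \<gamma> x = x}" using KM galois_groupD(2) by fastforce
  show "{x \<in> M. \<forall>\<gamma> \<in> carrier \<Gamma>. \<gamma> x = x} \<subseteq> K"
  proof
    fix x assume x: "x \<in> {x \<in> M. \<forall>\<gamma> \<in> carrier \<Gamma>. \<gamma> x = x}"
    then have xE: "x \<in> E" using fixed_by_relative_galois_group[of x] by blast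
    show "x \<in> K"
    proof (rule normal_extension_fixed_field[OF char K E KE fd nrm xE])
      fix \<tau> assume "\<tau> \<in> carrier G"
      then obtain \<gamma> where \<gamma>: "\<gamma> \<in> carrier \<Gamma>" "restrict \<gamma> E = \<tau>" using restriction_surj by blast
      then have "\<tau> x = \<gamma> x" using xE by auto
      then show "\<tau> x = x" using x \<gamma>(1) by simp
    qed
  qed
qed

lemma restriction_hom:
  "(\<lambda>\<gamma>. restrict \<gamma> E) \<in> hom \<Gamma> G"
proof (rule homI)
  fix \<gamma> assume g: "\<gamma> \<in> carrier \<Gamma>"
  show rg: "restrict \<gamma> E \<in> carrier G" by (rule galois_restrict_mem[OF K E M KE EM nrm g])
  fix \<delta> assume d: "\<delta> \<in> carrier \<Gamma>"
  have rd: "restrict \<delta> E \<in> carrier G" by (rule galois_restrict_mem[OF K E M KE EM nrm d])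
  show "restrict (\<gamma> \<otimes>\<^bsub>\<Gamma>\<^esub> \<delta>) E = restrict \<gamma> E \<otimes>\<^bsub>G\<^esub> restrict \<delta> E"
    unfolding galois_group_mult[OF g d] galois_group_mult[OF rg rd]
    using normal_extension_stable[OF K E M KE EM nrm d] EM by (auto simp: compose_def fun_eq_iff)
qed

lemma galois_finite_automorphism_group:
  "finite_automorphism_group (R\<lparr>carrier := M\<rparr>) \<Gamma>"
proof -
  interpret M: field "R\<lparr>carrier := M\<rparr>" by (rule field_M)
  show ?thesis
  proof (intro finite_automorphism_group.intro finite_automorphism_group_axioms.intro M.field_axioms)
    show "group \<Gamma>" by (rule galois_group_is_group[OF K M KM])
    show "finite (carrier \<Gamma>)" by (rule finite_galois_group[OF K M KM fdM])
    fix \<gamma> assume g: "\<gamma> \<in> carrier \<Gamma>"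
    show "\<gamma> \<in> ring_hom (R\<lparr>carrier := M\<rparr>) (R\<lparr>carrier := M\<rparr>)" by (rule galois_groupD(1)[OF g])
    fix \<delta> assume d: "\<delta> \<in> carrier \<Gamma>"
    show "(\<gamma> \<otimes>\<^bsub>\<Gamma>\<^esub> \<delta>) x = \<gamma> (\<delta> x)" if "x \<in> carrier (R\<lparr>carrier := M\<rparr>)" for x
      using that by (simp add: galois_group_mult[OF g d] compose_eq)
    show "\<exists>x\<in>carrier (R\<lparr>carrier := M\<rparr>). \<gamma> x \<noteq> \<delta> x" if "\<gamma> \<noteq> \<delta>"
      using that extensionalityI[OF galois_groupD(5)[OF g] galois_groupD(5)[OF d]] by auto
  next
    show "\<one>\<^bsub>\<Gamma>\<^esub> x = x" if "x \<in> carrier (R\<lparr>carrier := M\<rparr>)" for x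
      using that by (simp add: galois_group_one)
  qed
qed

end

section \<open>Fixed rings of group algebras\<close>

text \<open>\<open>algebra_isomorphic\<close> compares bare records. To see that the inverse of an
  isomorphism respects the operations, one needs the source to be closed under them.\<close>

definition algebra_closed :: "'a set \<Rightarrow> ('a, 'c, 'm) module_scheme \<Rightarrow> bool" where
  "algebra_closed K A \<longleftrightarrow> \<one>\<^bsub>A\<^esub> \<in> carrier A \<and>
     (\<forall>x \<in> carrier A. (\<forall>y \<in> carrier A. x \<otimes>\<^bsub>A\<^esub> y \<in> carrier A \<and> x \<oplus>\<^bsub>A\<^esub> y \<in> carrier A) \<and>
       (\<forall>k \<in> K. k \<odot>\<^bsub>A\<^esub> x \<in> carrier A))"

lemma algebra_isomorphic_sym:
  assumes "algebra_closed K A" "algebra_isomorphic K A B"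
  shows "algebra_isomorphic K B A"
proof -
  obtain f where f: "f \<in> ring_iso A B" "\<And>k x. k \<in> K \<Longrightarrow> x \<in> carrier A \<Longrightarrow> f (k \<odot>\<^bsub>A\<^esub> x) = k \<odot>\<^bsub>B\<^esub> f x"
    using assms(2) by (auto simp: algebra_isomorphic_def)
  note iso = ring_iso_memE[OF f(1)]
  define g where "g = inv_into (carrier A) f"
  have g: "g (f x) = x" if "x \<in> carrier A" for x
    using iso(5) that by (simp add: g_def bij_betw_def)
  have surj: "\<exists>x\<in>carrier A. y = f x" if "y \<in> carrier B" for y using iso(5) that by (auto simp: bij_betw_def)
  have "g \<in> ring_hom B A"
  proof (rule ring_hom_memI)
    fix x y assume "x \<in> carrier B" "y \<in> carrier B"
    then obtain a b where a: "a \<in> carrier A" "x = f a" and b: "b \<in> carrier A" "y = f b" using surj by metis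
    have ab: "a \<otimes>\<^bsub>A\<^esub> b \<in> carrier A" "a \<oplus>\<^bsub>A\<^esub> b \<in> carrier A" using assms(1) a b by (auto simp: algebra_closed_def)
    show "g x \<in> carrier A" using a g by simp
    show "g (x \<otimes>\<^bsub>B\<^esub> y) = g x \<otimes>\<^bsub>A\<^esub> g y" using iso(2)[OF a(1) b(1)] g[OF ab(1)] g a b by simp
    show "g (x \<oplus>\<^bsub>B\<^esub> y) = g x \<oplus>\<^bsub>A\<^esub> g y" using iso(3)[OF a(1) b(1)] g[OF ab(2)] g a b by simp
  next
    show "g \<one>\<^bsub>B\<^esub> = \<one>\<^bsub>A\<^esub>" using iso(4) g[of "\<one>\<^bsub>A\<^esub>"] assms(1) by (simp add: algebra_closed_def)
  qed
  moreover have "bij_betw g (carrier B) (carrier A)" unfolding g_def by (rule bij_betw_inv_into[OF iso(5)])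
  moreover have "g (k \<odot>\<^bsub>B\<^esub> y) = k \<odot>\<^bsub>A\<^esub> g y" if k: "k \<in> K" and y: "y \<in> carrier B" for k y
  proof -
    obtain a where a: "a \<in> carrier A" "y = f a" using surj[OF y] by auto
    then show ?thesis using f(2)[OF k a(1)] g[of "k \<odot>\<^bsub>A\<^esub> a"] g assms(1) k by (simp add: algebra_closed_def)
  qed
  ultimately show ?thesis by (auto simp: algebra_isomorphic_def ring_iso_def)
qed

lemma algebra_isomorphic_trans:
  assumes "algebra_isomorphic K A B" "algebra_isomorphic K B C"
  shows "algebra_isomorphic K A C"
proof -
  obtain f where f: "f \<in> ring_iso A B" "\<And>k x. k \<in> K \<Longrightarrow> x \<in> carrier A \<Longrightarrow> f (k \<odot>\<^bsub>A\<^esub> x) = k \<odot>\<^bsub>B\<^esub> f x"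
    using assms(1) by (auto simp: algebra_isomorphic_def)
  obtain g where g: "g \<in> ring_iso B C" "\<And>k x. k \<in> K \<Longrightarrow> x \<in> carrier B \<Longrightarrow> g (k \<odot>\<^bsub>B\<^esub> x) = k \<odot>\<^bsub>C\<^esub> g x"
    using assms(2) by (auto simp: algebra_isomorphic_def)
  have "g \<circ> f \<in> ring_iso A C" using ring_iso_set_trans[OF f(1) g(1)] .
  then show ?thesis using f g ring_iso_memE(1)[OF f(1)]
    unfolding algebra_isomorphic_def by (intro bexI[of _ "g \<circ> f"]) auto
qed

lemma (in equivariant) equivariant_algebra_closed:
  assumes "K = {x \<in> carrier F. \<forall>\<gamma>\<in>carrier \<Gamma>. \<gamma> x = x}"
  shows "algebra_closed K A"
  using one_mem mult_mem add_mem smult_mem assms by (auto simp: algebra_closed_def)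

section \<open>Conjugation by coset translations in terms of N\<close>

locale regular_representation =
  fixes N :: "('n, 'j) monoid_scheme" and G :: "('g, 'k) monoid_scheme" and H :: "'g set"
    and \<alpha> :: "'n \<Rightarrow> 'g set \<Rightarrow> 'g set"
  assumes N: "group N" and fin: "finite (carrier N)" and G: "group G" and H: "H \<subseteq> carrier G"
    and card: "order N = card (lcosets\<^bsub>G\<^esub> H)"
    and \<alpha>: "\<alpha> \<in> hom N (BijGroup (lcosets\<^bsub>G\<^esub> H))" and inj: "inj_on \<alpha> (carrier N)"
    and reg: "regular_subgroup (lcosets\<^bsub>G\<^esub> H) (\<alpha> ` carrier N)"
    and nrm: "coset_translation G H ` carrier G \<subseteq> normalizer (BijGroup (lcosets\<^bsub>G\<^esub> H)) (\<alpha> ` carrier N)"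
begin

sublocale N: group N by (rule N)
sublocale G: group G by (rule G)

abbreviation Q where "Q \<equiv> lcosets\<^bsub>G\<^esub> H"
abbreviation S where "S \<equiv> BijGroup Q"
abbreviation l where "l \<equiv> coset_translation G H"

sublocale S: group S by (rule group_BijGroup)

text \<open>The automorphism component of \<beta>(g). By \<open>perm_conj_eq\<close> it describes
  conjugation by \<lambda>(g) on the image of \<alpha>.\<close>

definition \<theta> :: "'g \<Rightarrow> 'n \<Rightarrow> 'n" where "\<theta> g = aut_part N (hol_embedding N G H \<alpha> g)"

lemma carrier_S: "carrier S = Bij Q" by (simp add: BijGroup_def)

lemma apply_S: "p \<in> Bij Q \<Longrightarrow> q \<in> Bij Q \<Longrightarrow> x \<in> Q \<Longrightarrow> (p \<otimes>\<^bsub>S\<^esub> q) x = p (q x)"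
  by (simp add: BijGroup_def compose_def)

lemma \<alpha>_Bij: "n \<in> carrier N \<Longrightarrow> \<alpha> n \<in> Bij Q"
  using \<alpha> by (auto simp: hom_def carrier_S)

lemma \<alpha>_mult: "m \<in> carrier N \<Longrightarrow> n \<in> carrier N \<Longrightarrow> \<alpha> (m \<otimes>\<^bsub>N\<^esub> n) = \<alpha> m \<otimes>\<^bsub>S\<^esub> \<alpha> n"
  using \<alpha> by (auto simp: hom_def)

lemma l_Bij: "g \<in> carrier G \<Longrightarrow> l g \<in> Bij Q"
proof -
  assume "g \<in> carrier G"
  then have "l g \<in> normalizer S (\<alpha> ` carrier N)" using nrm by auto
  moreover have "\<alpha> ` carrier N \<subseteq> carrier S" using \<alpha>_Bij carrier_S by auto
  ultimately show ?thesis by (auto simp: normalizer_def stabilizer_def carrier_S)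
qed

lemma hol: "g \<in> carrier G \<Longrightarrow> hol_embedding N G H \<alpha> g \<in> holomorph N"
  using hol_embedding_in_holomorph[OF N fin _ card \<alpha> reg nrm] G by (simp add: group_def)

lemma \<theta>_auto: "g \<in> carrier G \<Longrightarrow> \<theta> g \<in> auto N"
  unfolding \<theta>_def by (rule N.aut_part(1)[OF hol])

lemma \<theta>_closed: "g \<in> carrier G \<Longrightarrow> n \<in> carrier N \<Longrightarrow> \<theta> g n \<in> carrier N"
  and \<theta>_hom: "g \<in> carrier G \<Longrightarrow> m \<in> carrier N \<Longrightarrow> n \<in> carrier N \<Longrightarrow> \<theta> g (m \<otimes>\<^bsub>N\<^esub> n) = \<theta> g m \<otimes>\<^bsub>N\<^esub> \<theta> g n"
  and \<theta>_bij: "g \<in> carrier G \<Longrightarrow> bij_betw (\<theta> g) (carrier N) (carrier N)"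
  using \<theta>_auto[of g] by (auto simp: auto_def hom_def Bij_def)

text \<open>The bijection \<open>a\<close> carries left translation by n to \<alpha>(n), and
  \<open>h\<close> to \<lambda>(g). As \<open>h\<close> is the automorphism
  \<open>\<theta> g\<close> followed by a right translation, which commutes with left translations,
  h(nx) is the product of \<open>\<theta> g n\<close> and h(x); read through \<open>a\<close>, this
  is the claim.\<close>

lemma perm_conj_eq:
  assumes g: "g \<in> carrier G" and n: "n \<in> carrier N"
  shows "perm_conj G H g (\<alpha> n) = \<alpha> (\<theta> g n)"
proof -
  define a where "a = base_orbit_map G H \<alpha>"
  define h where "h = hol_embedding N G H \<alpha> g"
  have b: "\<one>\<^bsub>G\<^esub> <#\<^bsub>G\<^esub> H \<in> Q" by (auto simp: LCOSETS_def)
  have aQ: "a m \<in> Q" if "m \<in> carrier N" for m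
    using Bij_imp_funcset[OF \<alpha>_Bij[OF that]] b by (auto simp: a_def base_orbit_map_def)
  have "a ` carrier N = Q"
  proof
    show "Q \<subseteq> a ` carrier N"
    proof
      fix y assume "y \<in> Q"
      then obtain m where "m \<in> carrier N" "\<alpha> m (\<one>\<^bsub>G\<^esub> <#\<^bsub>G\<^esub> H) = y"
        using reg b unfolding regular_subgroup_def by blast
      then show "y \<in> a ` carrier N" by (auto simp: a_def base_orbit_map_def)
    qed
  qed (use aQ in auto)
  moreover from this have "inj_on a (carrier N)"
    using card fin by (intro eq_card_imp_inj_on) (auto simp: order_def)
  ultimately have abij: "bij_betw a (carrier N) Q" by (simp add: bij_betw_def)
  have lQ: "l g y \<in> Q" if "y \<in> Q" for y using Bij_imp_funcset[OF l_Bij[OF g]] that by auto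
  have ah: "a (h x) = l g (a x)" if "x \<in> carrier N" for x
    using that bij_betw_inv_into_right[OF abij] lQ[OF aQ[OF that]] by (simp add: h_def hol_embedding_def a_def)
  have a_mult: "a (k \<otimes>\<^bsub>N\<^esub> x) = \<alpha> k (a x)" if "k \<in> carrier N" "x \<in> carrier N" for k x
    using \<alpha>_mult[OF that] apply_S[OF \<alpha>_Bij[OF that(1)] \<alpha>_Bij[OF that(2)] b] by (simp add: a_def base_orbit_map_def)
  obtain m where m: "m \<in> carrier N" "h = compose (carrier N) (right_translation N m) (\<theta> g)"
    using N.aut_part(2)[OF hol[OF g]] unfolding h_def \<theta>_def by blast
  have hx: "h x = \<theta> g x \<otimes>\<^bsub>N\<^esub> m" if "x \<in> carrier N" for x
    using that \<theta>_closed[OF g] by (simp add: m(2) compose_eq right_translation_def)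
  have hc: "h x \<in> carrier N" if "x \<in> carrier N" for x using hx[OF that] m(1) \<theta>_closed[OF g that] by simp
  have eq: "l g (\<alpha> n y) = \<alpha> (\<theta> g n) (l g y)" if y: "y \<in> Q" for y
  proof -
    obtain x where x: "x \<in> carrier N" "y = a x" using abij y by (auto simp: bij_betw_def)
    have "l g (\<alpha> n y) = a (h (n \<otimes>\<^bsub>N\<^esub> x))" using ah[of "n \<otimes>\<^bsub>N\<^esub> x"] a_mult n x by simp
    also have "h (n \<otimes>\<^bsub>N\<^esub> x) = \<theta> g n \<otimes>\<^bsub>N\<^esub> h x"
      using hx n x m(1) \<theta>_hom[OF g] \<theta>_closed[OF g] by (simp add: N.m_assoc)
    also have "a \<dots> = \<alpha> (\<theta> g n) (l g y)" using a_mult[OF \<theta>_closed[OF g n] hc[OF x(1)]] ah x by simp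
    finally show ?thesis .
  qed
  have \<theta>n: "\<alpha> (\<theta> g n) \<in> Bij Q" by (rule \<alpha>_Bij[OF \<theta>_closed[OF g n]])
  have "l g \<otimes>\<^bsub>S\<^esub> \<alpha> n = \<alpha> (\<theta> g n) \<otimes>\<^bsub>S\<^esub> l g"
  proof (rule extensionalityI[of _ Q])
    show "l g \<otimes>\<^bsub>S\<^esub> \<alpha> n \<in> extensional Q" "\<alpha> (\<theta> g n) \<otimes>\<^bsub>S\<^esub> l g \<in> extensional Q"
      using l_Bij[OF g] \<alpha>_Bij[OF n] \<theta>n by (auto simp: BijGroup_def)
  qed (use l_Bij[OF g] \<alpha>_Bij[OF n] \<theta>n eq in \<open>simp add: apply_S\<close>)
  then have "l g \<otimes>\<^bsub>S\<^esub> \<alpha> n \<otimes>\<^bsub>S\<^esub> inv\<^bsub>S\<^esub> l g = \<alpha> (\<theta> g n)"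
    using l_Bij[OF g, folded carrier_S] \<theta>n[folded carrier_S] by (simp add: S.m_assoc)
  then show ?thesis by (simp add: perm_conj_def Let_def)
qed

lemma l_mult:
  assumes g: "g \<in> carrier G" and h: "h \<in> carrier G"
  shows "l (g \<otimes>\<^bsub>G\<^esub> h) = l g \<otimes>\<^bsub>S\<^esub> l h"
proof (rule extensionalityI[of _ Q])
  fix C assume C: "C \<in> Q"
  then obtain a where a: "a \<in> carrier G" "C = a <#\<^bsub>G\<^esub> H" by (auto simp: LCOSETS_def)
  have CG: "C \<subseteq> carrier G" using G.l_coset_subset_G[OF H a(1)] a(2) by simp
  have hC: "h <#\<^bsub>G\<^esub> C \<in> Q" using a h G.lcos_m_assoc[OF H h a(1)] by (auto simp: LCOSETS_def)
  show "l (g \<otimes>\<^bsub>G\<^esub> h) C = (l g \<otimes>\<^bsub>S\<^esub> l h) C"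
    using apply_S[OF l_Bij[OF g] l_Bij[OF h] C] C hC G.lcos_m_assoc[OF CG g h] by (simp add: coset_translation_def)
qed (use l_Bij[OF g] l_Bij[OF h] in \<open>auto simp: coset_translation_def BijGroup_def\<close>)

text \<open>\<lambda> is multiplicative and \<alpha> injective, so the conjugation formula yields
  multiplicativity without decomposing a product in the holomorph.\<close>

lemma \<theta>_mult:
  assumes g: "g \<in> carrier G" and h: "h \<in> carrier G" and n: "n \<in> carrier N"
  shows "\<theta> (g \<otimes>\<^bsub>G\<^esub> h) n = \<theta> g (\<theta> h n)"
proof -
  have c: "l g \<in> carrier S" "l h \<in> carrier S" "\<alpha> n \<in> carrier S"
    using l_Bij g h \<alpha>_Bij[OF n] by (simp_all add: carrier_S)
  have "\<alpha> (\<theta> (g \<otimes>\<^bsub>G\<^esub> h) n) = perm_conj G H (g \<otimes>\<^bsub>G\<^esub> h) (\<alpha> n)" using perm_conj_eq g h n by simp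
  also have "\<dots> = l g \<otimes>\<^bsub>S\<^esub> (l h \<otimes>\<^bsub>S\<^esub> \<alpha> n \<otimes>\<^bsub>S\<^esub> inv\<^bsub>S\<^esub> l h) \<otimes>\<^bsub>S\<^esub> inv\<^bsub>S\<^esub> l g"
    using c by (simp add: perm_conj_def Let_def l_mult[OF g h] S.inv_mult_group S.m_assoc)
  also have "\<dots> = perm_conj G H g (perm_conj G H h (\<alpha> n))" by (simp add: perm_conj_def Let_def)
  also have "\<dots> = \<alpha> (\<theta> g (\<theta> h n))" using perm_conj_eq g h n \<theta>_closed by simp
  finally show ?thesis using inj g h n \<theta>_closed by (auto dest: inj_onD)
qed

text \<open>An idempotent injective map is the identity.\<close>

lemma \<theta>_one:
  assumes n: "n \<in> carrier N" shows "\<theta> \<one>\<^bsub>G\<^esub> n = n"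
proof -
  have "\<theta> \<one>\<^bsub>G\<^esub> (\<theta> \<one>\<^bsub>G\<^esub> n) = \<theta> \<one>\<^bsub>G\<^esub> n" using \<theta>_mult[of "\<one>\<^bsub>G\<^esub>" "\<one>\<^bsub>G\<^esub>"] n by simp
  then show ?thesis
    using \<theta>_bij[of "\<one>\<^bsub>G\<^esub>"] \<theta>_closed[of "\<one>\<^bsub>G\<^esub>" n] n by (auto simp: bij_betw_def dest: inj_onD)
qed

lemma \<alpha>_subgroup: "subgroup (\<alpha> ` carrier N) S"
  using reg by (simp add: regular_subgroup_def)

lemma \<alpha>_one: "\<alpha> \<one>\<^bsub>N\<^esub> = \<one>\<^bsub>S\<^esub>"
  using hom_one[OF \<alpha> N group_BijGroup] .

lemma \<alpha>_inv: "n \<in> carrier N \<Longrightarrow> inv\<^bsub>S\<lparr>carrier := \<alpha> ` carrier N\<rparr>\<^esub> \<alpha> n = \<alpha> (inv\<^bsub>N\<^esub> n)"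
  using S.m_inv_consistent[OF \<alpha>_subgroup, of "\<alpha> n"]
    group_hom.hom_inv[of N S \<alpha> n] N group_BijGroup \<alpha> by (simp add: group_hom_def group_hom_axioms_def)

end

text \<open>The group algebra sums in E, the Fourier transform in E(\<zeta>); both are compared as
  sums in R.\<close>

lemma (in ring) finsum_subring:
  assumes K: "subring K R" and f: "f \<in> A \<rightarrow> K"
  shows "finsum (R\<lparr>carrier := K\<rparr>) f A = finsum R f A"
proof -
  interpret K: ring "R\<lparr>carrier := K\<rparr>" using K by (rule subring_is_ring)
  show ?thesis
    using f
  proof (induction A rule: infinite_finite_induct)
    case (insert a A)
    have "f \<in> A \<rightarrow> K" "f a \<in> K" "f \<in> A \<rightarrow> carrier R" "f a \<in> carrier R"
      using insert.prems subringE(1)[OF K] by auto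
    then show ?case using insert K.finsum_insert[of A a f] finsum_insert[of A a f] by simp
  qed (use K.finsum_infinite K.finsum_empty finsum_infinite in auto)
qed

section \<open>The Fourier transform on the fixed ring\<close>

locale fixed_algebra = cyclotomic_extension R K E \<zeta> "group_exponent N" +
  rep: regular_representation N "galois_group R E K" H \<alpha>
  for R (structure) and K E \<zeta> and N :: "('n, 'j) monoid_scheme" and H and \<alpha> +
  assumes comm: "comm_group N"
begin

abbreviation F where "F \<equiv> R\<lparr>carrier := M\<rparr>"
abbreviation P where "P \<equiv> \<alpha> ` carrier N"
abbreviation A where "A \<equiv> fixed_group_algebra R E G H P"

sublocale aut: finite_automorphism_group F \<Gamma> by (rule galois_finite_automorphism_group)

sublocale dual: character_duality F N \<zeta>
proof (intro character_duality.intro character_duality_axioms.intro field_M comm rep.fin)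
  have pow: "[k] \<cdot>\<^bsub>F\<^esub> \<one> = [k] \<cdot> \<one>" for k :: nat
    by (induction k) (simp_all add: add_pow_def nat_pow_def)
  show "[k] \<cdot>\<^bsub>F\<^esub> \<one>\<^bsub>F\<^esub> \<noteq> \<zero>\<^bsub>F\<^esub>" if "0 < k" for k :: nat using char[OF that] pow by simp
  show "primitive_root_of_unity F (group_exponent N) \<zeta>" by (rule M_consistent(4))
qed

abbreviation act where "act \<equiv> galois_act_char N E G H \<Gamma> \<alpha>"
abbreviation B where "B \<equiv> equivariant_algebra F \<Gamma> dual.dual act"

lemma restrict_closed: "\<gamma> \<in> carrier \<Gamma> \<Longrightarrow> restrict \<gamma> E \<in> carrier G"
  using restriction_hom by (auto simp: hom_def)

lemma restrict_mult: "\<gamma> \<in> carrier \<Gamma> \<Longrightarrow> \<delta> \<in> carrier \<Gamma> \<Longrightarrow> restrict (\<gamma> \<otimes>\<^bsub>\<Gamma>\<^esub> \<delta>) E = restrict \<gamma> E \<otimes>\<^bsub>G\<^esub> restrict \<delta> E"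
  using restriction_hom by (auto simp: hom_def)

lemma restrict_one: "restrict \<one>\<^bsub>\<Gamma>\<^esub> E = \<one>\<^bsub>G\<^esub>"
  using hom_one[OF restriction_hom aut.\<Gamma>.is_group rep.G.is_group] .

lemma restrict_inv: "\<gamma> \<in> carrier \<Gamma> \<Longrightarrow> restrict (inv\<^bsub>\<Gamma>\<^esub> \<gamma>) E = inv\<^bsub>G\<^esub> (restrict \<gamma> E)"
  using group_hom.hom_inv[of \<Gamma> G "\<lambda>\<gamma>. restrict \<gamma> E" \<gamma>] restriction_hom aut.\<Gamma>.is_group rep.G.is_group
  by (simp add: group_hom_def group_hom_axioms_def)

abbreviation twist where "twist \<gamma> \<equiv> rep.\<theta> (restrict (inv\<^bsub>\<Gamma>\<^esub> \<gamma>) E)"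

lemma act_apply:
  "\<eta> \<in> carrier N \<Longrightarrow> act \<gamma> \<chi> \<eta> = \<gamma> (\<chi> (twist \<gamma> \<eta>))"
  by (simp add: galois_act_char_def galois_act_group_def rep.\<theta>_def)

lemma \<theta>_restrict_closed: "\<gamma> \<in> carrier \<Gamma> \<Longrightarrow> \<eta> \<in> carrier N \<Longrightarrow> rep.\<theta> (restrict \<gamma> E) \<eta> \<in> carrier N"
  using rep.\<theta>_closed restrict_closed by blast

lemma act_closed:
  assumes g: "\<gamma> \<in> carrier \<Gamma>" and c: "\<chi> \<in> dual.dual"
  shows "act \<gamma> \<chi> \<in> dual.dual"
proof (rule dual.char_memI)
  have i: "inv\<^bsub>\<Gamma>\<^esub> \<gamma> \<in> carrier \<Gamma>" using g by simp
  show "act \<gamma> \<chi> \<in> extensional (carrier N)" by (simp add: galois_act_char_def)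
  fix a assume a: "a \<in> carrier N"
  note cl = dual.char_closed[OF c \<theta>_restrict_closed[OF i]]
  show "act \<gamma> \<chi> a \<in> carrier F" using aut.closed[OF g cl[OF a]] a by (simp add: act_apply)
  have "inj_on \<gamma> M" using galois_groupD(3)[OF g] by (auto simp: Bij_def bij_betw_def)
  moreover have "\<gamma> \<zero> = \<zero>" using ring_hom_cring.hom_zero[OF aut.hom_cring[OF g]] by simp
  ultimately have "\<gamma> z = \<zero> \<Longrightarrow> z = \<zero>" if "z \<in> M" for z
    using that aut.zero_closed inj_onD[of \<gamma> M z \<zero>] by simp
  then show "act \<gamma> \<chi> a \<noteq> \<zero>\<^bsub>F\<^esub>"
    using dual.char_nonzero[OF c \<theta>_restrict_closed[OF i a]] cl[OF a] a by (simp add: act_apply) blast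
  fix b assume b: "b \<in> carrier N"
  show "act \<gamma> \<chi> (a \<otimes>\<^bsub>N\<^esub> b) = act \<gamma> \<chi> a \<otimes>\<^bsub>F\<^esub> act \<gamma> \<chi> b"
    using a b rep.\<theta>_hom[OF restrict_closed[OF i] a b] dual.char_mult[OF c \<theta>_restrict_closed[OF i a] \<theta>_restrict_closed[OF i b]]
      aut.hom_mult[OF g cl[OF a] cl[OF b]] by (simp add: act_apply)
qed

sublocale eqv: equivariant F \<Gamma> dual.dual act
proof (intro equivariant.intro finite_gset.intro galois_finite_automorphism_group)
  show "finite dual.dual" by (rule dual.finite_dual)
  show "act \<gamma> \<chi> \<in> dual.dual" if "\<gamma> \<in> carrier \<Gamma>" "\<chi> \<in> dual.dual" for \<gamma> \<chi> using act_closed that .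
  have ext: "\<chi> \<in> extensional (carrier N)" if "\<chi> \<in> dual.dual" for \<chi> using that by (simp add: characters_def)
  show "act (\<gamma> \<otimes>\<^bsub>\<Gamma>\<^esub> \<delta>) \<chi> = act \<gamma> (act \<delta> \<chi>)"
    if g: "\<gamma> \<in> carrier \<Gamma>" and d: "\<delta> \<in> carrier \<Gamma>" and c: "\<chi> \<in> dual.dual" for \<gamma> \<delta> \<chi>
  proof (rule extensionalityI[of _ "carrier N"])
    fix \<eta> assume \<eta>: "\<eta> \<in> carrier N"
    have i: "inv\<^bsub>\<Gamma>\<^esub> \<gamma> \<in> carrier \<Gamma>" "inv\<^bsub>\<Gamma>\<^esub> \<delta> \<in> carrier \<Gamma>" using g d by auto
    \<comment> \<open>Precomposition alone would give a right action; the inverse in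
      \<open>twist\<close> reverses the product and makes it a left action.\<close>
    have "rep.\<theta> (restrict (inv\<^bsub>\<Gamma>\<^esub> (\<gamma> \<otimes>\<^bsub>\<Gamma>\<^esub> \<delta>)) E) \<eta>
        = rep.\<theta> (restrict (inv\<^bsub>\<Gamma>\<^esub> \<delta>) E) (twist \<gamma> \<eta>)"
      using rep.\<theta>_mult[OF restrict_closed[OF i(2)] restrict_closed[OF i(1)] \<eta>] restrict_mult[OF i(2,1)]
      by (simp add: aut.\<Gamma>.inv_mult_group[OF g d])
    then show "act (\<gamma> \<otimes>\<^bsub>\<Gamma>\<^esub> \<delta>) \<chi> \<eta> = act \<gamma> (act \<delta> \<chi>) \<eta>"
      using \<eta> \<theta>_restrict_closed[OF i(1) \<eta>]
        aut.mult[OF g d dual.char_closed[OF c \<theta>_restrict_closed[OF i(2) \<theta>_restrict_closed[OF i(1) \<eta>]]]]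
      by (simp add: act_apply)
  qed (simp_all add: galois_act_char_def)
  show "act \<one>\<^bsub>\<Gamma>\<^esub> \<chi> = \<chi>" if c: "\<chi> \<in> dual.dual" for \<chi>
  proof (rule extensionalityI[of _ "carrier N"])
    fix \<eta> assume \<eta>: "\<eta> \<in> carrier N"
    show "act \<one>\<^bsub>\<Gamma>\<^esub> \<chi> \<eta> = \<chi> \<eta>"
      using \<eta> rep.\<theta>_one[OF \<eta>] restrict_one aut.one[OF dual.char_closed[OF c \<eta>]] by (simp add: act_apply)
  qed (use ext[OF c] in \<open>simp_all add: galois_act_char_def\<close>)
qed

text \<open>\<gamma> passes through the finite sum, and reindexing by \<open>twist \<gamma>\<close>
  moves it onto the character. Thus the transform intertwines the action on characters with the
  semilinear action taking x to
  \<open>\<lambda>\<eta>. \<gamma> (x (twist \<gamma> \<eta>))\<close>.\<close>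

lemma fourier_equivariant:
  assumes g: "\<gamma> \<in> carrier \<Gamma>" and c: "\<chi> \<in> dual.dual" and x: "x \<in> carrier N \<rightarrow> carrier F"
  shows "\<gamma> (dual.fourier x \<chi>) = dual.fourier (\<lambda>\<eta>. \<gamma> (x (twist \<gamma> \<eta>))) (act \<gamma> \<chi>)"
proof -
  interpret \<gamma>: ring_hom_cring F F \<gamma> by (rule aut.hom_cring[OF g])
  have i: "inv\<^bsub>\<Gamma>\<^esub> \<gamma> \<in> carrier \<Gamma>" using g by simp
  let ?t = "twist \<gamma>"
  have bij: "bij_betw ?t (carrier N) (carrier N)" by (rule rep.\<theta>_bij[OF restrict_closed[OF i]])
  have xc: "x \<eta> \<in> carrier F" "\<chi> \<eta> \<in> carrier F" if "\<eta> \<in> carrier N" for \<eta>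
    using x that dual.char_closed[OF c] by auto
  have cl: "x \<eta> \<otimes>\<^bsub>F\<^esub> \<chi> \<eta> \<in> carrier F" if "\<eta> \<in> carrier N" for \<eta>
    using aut.m_closed[OF xc[OF that]] .
  have "\<gamma> (dual.fourier x \<chi>) = (\<Oplus>\<^bsub>F\<^esub>\<eta>\<in>carrier N. \<gamma> (x \<eta> \<otimes>\<^bsub>F\<^esub> \<chi> \<eta>))"
    unfolding dual.fourier_def using cl by (subst \<gamma>.hom_finsum) (auto simp: comp_def)
  also have "\<dots> = (\<Oplus>\<^bsub>F\<^esub>\<eta>\<in>?t ` carrier N. \<gamma> (x \<eta> \<otimes>\<^bsub>F\<^esub> \<chi> \<eta>))" using bij by (simp add: bij_betw_def)
  also have "\<dots> = (\<Oplus>\<^bsub>F\<^esub>\<eta>\<in>carrier N. \<gamma> (x (?t \<eta>) \<otimes>\<^bsub>F\<^esub> \<chi> (?t \<eta>)))"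
    using bij cl \<gamma>.hom_closed by (intro aut.finsum_reindex) (auto simp: bij_betw_def)
  also have "\<dots> = dual.fourier (\<lambda>\<eta>. \<gamma> (x (?t \<eta>))) (act \<gamma> \<chi>)"
    unfolding dual.fourier_def
  proof (rule aut.finsum_cong')
    fix \<eta> assume \<eta>: "\<eta> \<in> carrier N"
    note t = \<theta>_restrict_closed[OF i \<eta>]
    show "\<gamma> (x (?t \<eta>) \<otimes>\<^bsub>F\<^esub> \<chi> (?t \<eta>)) = \<gamma> (x (?t \<eta>)) \<otimes>\<^bsub>F\<^esub> act \<gamma> \<chi> \<eta>"
      using aut.hom_mult[OF g xc[OF t]] \<eta> by (simp add: act_apply)
  next
    show "(\<lambda>\<eta>. \<gamma> (x (?t \<eta>)) \<otimes>\<^bsub>F\<^esub> act \<gamma> \<chi> \<eta>) \<in> carrier N \<rightarrow> carrier F"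
    proof
      fix \<eta> assume \<eta>: "\<eta> \<in> carrier N"
      show "\<gamma> (x (?t \<eta>)) \<otimes>\<^bsub>F\<^esub> act \<gamma> \<chi> \<eta> \<in> carrier F"
        by (rule aut.m_closed[OF aut.closed[OF g xc(1)[OF \<theta>_restrict_closed[OF i \<eta>]]] dual.char_closed[OF act_closed[OF g c] \<eta>]])
    qed
  qed simp
  finally show ?thesis .
qed

text \<open>By \<open>perm_conj_eq\<close> conjugation on P is \<theta> on N, which turns invariance
  in the group algebra into a condition on a coefficient function on N.\<close>

lemma carrier_A:
  "x \<in> carrier A \<longleftrightarrow> x \<in> P \<rightarrow>\<^sub>E E \<and> (\<forall>\<sigma>' \<in> carrier G. \<forall>\<eta> \<in> carrier N. \<sigma>' (x (\<alpha> (rep.\<theta> (inv\<^bsub>G\<^esub> \<sigma>') \<eta>))) = x (\<alpha> \<eta>))"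
proof -
  have "group_algebra_action G H P \<sigma>' x = x \<longleftrightarrow> (\<forall>\<eta> \<in> carrier N. \<sigma>' (x (\<alpha> (rep.\<theta> (inv\<^bsub>G\<^esub> \<sigma>') \<eta>))) = x (\<alpha> \<eta>))"
    if s: "\<sigma>' \<in> carrier G" and x: "x \<in> P \<rightarrow>\<^sub>E E" for \<sigma>'
  proof -
    have "group_algebra_action G H P \<sigma>' x = x \<longleftrightarrow> (\<forall>\<nu> \<in> P. \<sigma>' (x (perm_conj G H (inv\<^bsub>G\<^esub> \<sigma>') \<nu>)) = x \<nu>)"
      using x unfolding group_algebra_action_def by (auto simp: fun_eq_iff restrict_def PiE_def extensional_def)
    also have "\<dots> \<longleftrightarrow> (\<forall>\<eta> \<in> carrier N. \<sigma>' (x (\<alpha> (rep.\<theta> (inv\<^bsub>G\<^esub> \<sigma>') \<eta>))) = x (\<alpha> \<eta>))"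
      using rep.perm_conj_eq[OF rep.G.inv_closed[OF s]] by simp
    finally show ?thesis .
  qed
  then show ?thesis by (auto simp: fixed_group_algebra_def group_algebra_def Let_def)
qed

lemma A_fixed:
  assumes x: "x \<in> carrier A" and s: "\<sigma>' \<in> carrier G" and \<eta>: "\<eta> \<in> carrier N"
  shows "\<sigma>' (x (\<alpha> (rep.\<theta> (inv\<^bsub>G\<^esub> \<sigma>') \<eta>))) = x (\<alpha> \<eta>)"
proof -
  have "\<forall>\<sigma>' \<in> carrier G. \<forall>\<eta> \<in> carrier N. \<sigma>' (x (\<alpha> (rep.\<theta> (inv\<^bsub>G\<^esub> \<sigma>') \<eta>))) = x (\<alpha> \<eta>)"
    using x carrier_A by blast
  from this[THEN bspec, OF s, THEN bspec, OF \<eta>] show ?thesis .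
qed

definition T :: "((('a \<Rightarrow> 'a) set \<Rightarrow> ('a \<Rightarrow> 'a) set) \<Rightarrow> 'a) \<Rightarrow> ('n \<Rightarrow> 'a) \<Rightarrow> 'a" where
  "T x = (\<lambda>\<chi>\<in>dual.dual. dual.fourier (\<lambda>\<eta>. x (\<alpha> \<eta>)) \<chi>)"

lemma P_to_F: "x \<in> P \<rightarrow>\<^sub>E E \<Longrightarrow> (\<lambda>\<eta>. x (\<alpha> \<eta>)) \<in> carrier N \<rightarrow> carrier F"
  using EM by auto

text \<open>Invariance says that \<gamma> and \<open>twist \<gamma>\<close> together leave the
  coefficients unchanged, so \<open>fourier_equivariant\<close> becomes equivariance of the
  transform.\<close>

lemma T_mem: assumes x: "x \<in> carrier A" shows "T x \<in> carrier B"
proof -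
  have xE: "x \<in> P \<rightarrow>\<^sub>E E" using x carrier_A by blast
  have "T x (act \<gamma> \<chi>) = \<gamma> (T x \<chi>)" if g: "\<gamma> \<in> carrier \<Gamma>" and c: "\<chi> \<in> dual.dual" for \<gamma> \<chi>
  proof -
    have "\<gamma> (x (\<alpha> (twist \<gamma> \<eta>))) = x (\<alpha> \<eta>)" if \<eta>: "\<eta> \<in> carrier N" for \<eta>
    proof -
      have "twist \<gamma> \<eta> \<in> carrier N" using \<theta>_restrict_closed g \<eta> by simp
      then have "x (\<alpha> (twist \<gamma> \<eta>)) \<in> E" using xE by auto
      moreover have "restrict \<gamma> E (x (\<alpha> (twist \<gamma> \<eta>))) = x (\<alpha> \<eta>)"
        unfolding restrict_inv[OF g] by (rule A_fixed[OF x restrict_closed[OF g] \<eta>])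
      ultimately show ?thesis by (simp only: restrict_apply')
    qed
    then have "dual.fourier (\<lambda>\<eta>. \<gamma> (x (\<alpha> (twist \<gamma> \<eta>)))) (act \<gamma> \<chi>) = dual.fourier (\<lambda>\<eta>. x (\<alpha> \<eta>)) (act \<gamma> \<chi>)"
      by (rule dual.fourier_cong[OF _ P_to_F[OF xE] act_closed[OF g c]])
    then show ?thesis
      using fourier_equivariant[OF g c P_to_F[OF xE]] act_closed[OF g c] c by (simp add: T_def)
  qed
  moreover have "T x \<in> dual.dual \<rightarrow>\<^sub>E carrier F"
    using dual.fourier_closed[OF P_to_F[OF xE]] by (auto simp: T_def)
  ultimately show ?thesis by (simp add: equivariant_algebra_def)
qed

text \<open>Stated for all E-valued functions on P, invariant or not, so that
  \<open>fixed_algebra_closed\<close> can recognize an element of \<open>A\<close> by its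
  transform.\<close>

lemma T_inj:
  assumes x: "x \<in> P \<rightarrow>\<^sub>E E" and y: "y \<in> P \<rightarrow>\<^sub>E E" and eq: "T x = T y"
  shows "x = y"
proof (rule extensionalityI[of _ P])
  fix \<nu> assume "\<nu> \<in> P"
  then obtain \<eta> where \<eta>: "\<eta> \<in> carrier N" "\<nu> = \<alpha> \<eta>" by auto
  have "dual.fourier (\<lambda>\<eta>. x (\<alpha> \<eta>)) \<chi> = dual.fourier (\<lambda>\<eta>. y (\<alpha> \<eta>)) \<chi>" if "\<chi> \<in> dual.dual" for \<chi>
    using fun_cong[OF eq, of \<chi>] that by (simp add: T_def)
  from dual.fourier_inj[OF P_to_F[OF x] P_to_F[OF y] this \<eta>(1)] show "x \<nu> = y \<nu>" using \<eta>(2) by simp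
qed (use x y in \<open>auto simp: PiE_iff\<close>)

text \<open>Fourier inversion gives coefficients in E(\<zeta>); equivariance of f and injectivity of
  the transform make them \<Gamma>-invariant. An element trivial on E has trivial twist, so it fixes
  each coefficient, which therefore lies in E. Lifting elements of G to \<Gamma> then gives the
  invariance that defines \<open>A\<close>.\<close>

lemma T_surj:
  assumes f: "f \<in> carrier B" shows "\<exists>x \<in> carrier A. T x = f"
proof -
  have fc: "f \<chi> \<in> carrier F" if "\<chi> \<in> dual.dual" for \<chi> using eqv.value_closed[OF f that] .
  obtain y where y: "y \<in> carrier N \<rightarrow> carrier F" "\<And>\<chi>. \<chi> \<in> dual.dual \<Longrightarrow> dual.fourier y \<chi> = f \<chi>"
    using dual.fourier_surj[of f] fc by blast
  have inv: "\<gamma> (y (twist \<gamma> \<eta>)) = y \<eta>" if g: "\<gamma> \<in> carrier \<Gamma>" and \<eta>: "\<eta> \<in> carrier N" for \<gamma> \<eta>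
  proof (rule dual.fourier_inj[OF _ y(1) _ \<eta>])
    have i: "inv\<^bsub>\<Gamma>\<^esub> \<gamma> \<in> carrier \<Gamma>" using g by simp
    show "(\<lambda>\<eta>. \<gamma> (y (twist \<gamma> \<eta>))) \<in> carrier N \<rightarrow> carrier F"
      using aut.closed[OF g funcset_mem[OF y(1) \<theta>_restrict_closed[OF i]]] by blast
    fix \<chi> assume c: "\<chi> \<in> dual.dual"
    \<comment> \<open>Writing \<chi> as the translate of \<psi> by \<gamma> brings the transform
      into the form of \<open>fourier_equivariant\<close>.\<close>
    define \<psi> where "\<psi> = act (inv\<^bsub>\<Gamma>\<^esub> \<gamma>) \<chi>"
    have \<psi>: "\<psi> \<in> dual.dual" "act \<gamma> \<psi> = \<chi>"
      using act_closed[OF i c] eqv.act_mult[OF g i c] eqv.act_one[OF c] g by (simp_all add: \<psi>_def)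
    have "dual.fourier (\<lambda>\<eta>. \<gamma> (y (twist \<gamma> \<eta>))) \<chi> = \<gamma> (dual.fourier y \<psi>)"
      using fourier_equivariant[OF g \<psi>(1) y(1)] \<psi>(2) by simp
    also have "\<dots> = f \<chi>" using y(2)[OF \<psi>(1)] f g \<psi> by (auto simp: equivariant_algebra_def)
    finally show "dual.fourier (\<lambda>\<eta>. \<gamma> (y (twist \<gamma> \<eta>))) \<chi> = dual.fourier y \<chi>"
      using y(2)[OF c] by simp
  qed
  have yE: "y \<eta> \<in> E" if \<eta>: "\<eta> \<in> carrier N" for \<eta>
  proof (rule fixed_by_relative_galois_group)
    show "y \<eta> \<in> M" using y(1) \<eta> by auto
    fix \<gamma> assume g: "\<gamma> \<in> carrier \<Gamma>" and id: "\<And>a. a \<in> E \<Longrightarrow> \<gamma> a = a"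
    have "restrict \<gamma> E = \<one>\<^bsub>G\<^esub>" using id by (auto simp: galois_group_one)
    then have "restrict (inv\<^bsub>\<Gamma>\<^esub> \<gamma>) E = \<one>\<^bsub>G\<^esub>" by (simp add: restrict_inv[OF g])
    then show "\<gamma> (y \<eta>) = y \<eta>" using inv[OF g \<eta>] rep.\<theta>_one[OF \<eta>] by simp
  qed
  define x where "x = (\<lambda>\<nu>\<in>P. y (inv_into (carrier N) \<alpha> \<nu>))"
  have x\<alpha>: "x (\<alpha> \<eta>) = y \<eta>" if "\<eta> \<in> carrier N" for \<eta> using that rep.inj by (simp add: x_def)
  have "x \<in> carrier A"
    unfolding carrier_A
  proof (intro conjI ballI)
    show "x \<in> P \<rightarrow>\<^sub>E E"
    proof (rule PiE_I)
      fix \<nu> assume "\<nu> \<in> P"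
      then obtain \<eta> where "\<eta> \<in> carrier N" "\<nu> = \<alpha> \<eta>" by blast
      then show "x \<nu> \<in> E" using x\<alpha> yE by simp
    qed (simp add: x_def)
    fix \<sigma>' \<eta> assume s: "\<sigma>' \<in> carrier G" and \<eta>: "\<eta> \<in> carrier N"
    obtain \<gamma> where g: "\<gamma> \<in> carrier \<Gamma>" "restrict \<gamma> E = \<sigma>'" using restriction_surj[OF s] by blast
    have t: "rep.\<theta> (inv\<^bsub>G\<^esub> \<sigma>') \<eta> \<in> carrier N" using rep.\<theta>_closed s \<eta> by simp
    have "\<sigma>' z = \<gamma> z" if "z \<in> E" for z using that fun_cong[OF g(2), of z] by simp
    from this[OF yE[OF t]] have "\<sigma>' (y (rep.\<theta> (inv\<^bsub>G\<^esub> \<sigma>') \<eta>)) = \<gamma> (y (rep.\<theta> (inv\<^bsub>G\<^esub> \<sigma>') \<eta>))" .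
    also have "\<dots> = y \<eta>" using inv[OF g(1) \<eta>] restrict_inv[OF g(1)] g(2) by simp
    finally show "\<sigma>' (x (\<alpha> (rep.\<theta> (inv\<^bsub>G\<^esub> \<sigma>') \<eta>))) = x (\<alpha> \<eta>)" using x\<alpha> t \<eta> by simp
  qed
  moreover have "T x = f"
  proof (rule extensionalityI[of _ dual.dual])
    fix \<chi> assume c: "\<chi> \<in> dual.dual"
    have "dual.fourier (\<lambda>\<eta>. x (\<alpha> \<eta>)) \<chi> = dual.fourier y \<chi>"
      by (rule dual.fourier_cong[OF x\<alpha> y(1) c])
    then show "T x \<chi> = f \<chi>" using y(2)[OF c] c by (simp add: T_def)
  qed (use f in \<open>auto simp: T_def equivariant_algebra_def PiE_iff\<close>)
  ultimately show ?thesis by blast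
qed

lemma A_ops:
  "\<eta> \<in> carrier N \<Longrightarrow> (x \<oplus>\<^bsub>A\<^esub> y) (\<alpha> \<eta>) = x (\<alpha> \<eta>) \<oplus> y (\<alpha> \<eta>)"
  "\<eta> \<in> carrier N \<Longrightarrow> (k \<odot>\<^bsub>A\<^esub> x) (\<alpha> \<eta>) = k \<otimes> x (\<alpha> \<eta>)"
  "\<eta> \<in> carrier N \<Longrightarrow> \<one>\<^bsub>A\<^esub> (\<alpha> \<eta>) = (if \<eta> = \<one>\<^bsub>N\<^esub> then \<one> else \<zero>)"
  using rep.\<alpha>_one inj_on_eq_iff[OF rep.inj _ rep.N.one_closed]
  by (auto simp: fixed_group_algebra_def group_algebra_def Let_def)

text \<open>\<alpha> is an isomorphism onto P, so the convolution over P becomes one over N; the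
  passage from sums in E to sums in E(\<zeta>) goes through R.\<close>

lemma A_mult:
  assumes x: "x \<in> P \<rightarrow>\<^sub>E E" and y: "y \<in> P \<rightarrow>\<^sub>E E" and \<eta>: "\<eta> \<in> carrier N"
  shows "(x \<otimes>\<^bsub>A\<^esub> y) (\<alpha> \<eta>) = (\<Oplus>\<^bsub>F\<^esub>k\<in>carrier N. x (\<alpha> k) \<otimes>\<^bsub>F\<^esub> y (\<alpha> (inv\<^bsub>N\<^esub> k \<otimes>\<^bsub>N\<^esub> \<eta>)))"
proof -
  let ?S = "rep.S\<lparr>carrier := P\<rparr>"
  have eq: "inv\<^bsub>?S\<^esub> (\<alpha> k) \<otimes>\<^bsub>rep.S\<^esub> \<alpha> \<eta> = \<alpha> (inv\<^bsub>N\<^esub> k \<otimes>\<^bsub>N\<^esub> \<eta>)" if "k \<in> carrier N" for k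
    using rep.\<alpha>_inv[OF that] rep.\<alpha>_mult[of "inv\<^bsub>N\<^esub> k" \<eta>] that \<eta> by simp
  have xyE: "x (\<alpha> k) \<otimes> y (\<alpha> (inv\<^bsub>N\<^esub> k \<otimes>\<^bsub>N\<^esub> \<eta>)) \<in> E" if k: "k \<in> carrier N" for k
  proof -
    have "inv\<^bsub>N\<^esub> k \<otimes>\<^bsub>N\<^esub> \<eta> \<in> carrier N" using k \<eta> by simp
    then show ?thesis using x y k by (intro subringE(6)[OF subfieldE(1)[OF E]]) auto
  qed
  have ER: "z \<in> E \<Longrightarrow> z \<in> carrier R" for z using subfieldE(3)[OF E] by auto
  have "(x \<otimes>\<^bsub>A\<^esub> y) (\<alpha> \<eta>) = (\<Oplus>\<^bsub>R\<lparr>carrier := E\<rparr>\<^esub>\<nu>\<in>P. x \<nu> \<otimes> y (inv\<^bsub>?S\<^esub> \<nu> \<otimes>\<^bsub>rep.S\<^esub> \<alpha> \<eta>))"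
    using \<eta> by (simp add: fixed_group_algebra_def group_algebra_def Let_def)
  also have "\<dots> = (\<Oplus>\<nu>\<in>P. x \<nu> \<otimes> y (inv\<^bsub>?S\<^esub> \<nu> \<otimes>\<^bsub>rep.S\<^esub> \<alpha> \<eta>))"
    using xyE eq by (intro finsum_subring[OF subfieldE(1)[OF E]]) auto
  also have "\<dots> = (\<Oplus>k\<in>carrier N. x (\<alpha> k) \<otimes> y (inv\<^bsub>?S\<^esub> (\<alpha> k) \<otimes>\<^bsub>rep.S\<^esub> \<alpha> \<eta>))"
    using xyE eq ER by (intro finsum_reindex[OF _ rep.inj]) auto
  also have "\<dots> = (\<Oplus>k\<in>carrier N. x (\<alpha> k) \<otimes> y (\<alpha> (inv\<^bsub>N\<^esub> k \<otimes>\<^bsub>N\<^esub> \<eta>)))"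
    using xyE eq ER by (intro finsum_cong') auto
  also have "\<dots> = (\<Oplus>\<^bsub>F\<^esub>k\<in>carrier N. x (\<alpha> k) \<otimes> y (\<alpha> (inv\<^bsub>N\<^esub> k \<otimes>\<^bsub>N\<^esub> \<eta>)))"
    using xyE EM by (intro finsum_subring[OF subfieldE(1)[OF M], symmetric]) auto
  finally show ?thesis by simp
qed

lemma A_ops_mem:
  assumes x: "x \<in> P \<rightarrow>\<^sub>E E" and y: "y \<in> P \<rightarrow>\<^sub>E E"
  shows "x \<oplus>\<^bsub>A\<^esub> y \<in> P \<rightarrow>\<^sub>E E" "x \<otimes>\<^bsub>A\<^esub> y \<in> P \<rightarrow>\<^sub>E E" "k \<in> K \<Longrightarrow> k \<odot>\<^bsub>A\<^esub> x \<in> P \<rightarrow>\<^sub>E E" "\<one>\<^bsub>A\<^esub> \<in> P \<rightarrow>\<^sub>E E"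
proof -
  note sub = subringE[OF subfieldE(1)[OF E]]
  interpret E: field "R\<lparr>carrier := E\<rparr>" using E by (rule subfield_iff(2))
  interpret Pg: group "rep.S\<lparr>carrier := P\<rparr>"
    using rep.\<alpha>_subgroup by (rule subgroup.subgroup_is_group) (rule group_BijGroup)
  have xy: "x \<nu> \<in> E" "y \<nu> \<in> E" if "\<nu> \<in> P" for \<nu> using x y that by auto
  have cl: "inv\<^bsub>rep.S\<lparr>carrier := P\<rparr>\<^esub> k \<otimes>\<^bsub>rep.S\<^esub> h \<in> P" if "k \<in> P" "h \<in> P" for k h
    using Pg.m_closed[OF Pg.inv_closed] that by simp
  show "x \<oplus>\<^bsub>A\<^esub> y \<in> P \<rightarrow>\<^sub>E E" "k \<in> K \<Longrightarrow> k \<odot>\<^bsub>A\<^esub> x \<in> P \<rightarrow>\<^sub>E E" "\<one>\<^bsub>A\<^esub> \<in> P \<rightarrow>\<^sub>E E"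
    using xy sub(2,3) sub(6,7) KE
    by (auto simp: fixed_group_algebra_def group_algebra_def Let_def subset_iff intro!: PiE_I)
  show "x \<otimes>\<^bsub>A\<^esub> y \<in> P \<rightarrow>\<^sub>E E"
  proof (rule PiE_I)
    fix h assume h: "h \<in> P"
    have "(\<Oplus>\<^bsub>R\<lparr>carrier := E\<rparr>\<^esub>k\<in>P. x k \<otimes> y (inv\<^bsub>rep.S\<lparr>carrier := P\<rparr>\<^esub> k \<otimes>\<^bsub>rep.S\<^esub> h)) \<in> carrier (R\<lparr>carrier := E\<rparr>)"
    proof (rule E.finsum_closed, rule Pi_I)
      fix k assume k: "k \<in> P"
      show "x k \<otimes> y (inv\<^bsub>rep.S\<lparr>carrier := P\<rparr>\<^esub> k \<otimes>\<^bsub>rep.S\<^esub> h) \<in> carrier (R\<lparr>carrier := E\<rparr>)"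
        using sub(6)[OF xy(1)[OF k] xy(2)[OF cl[OF k h]]] by simp
    qed
    then show "(x \<otimes>\<^bsub>A\<^esub> y) h \<in> E"
      using h by (simp add: fixed_group_algebra_def group_algebra_def Let_def)
  qed (simp add: fixed_group_algebra_def group_algebra_def Let_def)
qed

lemma T_ops:
  assumes x: "x \<in> P \<rightarrow>\<^sub>E E" and y: "y \<in> P \<rightarrow>\<^sub>E E"
  shows "T (x \<oplus>\<^bsub>A\<^esub> y) = T x \<oplus>\<^bsub>B\<^esub> T y" "T (x \<otimes>\<^bsub>A\<^esub> y) = T x \<otimes>\<^bsub>B\<^esub> T y"
    "k \<in> K \<Longrightarrow> T (k \<odot>\<^bsub>A\<^esub> x) = k \<odot>\<^bsub>B\<^esub> T x" "T \<one>\<^bsub>A\<^esub> = \<one>\<^bsub>B\<^esub>"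
proof -
  note xF = P_to_F[OF x] and yF = P_to_F[OF y]
  \<comment> \<open>It suffices to name the coefficients \<open>w\<close> of \<open>z\<close> on N
    and to compute the transform of \<open>w\<close>; this serves all four claims.\<close>
  have ext: "T z = f" if "f \<in> extensional dual.dual" "z \<in> P \<rightarrow>\<^sub>E E" "\<And>\<eta>. \<eta> \<in> carrier N \<Longrightarrow> z (\<alpha> \<eta>) = w \<eta>"
    "\<And>\<chi>. \<chi> \<in> dual.dual \<Longrightarrow> dual.fourier w \<chi> = f \<chi>" for z f w
  proof (rule extensionalityI[of _ dual.dual])
    fix \<chi> assume c: "\<chi> \<in> dual.dual"
    have "dual.fourier w \<chi> = dual.fourier (\<lambda>\<eta>. z (\<alpha> \<eta>)) \<chi>"
      using that(3) by (intro dual.fourier_cong[OF _ P_to_F[OF that(2)] c]) simp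
    then show "T z \<chi> = f \<chi>" using that(4)[OF c] c by (simp add: T_def)
  qed (use that(1) in \<open>simp_all add: T_def\<close>)
  have Be: "T x \<oplus>\<^bsub>B\<^esub> T y \<in> extensional dual.dual" "T x \<otimes>\<^bsub>B\<^esub> T y \<in> extensional dual.dual"
     "k \<odot>\<^bsub>B\<^esub> T x \<in> extensional dual.dual" "\<one>\<^bsub>B\<^esub> \<in> extensional dual.dual"
    by (auto simp: equivariant_algebra_def)
  show "T (x \<oplus>\<^bsub>A\<^esub> y) = T x \<oplus>\<^bsub>B\<^esub> T y"
    using dual.fourier_add[OF xF yF]
    by (intro ext[OF Be(1) A_ops_mem(1)[OF x y] A_ops(1)]) (simp_all add: eqv.add_eval T_def)
  show "T (x \<otimes>\<^bsub>A\<^esub> y) = T x \<otimes>\<^bsub>B\<^esub> T y"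
    using dual.fourier_convolution[OF xF yF]
    by (intro ext[OF Be(2) A_ops_mem(2)[OF x y] A_mult[OF x y]]) (simp_all add: eqv.mult_eval T_def)
  show "T (k \<odot>\<^bsub>A\<^esub> x) = k \<odot>\<^bsub>B\<^esub> T x" if k: "k \<in> K"
    using dual.fourier_smult[OF _ xF, of k] k KM
    by (intro ext[OF Be(3) A_ops_mem(3)[OF x y k] A_ops(2)]) (auto simp: eqv.smult_eval T_def)
  show "T \<one>\<^bsub>A\<^esub> = \<one>\<^bsub>B\<^esub>"
    using dual.fourier_unit
    by (intro ext[OF Be(4) A_ops_mem(4)[OF x y] A_ops(3)]) (simp_all add: eqv.one_eval cong: if_cong)
qed

text \<open>Closure is pulled back from \<open>B\<close>: an E-valued \<open>z\<close> on P whose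
  transform lies in \<open>B\<close> has the same transform as some element of \<open>A\<close>, and
  equals it by \<open>T_inj\<close>.\<close>

lemma fixed_algebra_closed: "algebra_closed K A"
proof -
  have sub: "x \<in> P \<rightarrow>\<^sub>E E" if "x \<in> carrier A" for x using that carrier_A by blast
  have mem: "z \<in> carrier A" if "z \<in> P \<rightarrow>\<^sub>E E" "T z \<in> carrier B" for z
    using T_surj[OF that(2)] T_inj[OF _ that(1)] sub by metis
  have B: "algebra_closed K B" using eqv.equivariant_algebra_closed fixed_field_M by simp
  have Bc: "f \<otimes>\<^bsub>B\<^esub> g \<in> carrier B" "f \<oplus>\<^bsub>B\<^esub> g \<in> carrier B" "k \<in> K \<Longrightarrow> k \<odot>\<^bsub>B\<^esub> f \<in> carrier B"
    if "f \<in> carrier B" "g \<in> carrier B" for f g k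
    using B that unfolding algebra_closed_def by blast+
  have one: "\<one>\<^bsub>A\<^esub> \<in> carrier A" if "x \<in> carrier A" for x
    using that B A_ops_mem(4)[OF sub sub] T_ops(4)[OF sub sub] by (intro mem) (auto simp: algebra_closed_def)
  \<comment> \<open>The facts about the unit take two E-valued functions as arguments; a preimage of
    the unit of \<open>B\<close> supplies them.\<close>
  obtain x where "x \<in> carrier A" using T_surj[of "\<one>\<^bsub>B\<^esub>"] B by (auto simp: algebra_closed_def)
  from one[OF this] show ?thesis
    unfolding algebra_closed_def
  proof (intro conjI ballI)
    fix x y assume x: "x \<in> carrier A" and y: "y \<in> carrier A"
    show "x \<otimes>\<^bsub>A\<^esub> y \<in> carrier A"
      using mem[OF A_ops_mem(2)[OF sub[OF x] sub[OF y]]] Bc(1)[OF T_mem[OF x] T_mem[OF y]]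
      unfolding T_ops(2)[OF sub[OF x] sub[OF y]] by blast
    show "x \<oplus>\<^bsub>A\<^esub> y \<in> carrier A"
      using mem[OF A_ops_mem(1)[OF sub[OF x] sub[OF y]]] Bc(2)[OF T_mem[OF x] T_mem[OF y]]
      unfolding T_ops(1)[OF sub[OF x] sub[OF y]] by blast
  next
    fix x k assume x: "x \<in> carrier A" and k: "k \<in> K"
    show "k \<odot>\<^bsub>A\<^esub> x \<in> carrier A"
      using mem[OF A_ops_mem(3)[OF sub[OF x] sub[OF x] k]] Bc(3)[OF T_mem[OF x] T_mem[OF x] k]
      unfolding T_ops(3)[OF sub[OF x] sub[OF x] k] by blast
  qed
qed

lemma fixed_algebra_isomorphic: "algebra_isomorphic K A B"
proof -
  have sub: "x \<in> P \<rightarrow>\<^sub>E E" if "x \<in> carrier A" for x using that carrier_A by blast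
  have "bij_betw T (carrier A) (carrier B)"
    unfolding bij_betw_def using T_inj sub T_mem T_surj by (auto simp: inj_on_def) blast
  moreover obtain x where "x \<in> carrier A" using fixed_algebra_closed by (auto simp: algebra_closed_def)
  then have "T \<in> ring_hom A B"
    using T_mem T_ops(1,2,4)[OF sub sub] by (intro ring_hom_memI) auto
  ultimately show ?thesis
    using T_ops(3)[OF sub sub] by (auto simp: algebra_isomorphic_def ring_iso_def)
qed

end

text \<open>Both fixed rings are replaced by algebras of equivariant functions with the same field
  E(\<zeta>), the same group and the same set of characters; only the actions differ.\<close>

lemma fixed_algebras_isomorphic_iff:
  assumes "fixed_algebra R K E \<zeta> N H \<alpha>1" "fixed_algebra R K E \<zeta> N H \<alpha>2"
    and M: "M = generate_field R (E \<union> {\<zeta>})" and G: "G = galois_group R E K" and \<Gamma>: "\<Gamma> = galois_group R M K"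
  shows "algebra_isomorphic K
           (fixed_group_algebra R E G H (\<alpha>1 ` carrier N)) (fixed_group_algebra R E G H (\<alpha>2 ` carrier N))
         \<longleftrightarrow>
         gset_isomorphic \<Gamma>
           (characters N (R\<lparr>carrier := M\<rparr>)) (galois_act_char N E G H \<Gamma> \<alpha>1)
           (characters N (R\<lparr>carrier := M\<rparr>)) (galois_act_char N E G H \<Gamma> \<alpha>2)"
proof -
  interpret f1: fixed_algebra R K E \<zeta> N H \<alpha>1 by fact
  interpret f2: fixed_algebra R K E \<zeta> N H \<alpha>2 by fact
  have M': "M = f1.M" by (simp add: M f1.M_def)
  \<comment> \<open>The order is reversed on the right to match the contravariance of
    \<open>algebra_isomorphic_iff_gset_isomorphic\<close>.\<close>
  have "algebra_isomorphic K f1.A f2.A \<longleftrightarrow> algebra_isomorphic K f2.B f1.B"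
  proof
    assume "algebra_isomorphic K f1.A f2.A"
    then have "algebra_isomorphic K f2.A f1.A" by (rule algebra_isomorphic_sym[OF f1.fixed_algebra_closed])
    moreover have "algebra_isomorphic K f2.B f2.A"
      by (rule algebra_isomorphic_sym[OF f2.fixed_algebra_closed f2.fixed_algebra_isomorphic])
    ultimately show "algebra_isomorphic K f2.B f1.B"
      using f1.fixed_algebra_isomorphic by (blast intro: algebra_isomorphic_trans)
  next
    assume iso: "algebra_isomorphic K f2.B f1.B"
    have "algebra_closed K f2.B" using f2.eqv.equivariant_algebra_closed f1.fixed_field_M by simp
    from algebra_isomorphic_sym[OF this iso] have "algebra_isomorphic K f1.B f2.B" .
    moreover have "algebra_isomorphic K f2.B f2.A"
      by (rule algebra_isomorphic_sym[OF f2.fixed_algebra_closed f2.fixed_algebra_isomorphic])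
    ultimately show "algebra_isomorphic K f1.A f2.A"
      using f1.fixed_algebra_isomorphic by (blast intro: algebra_isomorphic_trans)
  qed
  \<comment> \<open>The two \<Gamma>-sets have the same underlying set, so \<open>refl\<close>
    proves equality of cardinalities.\<close>
  also have "\<dots> \<longleftrightarrow> gset_isomorphic f1.\<Gamma> f1.dual.dual f1.act f1.dual.dual f2.act"
    using algebra_isomorphic_iff_gset_isomorphic[OF f1.eqv.equivariant_axioms f2.eqv.equivariant_axioms refl f1.dual.char]
      f1.fixed_field_M by simp
  finally show ?thesis unfolding \<Gamma> M' G .
qed

theorem theorem3p5:
  fixes R :: "('a, 'b) ring_scheme"
    and K L E E' :: "'a set"
    and N :: "('n, 'c) monoid_scheme"
    and G \<Gamma> :: "('a \<Rightarrow> 'a) monoid"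
    and GL :: "('a \<Rightarrow> 'a) set"
    and Q :: "('a \<Rightarrow> 'a) set set"
    and \<alpha>1 \<alpha>2 :: "'n \<Rightarrow> ('a \<Rightarrow> 'a) set \<Rightarrow> ('a \<Rightarrow> 'a) set"
    and \<zeta> :: 'a
  assumes "field R"
    and "subfield K R"
    and "\<And>n :: nat. 0 < n \<Longrightarrow> [n] \<cdot>\<^bsub>R\<^esub> \<one>\<^bsub>R\<^esub> \<noteq> \<zero>\<^bsub>R\<^esub>"
    and "subfield L R" and "K \<subseteq> L"
    and "ring.finite_dimension R K L"
    and "separable_extension R K L"
    and "galois_closure R K L E"
    and "G = galois_group R E K"
    and "GL = carrier (galois_group R E L)"
    and "Q = lcosets\<^bsub>G\<^esub> GL"
    and "comm_group N" and "finite (carrier N)"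
    and "order N = card Q"
    and "\<alpha>1 \<in> hom N (BijGroup Q)" and "inj_on \<alpha>1 (carrier N)"
    and "regular_subgroup Q (\<alpha>1 ` carrier N)"
    and "coset_translation G GL ` carrier G \<subseteq> normalizer (BijGroup Q) (\<alpha>1 ` carrier N)"
    and "\<alpha>2 \<in> hom N (BijGroup Q)" and "inj_on \<alpha>2 (carrier N)"
    and "regular_subgroup Q (\<alpha>2 ` carrier N)"
    and "coset_translation G GL ` carrier G \<subseteq> normalizer (BijGroup Q) (\<alpha>2 ` carrier N)"
    and "primitive_root_of_unity R (group_exponent N) \<zeta>"
    and "E' = generate_field R (E \<union> {\<zeta>})"
    and "\<Gamma> = galois_group R E' K"
  shows "algebra_isomorphic K
           (fixed_group_algebra R E G GL (\<alpha>1 ` carrier N))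
           (fixed_group_algebra R E G GL (\<alpha>2 ` carrier N))
         \<longleftrightarrow>
         gset_isomorphic \<Gamma>
           (characters N (R\<lparr>carrier := E'\<rparr>)) (galois_act_char N E G GL \<Gamma> \<alpha>1)
           (characters N (R\<lparr>carrier := E'\<rparr>)) (galois_act_char N E G GL \<Gamma> \<alpha>2)"
proof -
  interpret R: field R by fact
  have E: "subfield E R" "K \<subseteq> E" "R.finite_dimension K E" "normal_extension R K E"
    using \<open>galois_closure R K L E\<close> by (auto simp: galois_closure_def finite_galois_extension_def)
  have N: "group N" using \<open>comm_group N\<close> by (rule comm_group.axioms(2))
  have "GL \<subseteq> carrier G"
    using \<open>K \<subseteq> L\<close> unfolding \<open>GL = _\<close> \<open>G = _\<close> galois_group_def by auto
  \<comment> \<open>Stated for an arbitrary \<alpha>, so that it applies to both embeddings.\<close>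
  then have "fixed_algebra R K E \<zeta> N GL \<alpha>"
    if "\<alpha> \<in> hom N (BijGroup Q)" "inj_on \<alpha> (carrier N)" "regular_subgroup Q (\<alpha> ` carrier N)"
      "coset_translation G GL ` carrier G \<subseteq> normalizer (BijGroup Q) (\<alpha> ` carrier N)" for \<alpha>
    using that assms E N group_exponent(1)[OF N] R.galois_group_is_group
    by (intro fixed_algebra.intro cyclotomic_extension.intro cyclotomic_extension_axioms.intro
        regular_representation.intro fixed_algebra_axioms.intro) auto
  from fixed_algebras_isomorphic_iff[OF this this \<open>E' = _\<close> \<open>G = _\<close> \<open>\<Gamma> = _\<close>] assms
  show ?thesis by blast
qed

end
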